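(* Let $n$ be a positive integer and let $\{\mathtt{R}_i : i\in I\}$ be a set of right cells in $S_n$ containing exactly one representative (i.e. exactly one right cell) from each two-sided cell of $S_n$. For $w\in S_n$ set $f_w=\mathrm{ev}(\hat{\underline{H}}_{\overline{w}}\,\underline{H}_w)$, where $\overline{w}$ is the unique involution in the right cell of $w$, and for $i\in I$ and $(x,y)\in\mathtt{R}_i\times\mathtt{R}_i$ set $h^i_{(x,y)}=\mathrm{ev}(\hat{\underline{H}}_{x^{-1}}\,\underline{H}_y)$. Then, as subsets of $\mathbb{C}[S_n]$, $$\{f_w\mid w\in S_n\}=\{h^i_{(x,y)}\mid i\in I,\ (x,y)\in\mathtt{R}_i\times\mathtt{R}_i\}.$$
   Context: Hecke algebra. $S_n$ is the symmetric group on $\{1,\dots,n\}$ (permutations composed as functions, from right to left), $\mathcal{S}$ the set of simple transpositions $(i,i+1)$, $l$ the length function, $e$ the identity. The Hecke algebra $\mathcal{H}$ is the free $\mathbb{Z}[v,v^{-1}]$-module with basis $\{H_w\mid w\in S_n\}$ and multiplication $H_xH_y=H_{xy}$ if $l(x)+l(y)=l(xy)$, and $H_s^2=H_e+(v^{-1}-v)H_s$ for $s\in \mathcal{S}$. The Kazhdan-Lusztig basis $\{\underline{H}_w\}$ (Soergel's normalization): $\underline{H}_w$ is the unique element of $H_w+\sum_{y\neq w}v\mathbb{Z}[v]H_y$ fixed by the ring involution $v\mapsto v^{-1}$, $H_y\mapsto (H_{y^{-1}})^{-1}$; e.g. $\underline{H}_s=H_s+vH_e$. Let $\tau:\mathcal{H}\to\mathbb{Z}[v,v^{-1}]$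 be the $\mathbb{Z}[v,v^{-1}]$-linear trace form with $\tau(H_w)=\delta_{w,e}$. The dual Kazhdan-Lusztig basis $\{\hat{\underline{H}}_w\}$ is defined by $\tau(\hat{\underline{H}}_x\underline{H}_{w^{-1}})=\delta_{x,w}$ for all $x,w\in S_n$. The evaluation map $\mathrm{ev}:\mathbb{C}\otimes_{\mathbb{Z}}\mathcal{H}\to\mathbb{C}[S_n]$ is the $\mathbb{C}$-algebra epimorphism given by specializing $v=1$, $H_w\mapsto w$. Cells. The Robinson-Schensted correspondence is the bijection $w\mapsto(a(w),b(w))$ from $S_n$ to pairs of standard tableaux with $n$ boxes of the same shape, where $a(w)$ is the insertion tableau and $b(w)$ the recording tableau of the word $w(1)w(2)\cdots w(n)$. The right cell of $w$ is $\mathtt{R}_w=\{x\in S_n\mid a(x)=a(w)\}$; $\overline{w}$ is the unique involution (element with square $e$) in $\mathtt{R}_w$. Two elements $x,y\in S_n$ lie in the same two-sided cell if and only if $a(x)$ and $a(y)$ have the same shape; each two-sided cell is a union of right cells. *)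

theory Defs
  imports
    Complex_Main
    "HOL-Library.Poly_Mapping"
    "HOL-Combinatorics.Transposition"
    "HOL-Algebra.Ring"
    "HOL-Algebra.Sym_Groups"
begin

section \<open>The symmetric group and its length function\<close>

abbreviation Sym :: "nat \<Rightarrow> (nat \<Rightarrow> nat) set" where
  "Sym n \<equiv> carrier (sym_group n)"

definition simple_transpositions :: "nat \<Rightarrow> (nat \<Rightarrow> nat) set" where
  "simple_transpositions n = {transpose i (Suc i) | i. 1 \<le> i \<and> Suc i \<le> n}"

definition len :: "nat \<Rightarrow> (nat \<Rightarrow> nat) \<Rightarrow> nat" where
  "len n w = (LEAST k. \<exists>ss. length ss = k \<and> set ss \<subseteq> simple_transpositions n
                           \<and> w = foldr (\<circ>) ss id)"


section \<open>The ring of integral Laurent polynomials in \<open>v\<close>\<close>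

text \<open>A Laurent polynomial is the finitely supported map sending an exponent to its coefficient;
  \<^typ>\<open>int \<Rightarrow>\<^sub>0 int\<close> carries the convolution product.\<close>

type_synonym laurent = "int \<Rightarrow>\<^sub>0 int"

definition vpow :: "int \<Rightarrow> laurent" where
  "vpow k = Poly_Mapping.single k 1"

text \<open>The ring automorphism exchanging \<open>v\<close> and its inverse.\<close>

definition laurent_bar :: "laurent \<Rightarrow> laurent" where
  "laurent_bar p = Poly_Mapping.map_key uminus p"

text \<open>The subset \<open>v\<int>[v]\<close>.\<close>

definition vZv :: "laurent set" where
  "vZv = {p. Poly_Mapping.keys p \<subseteq> {k. 0 < k}}"

text \<open>The value at \<open>v = 1\<close>.\<close>

definition laurent_at_1 :: "laurent \<Rightarrow> int" where
  "laurent_at_1 p = (\<Sum>k\<in>Poly_Mapping.keys p. Poly_Mapping.lookup p k)"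


section \<open>The Hecke algebra\<close>

text \<open>Elements of the Hecke algebra are the finitely supported maps from permutations to Laurent
  polynomials whose support lies in \<open>S\<^sub>n\<close>. The product of \<^typ>\<open>laurent\<close> does not extend to this
  type (the keys are not an additive monoid), so the multiplication below is the only one.\<close>

type_synonym hecke = "(nat \<Rightarrow> nat) \<Rightarrow>\<^sub>0 laurent"

definition hecke_carrier :: "nat \<Rightarrow> hecke set" where
  "hecke_carrier n = {h. Poly_Mapping.keys h \<subseteq> Sym n}"

definition hscale :: "laurent \<Rightarrow> hecke \<Rightarrow> hecke" where
  "hscale c h = Poly_Mapping.map ((*) c) h"

definition H :: "(nat \<Rightarrow> nat) \<Rightarrow> hecke" where
  "H w = Poly_Mapping.single w 1"

definition hecke_ring_with :: "nat \<Rightarrow> (hecke \<Rightarrow> hecke \<Rightarrow> hecke) \<Rightarrow> hecke ring" where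
  "hecke_ring_with n M =
     \<lparr>carrier = hecke_carrier n, monoid.mult = M, one = H id, zero = 0, add = (+)\<rparr>"

text \<open>The multiplications turning the free module into an associative unital algebra in which the
  two families of defining relations hold. The values of such a multiplication on the carrier are
  determined by these conditions.\<close>

definition is_hecke_mult :: "nat \<Rightarrow> (hecke \<Rightarrow> hecke \<Rightarrow> hecke) \<Rightarrow> bool" where
  "is_hecke_mult n M \<longleftrightarrow>
     ring (hecke_ring_with n M) \<and>
     (\<forall>c. \<forall>a\<in>hecke_carrier n. \<forall>b\<in>hecke_carrier n.
        M (hscale c a) b = hscale c (M a b) \<and> M a (hscale c b) = hscale c (M a b)) \<and>
     (\<forall>x\<in>Sym n. \<forall>y\<in>Sym n. len n x + len n y = len n (x \<circ> y) \<longrightarrow> M (H x) (H y) = H (x \<circ> y)) \<and>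
     (\<forall>s\<in>simple_transpositions n. M (H s) (H s) = H id + hscale (vpow (-1) - vpow 1) (H s))"

definition hecke :: "nat \<Rightarrow> hecke ring" where
  "hecke n = hecke_ring_with n (SOME M. is_hecke_mult n M)"


section \<open>The Kazhdan-Lusztig basis and its dual\<close>

definition hecke_bar :: "nat \<Rightarrow> hecke \<Rightarrow> hecke" where
  "hecke_bar n h =
     (\<Sum>y\<in>Sym n. hscale (laurent_bar (Poly_Mapping.lookup h y)) (inv\<^bsub>hecke n\<^esub> (H (inv' y))))"

definition kl :: "nat \<Rightarrow> (nat \<Rightarrow> nat) \<Rightarrow> hecke" where
  "kl n w = (THE C. C \<in> carrier (hecke n) \<and> hecke_bar n C = C \<and>
     (\<exists>p. (\<forall>y\<in>Sym n - {w}. p y \<in> vZv) \<and> C = H w + (\<Sum>y\<in>Sym n - {w}. hscale (p y) (H y))))"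

definition trace_form :: "hecke \<Rightarrow> laurent" where
  "trace_form h = Poly_Mapping.lookup h id"

definition dual_kl :: "nat \<Rightarrow> (nat \<Rightarrow> nat) \<Rightarrow> hecke" where
  "dual_kl n x = (THE D. D \<in> carrier (hecke n) \<and>
     (\<forall>w\<in>Sym n. trace_form (D \<otimes>\<^bsub>hecke n\<^esub> kl n (inv' w)) = (if x = w then 1 else 0)))"


section \<open>Evaluation at \<open>v = 1\<close>\<close>

text \<open>Elements of \<open>\<complex>[S\<^sub>n]\<close> are finitely supported complex functions on permutations. Only the values
  of the evaluation map on the integral form are needed, i.e. its composition with
  \<open>h \<mapsto> 1 \<otimes> h\<close>.\<close>

definition ev :: "hecke \<Rightarrow> ((nat \<Rightarrow> nat) \<Rightarrow>\<^sub>0 complex)" where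
  "ev h = Poly_Mapping.map (\<lambda>p. of_int (laurent_at_1 p)) h"


section \<open>Robinson-Schensted insertion and cells\<close>

text \<open>A tableau is the list of its rows, from top to bottom. Inserting \<open>x\<close> into a row replaces the
  leftmost entry larger than \<open>x\<close>, which is then returned, or else appends \<open>x\<close>.\<close>

fun row_insert :: "nat \<Rightarrow> nat list \<Rightarrow> nat list \<times> nat option" where
  "row_insert x [] = ([x], None)"
| "row_insert x (y # ys) =
     (if x < y then (x # ys, Some y)
      else (case row_insert x ys of (zs, b) \<Rightarrow> (y # zs, b)))"

fun tableau_insert :: "nat \<Rightarrow> nat list list \<Rightarrow> nat list list" where
  "tableau_insert x [] = [[x]]"
| "tableau_insert x (r # rs) =
     (case row_insert x r of
        (r', None) \<Rightarrow> r' # rs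
      | (r', Some y) \<Rightarrow> r' # tableau_insert y rs)"

definition insertion_tableau :: "nat \<Rightarrow> (nat \<Rightarrow> nat) \<Rightarrow> nat list list" where
  "insertion_tableau n w = fold tableau_insert (map w [1..<Suc n]) []"

definition shape :: "nat list list \<Rightarrow> nat list" where
  "shape t = map length t"

definition right_cell :: "nat \<Rightarrow> (nat \<Rightarrow> nat) \<Rightarrow> (nat \<Rightarrow> nat) set" where
  "right_cell n w = {x \<in> Sym n. insertion_tableau n x = insertion_tableau n w}"

definition right_cells :: "nat \<Rightarrow> (nat \<Rightarrow> nat) set set" where
  "right_cells n = right_cell n ` Sym n"

definition two_sided_cell :: "nat \<Rightarrow> (nat \<Rightarrow> nat) \<Rightarrow> (nat \<Rightarrow> nat) set" where
  "two_sided_cell n w =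
     {x \<in> Sym n. shape (insertion_tableau n x) = shape (insertion_tableau n w)}"

definition two_sided_cells :: "nat \<Rightarrow> (nat \<Rightarrow> nat) set set" where
  "two_sided_cells n = two_sided_cell n ` Sym n"

definition cell_involution :: "nat \<Rightarrow> (nat \<Rightarrow> nat) \<Rightarrow> (nat \<Rightarrow> nat)" where
  "cell_involution n w = (THE x. x \<in> right_cell n w \<and> x \<circ> x = id)"

end

theory Submission
  imports Defs
begin

text \<open>Write \<open>C\<^sub>w\<close> for the Kazhdan-Lusztig basis and \<open>D\<^sub>w\<close> for its dual. Since the trace form is
  nondegenerate, the product of \<open>D\<close> at the inverse of \<open>x\<close> with \<open>C\<^sub>y\<close> is determined by the functional
  sending \<open>g\<close> to the coefficient of \<open>C\<^sub>x\<close> in \<open>C\<^sub>y g\<close>. If \<open>s\<close> and \<open>t\<close> are adjacent simple transpositions,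
  left multiplication by \<open>C\<^sub>t\<close> is an isomorphism of right modules from the span of the \<open>C\<^sub>y\<close> with left
  descent \<open>s\<close> to the span of those with left descent \<open>t\<close>, both modulo the elements with both descents,
  and it maps \<open>C\<^sub>y\<close> to the basis element of the star operation applied to \<open>y\<close>. Hence the functional
  does not change when the same star operation is applied to \<open>x\<close> and \<open>y\<close>.

  On the combinatorial side a star operation fixes the recording tableau and changes the insertion
  tableau by a dual Knuth move, and such moves connect all standard tableaux of a given shape. A pair
  in one right cell can therefore be moved to any other right cell of the same two-sided cell without
  changing the product. Moving it to the right cell whose insertion tableau is the recording tableau
  of \<open>x\<close> turns \<open>x\<close> into an involution, and a product \<open>h\<close> into some \<open>f\<^sub>w\<close>; moving the pair formed by
  \<open>w\<close> and the involution of its cell into a chosen right cell goes the other way.\<close>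

section \<open>Robinson-Schensted insertion\<close>

text \<open>Only insertion tableaux occur in the definitions, so the recording tableau of
  \<open>w\<close> enters as the insertion tableau of its inverse. That exchange is the symmetry of
  growth diagrams; through it a right cell becomes the set of all \<open>w\<close> with one sequence
  of rows occupied by 1, ..., n. Left multiplication of \<open>w\<close> permutes positions in the
  word of the inverse, so a star operation is a Knuth move there. On the algebraic side length takes
  the place of the Bruhat order: unitriangularity with respect to length gives uniqueness, existence
  and the inverse base change. The isomorphism of the overview rests on one vanishing statement. If
  \<open>y\<close> has left descent \<open>i\<close> and \<open>z\<close> does not, the coefficient
  of \<open>C_y\<close> at \<open>z\<close> is v times the one at \<open>s_i z\<close>. Its linear
  term, the multiplicity of \<open>C_z\<close> in a product, is therefore the constant term at
  \<open>s_i z\<close>, which is 1 for \<open>s_i z = y\<close> and 0 otherwise. The Hecke product,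
  the basis and its dual are given by \<open>SOME\<close> and \<open>THE\<close>, so each needs an
  existence proof before its properties are available.\<close>

definition row_step :: "nat \<Rightarrow> nat set \<Rightarrow> nat set \<Rightarrow> nat option \<Rightarrow> bool" where
  "row_step x R R' b \<longleftrightarrow> (case b of
      None \<Rightarrow> R' = insert x R \<and> (\<forall>e\<in>R. e < x)
    | Some y \<Rightarrow> y \<in> R \<and> x < y \<and> (\<forall>e\<in>R. x < e \<longrightarrow> y \<le> e) \<and> R' = insert x (R - {y}))"

lemma row_step_simps:
  "row_step x R R' None \<longleftrightarrow> R' = insert x R \<and> (\<forall>e\<in>R. e < x)"
  "row_step x R R' (Some y) \<longleftrightarrow>
     y \<in> R \<and> x < y \<and> (\<forall>e\<in>R. x < e \<longrightarrow> y \<le> e) \<and> R' = insert x (R - {y})"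
  by (simp_all add: row_step_def)

lemma row_insert_None:
  "row_insert x r = (r', None) \<Longrightarrow> r' = r @ [x] \<and> (\<forall>e\<in>set r. e \<le> x)"
  by (induction r arbitrary: r') (auto split: if_splits prod.splits)

lemma row_insert_Some:
  "row_insert x r = (r', Some y) \<Longrightarrow>
     \<exists>p q. r = p @ y # q \<and> r' = p @ x # q \<and> (\<forall>e\<in>set p. e \<le> x) \<and> x < y"
proof (induction r arbitrary: r')
  case (Cons a r)
  show ?case
  proof (cases "x < a")
    case True
    then show ?thesis using Cons.prems by (intro exI[of _ "[]"] exI[of _ r]) (auto split: if_splits)
  next
    case False
    then obtain zs where zs: "row_insert x r = (zs, Some y)" "r' = a # zs"
      using Cons.prems by (auto split: prod.splits)
    obtain p q where "r = p @ y # q" "zs = p @ x # q" "\<forall>e\<in>set p. e \<le> x" "x < y"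
      using Cons.IH[OF zs(1)] by blast
    with False zs(2) show ?thesis by (intro exI[of _ "a # p"] exI[of _ q]) auto
  qed
qed simp

text \<open>A strictly increasing row is determined by its entry set, so later arguments treat
  insertion as the set relation \<open>row_step\<close>, where order facts reduce to
  membership.\<close>

lemma row_insert_step:
  assumes "row_insert x r = (r', b)" "sorted_wrt (<) r" "x \<notin> set r"
  shows "sorted_wrt (<) r'" "row_step x (set r) (set r') b"
proof -
  have "sorted_wrt (<) r' \<and> row_step x (set r) (set r') b"
  proof (cases b)
    case None
    then show ?thesis
      using row_insert_None[of x r r'] assms
      by (auto simp: row_step_def sorted_wrt_append le_less)
  next
    case (Some y)
    then obtain p q where pq: "r = p @ y # q" "r' = p @ x # q" "\<forall>e\<in>set p. e \<le> x" "x < y"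
      using row_insert_Some[of x r r' y] assms(1) by blast
    have "e < x" if "e \<in> set p" for e
      using pq that assms(3) by (force simp: le_less)
    with pq Some assms show ?thesis
      by (fastforce simp: row_step_def sorted_wrt_append)
  qed
  then show "sorted_wrt (<) r'" "row_step x (set r) (set r') b" by auto
qed

lemma row_step_det:
  assumes "row_step x R A b" "row_step x R B c"
  shows "A = B \<and> b = c"
proof -
  have "b = c"
  proof (cases b)
    case None
    with assms show ?thesis by (cases c) (auto simp: row_step_simps)
  next
    case (Some y)
    with assms show ?thesis by (cases c) (auto simp: row_step_simps order.eq_iff)
  qed
  with assms show ?thesis by (cases c) (auto simp: row_step_simps)
qed

text \<open>After \<open>y\<close>, the letters \<open>x\<close> and \<open>z\<close> act on
  separate parts of the row and commute, so the two bumped words again differ by swapping their last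
  two letters. The alternatives record which letters come to rest in this row.\<close>

lemma row_knuth_I:
  assumes "x < y" "y < z" "x \<notin> R" "y \<notin> R" "z \<notin> R"
    and "row_step y R R1 b1" "row_step x R1 R2 b2" "row_step z R2 R3 b3"
    and "row_step z R1 R2' c2" "row_step x R2' R3' c3"
  shows "R3 = R3' \<and> c2 = b3 \<and> c3 = b2 \<and>
    ((\<exists>p q r. b1 = Some p \<and> b2 = Some q \<and> b3 = Some r \<and> q < p \<and> p < r) \<or>
     (\<exists>p q. b1 = Some p \<and> b2 = Some q \<and> b3 = None \<and> q < p) \<or>
     (\<exists>q. b1 = None \<and> b2 = Some q \<and> b3 = None))"
proof -
  have y1: "y \<in> R1" using assms(6) by (cases b1) (auto simp: row_step_simps)
  obtain q where q: "b2 = Some q" "q \<in> R1" "x < q" "\<forall>e\<in>R1. x < e \<longrightarrow> q \<le> e" "R2 = insert x (R1 - {q})"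
    using assms(1,7) y1 by (cases b2) (auto simp: row_step_simps)
  \<comment> \<open>Since \<open>y\<close> is already present, \<open>x\<close> bumps a letter at
    most \<open>y\<close>, while \<open>z\<close> can only bump a letter above itself; this
    separates the two insertions.\<close>
  have qy: "q \<le> y" using q y1 assms(1) by auto
  show ?thesis
  proof (cases c2)
    case None
    then have n: "R2' = insert z R1" "\<forall>e\<in>R1. e < z" using assms(9) by (auto simp: row_step_simps)
    have b3: "R3 = insert z R2 \<and> b3 = None"
      by (rule row_step_det[OF assms(8)]) (use n q assms(1,2) in \<open>auto simp: row_step_simps\<close>)
    have c3: "R3' = insert x (R2' - {q}) \<and> c3 = Some q"
      by (rule row_step_det[OF assms(10)]) (use n q qy assms(1,2) in \<open>auto simp: row_step_simps\<close>)
    have "R3 = R3'" using b3 c3 n q qy assms(2) by auto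
    moreover have "q < p" if "b1 = Some p" for p
      using that assms(6) qy by (auto simp: row_step_simps)
    ultimately show ?thesis using None b3 c3 q by (cases b1) auto
  next
    case (Some r)
    then have n: "r \<in> R1" "z < r" "\<forall>e\<in>R1. z < e \<longrightarrow> r \<le> e" "R2' = insert z (R1 - {r})"
      using assms(9) by (auto simp: row_step_simps)
    have b3: "R3 = insert z (R2 - {r}) \<and> b3 = Some r"
      by (rule row_step_det[OF assms(8)]) (use n q qy assms(1,2) in \<open>auto simp: row_step_simps\<close>)
    have c3: "R3' = insert x (R2' - {q}) \<and> c3 = Some q"
      by (rule row_step_det[OF assms(10)]) (use n q qy assms(1,2) in \<open>auto simp: row_step_simps\<close>)
    have "R3 = R3'" using b3 c3 n q qy assms(1,2) by auto
    moreover obtain p where p: "b1 = Some p" "q < p" "p < r"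
    proof (cases b1)
      case None
      then have False using assms(2,6) n by (auto simp: row_step_simps)
      then show ?thesis ..
    next
      case (Some p)
      then have "y < p" "p \<le> r" "p \<noteq> r"
        using assms(2,6) n by (auto simp: row_step_simps)
      with Some qy that show ?thesis by auto
    qed
    ultimately show ?thesis using Some b3 c3 q by auto
  qed
qed

text \<open>In the last three alternatives no entry lies between \<open>x\<close> and
  \<open>z\<close>, so inserting \<open>x\<close> after \<open>z\<close> bumps \<open>z\<close>
  itself. If all letters are bumped there, the bumped words are \<open>p q z\<close> and
  \<open>p z q\<close>: a move of the first kind. Thus the second kind does not simply reproduce
  itself from row to row.\<close>

lemma row_knuth_II:
  assumes "x < y" "y < z" "x \<notin> R" "y \<notin> R" "z \<notin> R"
    and "row_step x R R1 b1" "row_step z R1 R2 b2" "row_step y R2 R3 b3"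
    and "row_step z R R1' c1" "row_step x R1' R2' c2" "row_step y R2' R3' c3"
  shows "R3 = R3' \<and>
    ((\<exists>p q r. b1 = Some p \<and> b2 = Some q \<and> b3 = Some r \<and>
              c1 = Some q \<and> c2 = Some p \<and> c3 = Some r \<and> p < r \<and> r < q) \<or>
     (\<exists>p r. b1 = Some p \<and> b2 = None \<and> b3 = Some r \<and>
              c1 = None \<and> c2 = Some p \<and> c3 = Some r \<and> p < r) \<or>
     (\<exists>p q. b1 = Some p \<and> b2 = Some q \<and> b3 = Some z \<and>
              c1 = Some p \<and> c2 = Some z \<and> c3 = Some q \<and> z < p \<and> p < q) \<or>
     (\<exists>p. b1 = Some p \<and> b2 = None \<and> b3 = Some z \<and>
              c1 = Some p \<and> c2 = Some z \<and> c3 = None \<and> z < p) \<or>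
     (b1 = None \<and> b2 = None \<and> b3 = Some z \<and> c1 = None \<and> c2 = Some z \<and> c3 = None))"
proof (cases "\<exists>e\<in>R. x < e \<and> e < z")
  \<comment> \<open>Now \<open>x\<close> bumps a letter below \<open>z\<close>, and \<open>z\<close>
    one above itself or none. Both orders give the same row, and only the order of the bumped
    letters changes.\<close>
  case True
  then obtain p where p: "b1 = Some p" "p \<in> R" "x < p" "p < z" "\<forall>e\<in>R. x < e \<longrightarrow> p \<le> e"
      "R1 = insert x (R - {p})"
    using assms(6) by (cases b1) (auto simp: row_step_simps dest: le_less_trans)
  have z2: "z \<in> R2" using assms(7) by (cases b2) (auto simp: row_step_simps)
  obtain r where r: "b3 = Some r" "r \<in> R2" "y < r" "\<forall>e\<in>R2. y < e \<longrightarrow> r \<le> e" "R3 = insert y (R2 - {r})"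
    using assms(2,8) z2 by (cases b3) (auto simp: row_step_simps)
  have rz: "r \<le> z" using r z2 assms(2) by auto
  have pr: "p < r"
  proof -
    have "r \<in> insert z (R - {p})"
      using r p assms(1,7) by (cases b2) (auto simp: row_step_simps)
    then show ?thesis using p r assms(1) by (auto simp: le_less)
  qed
  show ?thesis
  proof (cases b2)
    case None
    then have n: "R2 = insert z R1" "\<forall>e\<in>R1. e < z" using assms(7) by (auto simp: row_step_simps)
    have c1: "R1' = insert z R \<and> c1 = None"
      by (rule row_step_det[OF assms(9)]) (use n p in \<open>auto simp: row_step_simps\<close>)
    have c2: "R2' = insert x (R1' - {p}) \<and> c2 = Some p"
      by (rule row_step_det[OF assms(10)]) (use c1 p in \<open>auto simp: row_step_simps\<close>)
    have "R2' = R2" using c1 c2 n p by auto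
    then have "R3' = R3" "c3 = Some r" using assms(8,11) r(1) row_step_det by blast+
    then show ?thesis using None c1 c2 p r pr by auto
  next
    case (Some q)
    then have n: "q \<in> R1" "z < q" "\<forall>e\<in>R1. z < e \<longrightarrow> q \<le> e" "R2 = insert z (R1 - {q})"
      using assms(7) by (auto simp: row_step_simps)
    have c1: "R1' = insert z (R - {q}) \<and> c1 = Some q"
      by (rule row_step_det[OF assms(9)]) (use n p assms(1,2) in \<open>auto simp: row_step_simps\<close>)
    have c2: "R2' = insert x (R1' - {p}) \<and> c2 = Some p"
      by (rule row_step_det[OF assms(10)]) (use c1 p n in \<open>auto simp: row_step_simps\<close>)
    have "R2' = R2" using c1 c2 n p assms(1,2) by auto
    then have "R3' = R3" "c3 = Some r" using assms(8,11) r(1) row_step_det by blast+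
    then show ?thesis using Some c1 c2 p r pr rz n by auto
  qed
next
  case False
  then have F: "e < x \<or> z < e" if "e \<in> R" for e
    using that assms by (metis linorder_neqE_nat)
  show ?thesis
  proof (cases b1)
    case None
    then have n: "R1 = insert x R" "\<forall>e\<in>R. e < x" using assms(6) by (auto simp: row_step_simps)
    have "row_step z R1 (insert z R1) None" using n assms(1,2) by (auto simp: row_step_simps)
    then have b2: "R2 = insert z R1" "b2 = None" using assms(7) row_step_det by blast+
    have b3: "R3 = insert y (R2 - {z}) \<and> b3 = Some z"
      by (rule row_step_det[OF assms(8)]) (use n b2 assms(1,2) in \<open>auto simp: row_step_simps\<close>)
    have "row_step z R (insert z R) None" using n assms(1,2) by (auto simp: row_step_simps)
    then have c1: "R1' = insert z R" "c1 = None" using assms(9) row_step_det by blast+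
    have c2: "R2' = insert x (R1' - {z}) \<and> c2 = Some z"
      by (rule row_step_det[OF assms(10)]) (use n c1 assms(1,2) in \<open>auto simp: row_step_simps\<close>)
    have c3: "R3' = insert y R2' \<and> c3 = None"
      by (rule row_step_det[OF assms(11)]) (use n c1 c2 assms(1,2) in \<open>auto simp: row_step_simps\<close>)
    have "R3 = R3'" using n b2 b3 c1 c2 c3 assms by auto
    then show ?thesis using None b2 b3 c1 c2 c3 by auto
  next
    case (Some p)
    then have n: "p \<in> R" "x < p" "\<forall>e\<in>R. x < e \<longrightarrow> p \<le> e" "R1 = insert x (R - {p})"
      using assms(6) by (auto simp: row_step_simps)
    have zp: "z < p" using F n by fastforce
    have c1: "R1' = insert z (R - {p}) \<and> c1 = Some p"
      by (rule row_step_det[OF assms(9)]) (use n zp assms(1,2) in \<open>auto simp: row_step_simps\<close>)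
    have c2: "R2' = insert x (R1' - {z}) \<and> c2 = Some z"
      by (rule row_step_det[OF assms(10)]) (use n c1 zp assms(1,2) in \<open>auto simp: row_step_simps\<close>)
    have R2': "R2' = R1" using c1 c2 n assms by auto
    have FR1: "e \<le> x \<or> z < e" if "e \<in> R1" for e using that n F by force
    show ?thesis
    proof (cases b2)
      case None
      then have m: "R2 = insert z R1" "\<forall>e\<in>R1. e < z" using assms(7) by (auto simp: row_step_simps)
      have "e \<le> x \<or> z \<le> e" if "e \<in> R2" for e using that m FR1 by force
      then have "row_step y R2 (insert y (R2 - {z})) (Some z)"
        unfolding row_step_simps using m(1) assms(1,2) by force
      then have b3: "R3 = insert y (R2 - {z})" "b3 = Some z" using assms(8) row_step_det by blast+
      have "e < y" if "e \<in> R1" for e using m(2) FR1[OF that] that assms(1) by force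
      then have "row_step y R2' (insert y R2') None"
        using R2' by (simp add: row_step_simps)
      then have c3: "R3' = insert y R2'" "c3 = None" using assms(11) row_step_det by blast+
      have "R3 = R3'" using n m b3 c3 R2' assms by auto
      then show ?thesis using None Some b3 c1 c2 c3 zp by auto
    next
      case (Some q)
      then have m: "q \<in> R1" "z < q" "\<forall>e\<in>R1. z < e \<longrightarrow> q \<le> e" "R2 = insert z (R1 - {q})"
        using assms(7) by (auto simp: row_step_simps)
      have pq: "p < q" using m n zp assms(1,2) by (auto simp: le_less)
      have "e \<le> x \<or> z \<le> e" if "e \<in> R2" for e using that m FR1 by force
      then have "row_step y R2 (insert y (R2 - {z})) (Some z)"
        unfolding row_step_simps using m(4) assms(1,2) by force
      then have b3: "R3 = insert y (R2 - {z})" "b3 = Some z" using assms(8) row_step_det by blast+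
      have "q \<le> e" if "e \<in> R1" "y < e" for e using m(3) FR1[OF that(1)] that assms(1) by force
      then have "row_step y R2' (insert y (R2' - {q})) (Some q)"
        using R2' m(1,2) assms(2) by (simp add: row_step_simps)
      then have c3: "R3' = insert y (R2' - {q})" "c3 = Some q" using assms(11) row_step_det by blast+
      have "R3 = R3'" using n m b3 c3 R2' assms by auto
      then show ?thesis using Some \<open>b1 = Some p\<close> b3 c1 c2 c3 zp pq by auto
    qed
  qed
qed

section \<open>Tableaux with strictly increasing, pairwise disjoint rows\<close>

definition ents :: "nat list list \<Rightarrow> nat set" where
  "ents T = (\<Union>r\<in>set T. set r)"

fun tab :: "nat list list \<Rightarrow> bool" where
  "tab [] \<longleftrightarrow> True"
| "tab (r # rs) \<longleftrightarrow> r \<noteq> [] \<and> sorted_wrt (<) r \<and> set r \<inter> ents rs = {} \<and> tab rs"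

text \<open>A standard tableau is determined by the rows of its entries, so of each added cell only
  the row is kept, counted from 0.\<close>

fun new_row :: "nat \<Rightarrow> nat list list \<Rightarrow> nat" where
  "new_row x [] = 0"
| "new_row x (r # rs) = (case row_insert x r of (_, None) \<Rightarrow> 0 | (_, Some y) \<Rightarrow> Suc (new_row y rs))"

lemma ents_simps [simp]: "ents [] = {}" "ents (r # rs) = set r \<union> ents rs"
  by (auto simp: ents_def)

lemma tableau_insert_cases:
  assumes "tab (r # rs)" "x \<notin> ents (r # rs)"
  obtains
    (None) r' where "row_insert x r = (r', None)" "row_step x (set r) (set r') None"
      "tableau_insert x (r # rs) = r' # rs" "new_row x (r # rs) = 0"
      "sorted_wrt (<) r'" "r' \<noteq> []"
  | (Some) r' y where "row_insert x r = (r', Some y)" "row_step x (set r) (set r') (Some y)"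
      "tableau_insert x (r # rs) = r' # tableau_insert y rs"
      "new_row x (r # rs) = Suc (new_row y rs)"
      "sorted_wrt (<) r'" "r' \<noteq> []" "y \<notin> ents rs" "x < y" "y \<in> set r"
proof -
  obtain r' b where rb: "row_insert x r = (r', b)" by fastforce
  have st: "sorted_wrt (<) r'" "row_step x (set r) (set r') b"
    using row_insert_step[OF rb] assms by auto
  have ne: "r' \<noteq> []" using st(2) by (cases b) (auto simp: row_step_simps)
  show thesis
  proof (cases b)
    case None
    with rb st ne that(1) show thesis by auto
  next
    case (Some y)
    then have "y \<in> set r" "x < y" using st(2) by (auto simp: row_step_simps)
    moreover then have "y \<notin> ents rs" using assms by auto
    ultimately show thesis using rb st ne Some that(2) by auto
  qed
qed

lemma tableau_insert_tab:
  assumes "tab T" "x \<notin> ents T"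
  shows "tab (tableau_insert x T)" "ents (tableau_insert x T) = insert x (ents T)"
proof -
  have "tab (tableau_insert x T) \<and> ents (tableau_insert x T) = insert x (ents T)"
    using assms
  proof (induction T arbitrary: x)
    case (Cons r rs)
    from Cons.prems show ?case
    proof (cases rule: tableau_insert_cases)
      case (None r')
      with Cons.prems show ?thesis by (auto simp: row_step_simps)
    next
      case (Some r' y)
      have "tab (tableau_insert y rs) \<and> ents (tableau_insert y rs) = insert y (ents rs)"
        using Cons.IH[of y] Cons.prems Some by simp
      with Some Cons.prems show ?thesis by (auto simp: row_step_simps)
    qed
  qed simp
  then show "tab (tableau_insert x T)" "ents (tableau_insert x T) = insert x (ents T)" by auto
qed

subsection \<open>Row bumping\<close>

text \<open>The letters bumped from a row by \<open>p\<close> and then \<open>q\<close> are ordered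
  like \<open>p\<close> and \<open>q\<close>, so the comparison descends until one of them comes to
  rest. This identifies the descents of a word with those of its recording tableau.\<close>

lemma new_row_next:
  assumes "tab T" "p \<notin> ents T" "q \<notin> ents T" "p \<noteq> q"
  shows "new_row p T < new_row q (tableau_insert p T) \<longleftrightarrow> q < p"
  using assms
proof (induction T arbitrary: p q)
  case (Cons r rs)
  have q: "q \<notin> ents (tableau_insert p (r # rs))" and t: "tab (tableau_insert p (r # rs))"
    using tableau_insert_tab[of "r # rs" p] Cons.prems by auto
  from Cons.prems(1,2) show ?case
  proof (cases rule: tableau_insert_cases)
    case (None r')
    from t q None have "tab (r' # rs)" "q \<notin> ents (r' # rs)" by simp_all
    then show ?thesis
      by (cases rule: tableau_insert_cases)
         (use None Cons.prems in \<open>auto simp: row_step_simps\<close>)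
  next
    case (Some r' y)
    from t q Some have "tab (r' # tableau_insert y rs)" "q \<notin> ents (r' # tableau_insert y rs)" by simp_all
    then show ?thesis
    proof (cases rule: tableau_insert_cases)
      case (None r'')
      then show ?thesis using Some Cons.prems by (auto simp: row_step_simps)
    next
      case S: (Some r'' z)
      have z: "z \<notin> ents rs" "z \<noteq> y" using S(7) tableau_insert_tab[of rs y] Some Cons.prems by auto
      have "z < y \<longleftrightarrow> q < p"
      proof (cases "q < p")
        case True
        then have "z \<le> p" using S(2) Some(2) by (auto simp: row_step_simps)
        then show ?thesis using Some(8) True by simp
      next
        case False
        have "z \<in> set r'" "q < z" using S(2) by (auto simp: row_step_simps)
        then have "y \<le> z" using Some(2) False Cons.prems(4) by (auto simp: row_step_simps)
        then show ?thesis using False by simp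
      qed
      then show ?thesis using Cons.IH[of y z] z Some S Cons.prems by auto
    qed
  qed
qed simp

subsection \<open>Injectivity of insertion\<close>

lemma sorted_wrt_less_eqI:
  "sorted_wrt (<) r \<Longrightarrow> sorted_wrt (<) r' \<Longrightarrow> set r = set r' \<Longrightarrow> r = (r' :: nat list)"
  by (simp add: strict_sorted_equal)

text \<open>One step of reverse bumping. Two different inserted letters would each lie in the
  other's old row; the smaller one would then have bumped something at most the larger one, not
  \<open>y\<close>.\<close>

lemma row_step_inj:
  assumes "row_step x A R (Some y)" "row_step x' A' R (Some y)" "x \<notin> A" "x' \<notin> A'"
  shows "x = x' \<and> A = A'"
proof -
  have a: "y \<in> A" "x < y" "\<And>e. e \<in> A \<Longrightarrow> x < e \<Longrightarrow> y \<le> e" "R = insert x (A - {y})"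
    and b: "y \<in> A'" "x' < y" "\<And>e. e \<in> A' \<Longrightarrow> x' < e \<Longrightarrow> y \<le> e" "R = insert x' (A' - {y})"
    using assms(1,2) by (auto simp: row_step_simps)
  have xx: "x = x'"
  proof (rule ccontr)
    assume ne: "x \<noteq> x'"
    have "x \<in> A'" "x' \<in> A" using ne a(4) b(4) by auto
    then show False using a(2) b(2) a(3)[of x'] b(3)[of x] ne by linarith
  qed
  have "A - {y} = R - {x}" "A' - {y} = R - {x}" using a(4) b(4) xx assms(3,4) by auto
  then have "A = A'" using a(1) b(1) by auto
  with xx show ?thesis by simp
qed

text \<open>Reverse insertion, done by comparing two insertions with equal result. The common row
  index tells whether the letter was appended in this row; otherwise the bumped letters agree by
  induction.\<close>

lemma tableau_insert_inj:
  assumes "tab T" "tab T'" "x \<notin> ents T" "x' \<notin> ents T'"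
    and "tableau_insert x T = tableau_insert x' T'" "new_row x T = new_row x' T'"
  shows "x = x' \<and> T = T'"
  using assms
proof (induction T arbitrary: x x' T')
  case Nil
  show ?case
  proof (cases T')
    case (Cons r rs)
    with Nil.prems have "tab (r # rs)" "x' \<notin> ents (r # rs)" by auto
    then show ?thesis
    proof (cases rule: tableau_insert_cases)
      case (None r')
      then show ?thesis using Nil.prems Cons row_insert_None by fastforce
    next
      case (Some r' y)
      then show ?thesis using Nil.prems Cons by auto
    qed
  qed (use Nil in auto)
next
  case (Cons r rs)
  note Cprems = Cons.prems and CIH = Cons.IH
  from Cons.prems(1,3) show ?case
  proof (cases rule: tableau_insert_cases)
    case (None r1)
    show ?thesis
    proof (cases T')
      case Nil
      then show ?thesis using Cprems None row_insert_None by fastforce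
    next
      case (Cons s ss)
      with Cprems have "tab (s # ss)" "x' \<notin> ents (s # ss)" by auto
      then show ?thesis
      proof (cases rule: tableau_insert_cases)
        case N: (None s1)
        have "r @ [x] = s @ [x']" "rs = ss"
          using N None Cprems Cons row_insert_None by (metis list.inject)+
        then show ?thesis using Cons by simp
      next
        case (Some s1 y)
        then show ?thesis using Cprems Cons None by auto
      qed
    qed
  next
    case (Some r1 y)
    then obtain s ss where T': "T' = s # ss" using Cprems by (cases T') auto
    with Cprems have "tab (s # ss)" "x' \<notin> ents (s # ss)" by auto
    then show ?thesis
    proof (cases rule: tableau_insert_cases)
      case (None s1)
      then show ?thesis using Cprems T' Some by auto
    next
      case S: (Some s1 z)
      have e: "r1 = s1" "tableau_insert y rs = tableau_insert z ss" "new_row y rs = new_row z ss"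
        using S Some Cprems T' by auto
      have yz: "y = z \<and> rs = ss"
        using CIH[of ss y z] e S Some Cprems T' by auto
      have "x = x' \<and> set r = set s"
        using row_step_inj[of x "set r" "set r1" y x' "set s"] S(2) Some(2) e yz Cprems T' by auto
      then show ?thesis using yz T' Cprems sorted_wrt_less_eqI by auto
    qed
  qed
qed

subsection \<open>Knuth moves\<close>

text \<open>A Knuth move in the inserted word also changes the three row indices of the new cells by a
  Knuth move, this time of weakly ordered letters.\<close>

definition row_move :: "nat \<Rightarrow> nat \<Rightarrow> nat \<Rightarrow> nat \<Rightarrow> nat \<Rightarrow> nat \<Rightarrow> bool" where
  "row_move a b c a' b' c' \<longleftrightarrow>
     (a' = a \<and> b' = c \<and> c' = b \<and> min b c \<le> a \<and> a < max b c) \<or>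
     (a' = b \<and> b' = a \<and> c' = c \<and> min a b < c \<and> c \<le> max a b)"

lemma row_move_Suc:
  "row_move a b c a' b' c' \<Longrightarrow> row_move (Suc a) (Suc b) (Suc c) (Suc a') (Suc b') (Suc c')"
  by (auto simp: row_move_def)

text \<open>The inequalities of the two alternatives exclude each other, so a word admits at most
  one move at a given place.\<close>

lemma row_move_det:
  "row_move a b c a' b' c' \<Longrightarrow> row_move a b c a'' b'' c'' \<Longrightarrow> a'' = a' \<and> b'' = b' \<and> c'' = c'"
  by (auto simp: row_move_def)

lemma row_move_sym: "row_move a b c a' b' c' \<Longrightarrow> row_move a' b' c' a b c"
  by (auto simp: row_move_def)

definition insert3 :: "nat \<Rightarrow> nat \<Rightarrow> nat \<Rightarrow> nat list list \<Rightarrow> nat list list \<times> nat \<times> nat \<times> nat" where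
  "insert3 x y z T = (let T1 = tableau_insert x T; T2 = tableau_insert y T1 in
     (tableau_insert z T2, new_row x T, new_row y T1, new_row z T2))"

definition knuth_rel :: "(nat list list \<times> nat \<times> nat \<times> nat) \<Rightarrow> (nat list list \<times> nat \<times> nat \<times> nat) \<Rightarrow> bool" where
  "knuth_rel = (\<lambda>(T, a, b, c) (T', a', b', c'). T = T' \<and> row_move a b c a' b' c')"

lemma knuth_rel_sym: "knuth_rel u v \<Longrightarrow> knuth_rel v u"
  by (auto simp: knuth_rel_def row_move_sym)

text \<open>Both kinds of move are proved together because the second kind can turn into the first
  in the next row. When letters come to rest early, the inequalities between new rows come from
  \<open>new_row_next\<close>.\<close>

lemma insert3_knuth:
  assumes "tab T" "x < y" "y < z" "{x, y, z} \<inter> ents T = {}"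
  shows "knuth_rel (insert3 y x z T) (insert3 y z x T) \<and>
         knuth_rel (insert3 x z y T) (insert3 z x y T)"
  using assms
proof (induction T arbitrary: x y z)
  case Nil
  then show ?case by (auto simp: insert3_def knuth_rel_def row_move_def)
next
  case (Cons r rs)
  have sr: "sorted_wrt (<) r" "x \<notin> set r" "y \<notin> set r" "z \<notin> set r" and rs: "tab rs"
    and xyz: "{x, y, z} \<inter> ents rs = {}"
    using Cons.prems by auto
  have disj: "set r \<inter> ents rs = {}" using Cons.prems(1) by simp
  have step: "sorted_wrt (<) r'" "row_step u (set s) (set r') b"
    if "sorted_wrt (<) s" "u \<notin> set s" "row_insert u s = (r', b)" for u s r' b
    using row_insert_step[OF that(3,1,2)] by auto
  have sub: "set r' \<subseteq> insert u (set s)" and bin: "\<And>p. b = Some p \<Longrightarrow> p \<in> set s"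
    if "row_step u (set s) (set r') b" for u s r' b
    using that by (cases b; auto simp: row_step_simps)+
  show ?case
  proof
    obtain r1 b1 where 1: "row_insert y r = (r1, b1)" by fastforce
    note s1 = step[OF sr(1,3) 1]
    have n1: "x \<notin> set r1" "z \<notin> set r1" using sub[OF s1(2)] sr Cons.prems by auto
    obtain r2 b2 where 2: "row_insert x r1 = (r2, b2)" by fastforce
    note s2 = step[OF s1(1) n1(1) 2]
    have n2: "z \<notin> set r2" using sub[OF s2(2)] n1 Cons.prems by auto
    obtain r3 b3 where 3: "row_insert z r2 = (r3, b3)" by fastforce
    note s3 = step[OF s2(1) n2 3]
    obtain t2 c2 where 4: "row_insert z r1 = (t2, c2)" by fastforce
    note s4 = step[OF s1(1) n1(2) 4]
    have n3: "x \<notin> set t2" using sub[OF s4(2)] n1 Cons.prems by auto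
    obtain t3 c3 where 5: "row_insert x t2 = (t3, c3)" by fastforce
    note s5 = step[OF s4(1) n3 5]
    note K = row_knuth_I[OF Cons.prems(2,3) sr(2-4) s1(2) s2(2) s3(2) s4(2) s5(2)]
    have rt: "r3 = t3" using K s3(1) s5(1) sorted_wrt_less_eqI by blast
    have c: "c2 = b3" "c3 = b2" using K by auto
    have ne1: "p \<notin> ents rs" if "b1 = Some p" for p using bin[OF s1(2) that] disj by auto
    have ne2: "p \<notin> ents rs" if "b2 = Some p" for p
      using bin[OF s2(2) that] sub[OF s1(2)] xyz disj by auto
    have ne3: "p \<notin> ents rs" if "b3 = Some p" for p
      using bin[OF s3(2) that] sub[OF s1(2)] sub[OF s2(2)] xyz disj by auto
    consider (a) p q s where "b1 = Some p" "b2 = Some q" "b3 = Some s" "q < p" "p < s"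
      | (b) p q where "b1 = Some p" "b2 = Some q" "b3 = None" "q < p"
      | (c) q where "b1 = None" "b2 = Some q" "b3 = None"
      using K by blast
    then show "knuth_rel (insert3 y x z (r # rs)) (insert3 y z x (r # rs))"
    proof cases
      case a
      have "knuth_rel (insert3 p q s rs) (insert3 p s q rs)"
        using Cons.IH[OF rs a(4,5)] ne1 ne2 ne3 a by auto
      then show ?thesis
        using a c rt 1 2 3 4 5 row_move_Suc by (simp add: insert3_def Let_def knuth_rel_def)
    next
      case b
      have "new_row p rs < new_row q (tableau_insert p rs)"
        using new_row_next[OF rs, of p q] ne1 ne2 b by auto
      then show ?thesis
        using b c rt 1 2 3 4 5 by (simp add: insert3_def Let_def knuth_rel_def row_move_def)
    next
      case c
      then show ?thesis
        using \<open>c2 = b3\<close> \<open>c3 = b2\<close> rt 1 2 3 4 5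
        by (simp add: insert3_def Let_def knuth_rel_def row_move_def)
    qed
  next
    obtain r1 b1 where 1: "row_insert x r = (r1, b1)" by fastforce
    note s1 = step[OF sr(1,2) 1]
    have n1: "y \<notin> set r1" "z \<notin> set r1" using sub[OF s1(2)] sr Cons.prems by auto
    obtain r2 b2 where 2: "row_insert z r1 = (r2, b2)" by fastforce
    note s2 = step[OF s1(1) n1(2) 2]
    have n2: "y \<notin> set r2" using sub[OF s2(2)] n1 Cons.prems by auto
    obtain r3 b3 where 3: "row_insert y r2 = (r3, b3)" by fastforce
    note s3 = step[OF s2(1) n2 3]
    obtain t1 c1 where 4: "row_insert z r = (t1, c1)" by fastforce
    note s4 = step[OF sr(1,4) 4]
    have n3: "x \<notin> set t1" "y \<notin> set t1" using sub[OF s4(2)] sr Cons.prems by auto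
    obtain t2 c2 where 5: "row_insert x t1 = (t2, c2)" by fastforce
    note s5 = step[OF s4(1) n3(1) 5]
    have n4: "y \<notin> set t2" using sub[OF s5(2)] n3 Cons.prems by auto
    obtain t3 c3 where 6: "row_insert y t2 = (t3, c3)" by fastforce
    note s6 = step[OF s5(1) n4 6]
    note K = row_knuth_II[OF Cons.prems(2,3) sr(2-4) s1(2) s2(2) s3(2) s4(2) s5(2) s6(2)]
    have rt: "r3 = t3" using K s3(1) s6(1) sorted_wrt_less_eqI by blast
    have ne1: "p \<notin> ents rs" if "b1 = Some p" for p using bin[OF s1(2) that] disj by auto
    have ne2: "p \<notin> ents rs" if "b2 = Some p" for p
      using bin[OF s2(2) that] sub[OF s1(2)] xyz disj by auto
    have ne3: "p \<notin> ents rs" if "b3 = Some p" for p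
      using bin[OF s3(2) that] sub[OF s1(2)] sub[OF s2(2)] xyz disj by auto
    from conjunct2[OF K] consider
        (a) p q s where "b1 = Some p" "b2 = Some q" "b3 = Some s" "c1 = Some q" "c2 = Some p" "c3 = Some s" "p < s" "s < q"
      | (b) p s where "b1 = Some p" "b2 = None" "b3 = Some s" "c1 = None" "c2 = Some p" "c3 = Some s" "p < s"
      | (c) p q where "b1 = Some p" "b2 = Some q" "b3 = Some z" "c1 = Some p" "c2 = Some z" "c3 = Some q" "z < p" "p < q"
      | (d) p where "b1 = Some p" "b2 = None" "b3 = Some z" "c1 = Some p" "c2 = Some z" "c3 = None" "z < p"
      | (e) "b1 = None" "b2 = None" "b3 = Some z" "c1 = None" "c2 = Some z" "c3 = None"
      by (elim disjE exE conjE) blast+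
    then show "knuth_rel (insert3 x z y (r # rs)) (insert3 z x y (r # rs))"
    proof cases
      case a
      have "knuth_rel (insert3 p q s rs) (insert3 q p s rs)"
        using Cons.IH[OF rs a(7,8)] ne1 ne2 ne3 a by auto
      then show ?thesis
        using a rt 1 2 3 4 5 6 row_move_Suc by (simp add: insert3_def Let_def knuth_rel_def)
    next
      case b
      have "new_row s (tableau_insert p rs) \<le> new_row p rs"
        using new_row_next[OF rs, of p s] ne1 ne3 b by force
      then show ?thesis
        using b rt 1 2 3 4 5 6 by (simp add: insert3_def Let_def knuth_rel_def row_move_def)
    next
      case c
      \<comment> \<open>Here the second kind has become the first kind, read in the opposite
        direction.\<close>
      have "knuth_rel (insert3 p q z rs) (insert3 p z q rs)"
        using Cons.IH[OF rs c(7,8)] ne1 ne2 ne3 c knuth_rel_sym by auto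
      then show ?thesis
        using c rt 1 2 3 4 5 6 row_move_Suc by (simp add: insert3_def Let_def knuth_rel_def)
    next
      case d
      have "new_row p rs < new_row z (tableau_insert p rs)"
        using new_row_next[OF rs, of p z] ne1 ne3 d by auto
      then show ?thesis
        using d rt 1 2 3 4 5 6 by (simp add: insert3_def Let_def knuth_rel_def row_move_def)
    next
      case e
      then show ?thesis
        using rt 1 2 3 4 5 6 by (simp add: insert3_def Let_def knuth_rel_def row_move_def)
    qed
  qed
qed

subsection \<open>Counting entries by row and size\<close>

text \<open>For fixed \<open>j\<close> these are the row lengths of the part of the tableau with
  entries at most \<open>j\<close>, that is, a vertex of the growth diagram. Missing rows count
  0.\<close>

fun row_count :: "nat list list \<Rightarrow> nat \<Rightarrow> nat \<Rightarrow> nat" where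
  "row_count [] k j = 0"
| "row_count (r # rs) 0 j = card {e \<in> set r. e \<le> j}"
| "row_count (r # rs) (Suc k) j = row_count rs k j"

text \<open>The row whose number of entries at most \<open>j\<close> grows when \<open>x\<close> is inserted.\<close>

fun new_row_upto :: "nat \<Rightarrow> nat \<Rightarrow> nat list list \<Rightarrow> nat" where
  "new_row_upto j x [] = 0"
| "new_row_upto j x (r # rs) = (case row_insert x r of
      (_, None) \<Rightarrow> 0
    | (_, Some y) \<Rightarrow> if y \<le> j then Suc (new_row_upto j y rs) else 0)"

lemma card_le_row_step_None:
  assumes "row_step x R R' None" "finite R" "x \<notin> R"
  shows "card {e \<in> R'. e \<le> j} = card {e \<in> R. e \<le> j} + (if x \<le> j then 1 else 0)"
proof -
  have "{e \<in> R'. e \<le> j} = (if x \<le> j then insert x {e \<in> R. e \<le> j} else {e \<in> R. e \<le> j})"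
    using assms by (auto simp: row_step_simps)
  then show ?thesis using assms by simp
qed

lemma card_le_row_step_Some:
  assumes "row_step x R R' (Some y)" "finite R" "x \<notin> R"
  shows "card {e \<in> R'. e \<le> j} = card {e \<in> R. e \<le> j} + (if x \<le> j \<and> j < y then 1 else 0)"
proof -
  have y: "y \<in> R" "x < y" "R' = insert x (R - {y})" using assms by (auto simp: row_step_simps)
  consider "j < x" | "x \<le> j" "j < y" | "y \<le> j" by linarith
  then show ?thesis
  proof cases
    case 1
    then have "{e \<in> R'. e \<le> j} = {e \<in> R. e \<le> j}" using y by auto
    with 1 show ?thesis by simp
  next
    case 2
    then have "{e \<in> R'. e \<le> j} = insert x {e \<in> R. e \<le> j}" using y by auto
    with 2 show ?thesis using assms by simp
  next
    case 3
    then have "{e \<in> R'. e \<le> j} = insert x ({e \<in> R. e \<le> j} - {y})" using y by auto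
    moreover have "y \<in> {e \<in> R. e \<le> j}" using 3 y by simp
    moreover have "finite {e \<in> R. e \<le> j}" using assms by simp
    ultimately show ?thesis using 3 assms
      by (simp add: card.insert_remove card_Suc_Diff1 del: card_Diff_insert)
  qed
qed

text \<open>For \<open>x \<le> j\<close>, a row that bumps a letter at most \<open>j\<close> keeps
  its count, since one counted letter replaces another; the first row that bumps a larger letter, or
  none, gains one.\<close>

lemma row_count_insert:
  assumes "tab T" "x \<notin> ents T"
  shows "row_count (tableau_insert x T) k j =
    row_count T k j + (if x \<le> j \<and> k = new_row_upto j x T then 1 else 0)"
  using assms
proof (induction T arbitrary: x k)
  case Nil
  have "{e. e = x \<and> e \<le> j} = (if x \<le> j then {x} else {})" by auto
  then show ?case by (cases k) auto
next
  case (Cons r rs)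
  from Cons.prems show ?case
  proof (cases rule: tableau_insert_cases)
    case (None r')
    show ?thesis
    proof (cases k)
      case 0
      then show ?thesis using None card_le_row_step_None[OF None(2), of j] Cons.prems by simp
    qed (use None in simp)
  next
    case (Some r' y)
    show ?thesis
    proof (cases k)
      case 0
      then show ?thesis using Some card_le_row_step_Some[OF Some(2), of j] Cons.prems by auto
    next
      case (Suc k')
      then show ?thesis using Some Cons.IH[of y k'] Cons.prems by auto
    qed
  qed
qed

lemma new_row_upto_self:
  assumes "tab T" "x \<notin> ents T"
  shows "new_row_upto x x T = 0"
proof (cases T)
  case (Cons r rs)
  with assms have "tab (r # rs)" "x \<notin> ents (r # rs)" by auto
  then show ?thesis using Cons by (cases rule: tableau_insert_cases) auto
qed simp

lemma row_count_Suc_notin: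
  assumes "Suc j \<notin> ents T"
  shows "row_count T k (Suc j) = row_count T k j"
  using assms
proof (induction T k j rule: row_count.induct)
  case (2 r rs j)
  then have "{e \<in> set r. e \<le> Suc j} = {e \<in> set r. e \<le> j}" by (auto simp: le_Suc_eq)
  then show ?case by simp
qed auto

lemma row_count_Suc_in:
  assumes "tab T" "Suc j \<in> ents T"
  obtains k where "\<And>k'. row_count T k' (Suc j) = row_count T k' j + (if k' = k then 1 else 0)"
proof -
  have "\<exists>k. \<forall>k'. row_count T k' (Suc j) = row_count T k' j + (if k' = k then 1 else 0)"
    using assms
  proof (induction T)
    case (Cons r rs)
    show ?case
    proof (cases "Suc j \<in> set r")
      case True
      then have "{e \<in> set r. e \<le> Suc j} = insert (Suc j) {e \<in> set r. e \<le> j}" by (auto simp: le_Suc_eq)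
      moreover have "Suc j \<notin> ents rs" using True Cons.prems by auto
      ultimately have "row_count (r # rs) k' (Suc j) = row_count (r # rs) k' j + (if k' = 0 then 1 else 0)" for k'
        by (cases k') (simp_all add: row_count_Suc_notin)
      then show ?thesis by blast
    next
      case False
      then have *: "{e \<in> set r. e \<le> Suc j} = {e \<in> set r. e \<le> j}" by (auto simp: le_Suc_eq)
      obtain k where "\<forall>k'. row_count rs k' (Suc j) = row_count rs k' j + (if k' = k then 1 else 0)"
        using Cons False by auto
      with * have "row_count (r # rs) k' (Suc j) = row_count (r # rs) k' j + (if k' = Suc k then 1 else 0)" for k'
        by (cases k') simp_all
      then show ?thesis by blast
    qed
  qed simp
  with that show thesis by blast
qed

text \<open>The local rule of Fomin's growth diagrams. It is symmetric in the two directions of the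
  diagram, which makes the insertion tableau of a permutation the recording tableau of its inverse.\<close>

lemma new_row_upto_Suc:
  assumes "tab T" "x \<notin> ents T" "x \<le> j"
  shows "new_row_upto (Suc j) x T = (let k = new_row_upto j x T in
    if row_count T k (Suc j) = row_count T k j then k else Suc k)"
  using assms
proof (induction T arbitrary: x)
  case (Cons r rs)
  from Cons.prems(1,2) show ?case
  proof (cases rule: tableau_insert_cases)
    case (None r')
    then have "{e \<in> set r. e \<le> Suc j} = {e \<in> set r. e \<le> j}"
      using Cons.prems by (auto simp: row_step_simps)
    with None show ?thesis by simp
  next
    case (Some r' y)
    consider "y \<le> j" | "y = Suc j" | "Suc j < y" by linarith
    then show ?thesis
    proof cases
      case 1
      then show ?thesis using Cons.IH[of y] Cons.prems Some by (auto simp: Let_def)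
    next
      \<comment> \<open>The letter \<open>Suc j\<close> itself is bumped. Seen up to
        \<open>Suc j\<close>, it comes to rest in the next row, so the gaining row moves down by
        one.\<close>
      case 2
      then have "{e \<in> set r. e \<le> Suc j} = insert (Suc j) {e \<in> set r. e \<le> j}"
        using Some by (auto simp: le_Suc_eq)
      then show ?thesis using 2 Some Cons.prems new_row_upto_self[of rs y] by (auto simp: Let_def)
    next
      case 3
      have "Suc j \<notin> set r"
        using Some(2) 3 Cons.prems by (force simp: row_step_simps)
      then have "{e \<in> set r. e \<le> Suc j} = {e \<in> set r. e \<le> j}" by (auto simp: le_Suc_eq)
      then show ?thesis using 3 Some by auto
    qed
  qed
qed simp

lemma new_row_upto_large:
  assumes "tab T" "x \<notin> ents T" "\<forall>e\<in>ents T. e \<le> j"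
  shows "new_row_upto j x T = new_row x T"
  using assms
proof (induction T arbitrary: x)
  case (Cons r rs)
  from Cons.prems(1,2) show ?case
    by (cases rule: tableau_insert_cases) (use Cons in auto)
qed simp

subsection \<open>Column strictness\<close>

text \<open>For increasing disjoint rows this means that entries increase down the columns and row
  lengths weakly decrease. The counting form avoids column indices and covers every restricted shape
  at once.\<close>

definition col_strict :: "nat list list \<Rightarrow> bool" where
  "col_strict T \<longleftrightarrow> (\<forall>k j. row_count T (Suc k) j \<le> row_count T k j)"

lemma col_strict_Cons:
  "col_strict (r # rs) \<longleftrightarrow>
    (\<forall>j. row_count rs 0 j \<le> card {e \<in> set r. e \<le> j}) \<and> col_strict rs"
  (is "?L \<longleftrightarrow> ?R")
proof
  assume L: ?L
  have "row_count rs 0 j \<le> card {e \<in> set r. e \<le> j}" for j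
    using L[unfolded col_strict_def, rule_format, of 0 j] by simp
  moreover have "row_count rs (Suc k) j \<le> row_count rs k j" for k j
    using L[unfolded col_strict_def, rule_format, of "Suc k" j] by simp
  ultimately show ?R by (simp add: col_strict_def)
next
  assume R: ?R
  show ?L
    unfolding col_strict_def
  proof (intro allI)
    fix k j
    show "row_count (r # rs) (Suc k) j \<le> row_count (r # rs) k j"
      using R by (cases k) (auto simp: col_strict_def)
  qed
qed

text \<open>Row \<open>Suc k\<close> gains a cell only if there is room below row \<open>k\<close>:
  the letter arriving there came from row \<open>k\<close>, where it is counted, while all counted
  letters of the lower row are smaller than it.\<close>

lemma row_count_pos:
  assumes "tab T" "x \<notin> ents T" "col_strict T" "x \<le> j" "Suc k = new_row_upto j x T"
  shows "row_count T (Suc k) j < row_count T k j"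
  using assms
proof (induction T arbitrary: x k)
  case (Cons r rs)
  from Cons.prems(1,2) show ?case
  proof (cases rule: tableau_insert_cases)
    case (None r')
    then show ?thesis using Cons.prems by simp
  next
    case (Some r' y)
    then have yj: "y \<le> j" and k: "k = new_row_upto j y rs"
      using Cons.prems by (auto split: if_splits)
    show ?thesis
    proof (cases k)
      case (Suc k')
      then show ?thesis using Cons.IH[of y k'] Cons.prems Some yj k col_strict_Cons by auto
    next
      case 0
      \<comment> \<open>Seen up to \<open>j\<close>, the letter \<open>y\<close> comes to rest in
        \<open>s\<close>, so whatever it bumps exceeds \<open>j\<close>; hence the entries of
        \<open>s\<close> up to \<open>j\<close> all lie below \<open>y\<close>.\<close>
      have le: "{e \<in> set s. e \<le> j} = {e \<in> set s. e \<le> y - 1}" if "rs = s # ss" for s ss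
      proof -
        have "tab (s # ss)" "y \<notin> ents (s # ss)" using that Cons.prems Some by auto
        then have "e < y" if "e \<in> set s" "e \<le> j" for e
        proof (cases rule: tableau_insert_cases)
          case None
          then show ?thesis using that by (simp add: row_step_simps)
        next
          case S: (Some s' z)
          then have "j < z" using 0 k \<open>rs = s # ss\<close> by (simp split: if_splits)
          moreover have "e \<noteq> y" using that \<open>rs = s # ss\<close> Some(7) by auto
          ultimately show ?thesis using S(2) that by (force simp: row_step_simps)
        qed
        then show ?thesis using yj \<open>x < y\<close> by fastforce
      qed
      have "row_count rs 0 j = row_count rs 0 (y - 1)"
        using le by (cases rs) auto
      also have "\<dots> \<le> card {e \<in> set r. e \<le> y - 1}"
        using Cons.prems(3) col_strict_Cons by blast
      also have "\<dots> < card {e \<in> set r. e \<le> j}"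
      proof (rule psubset_card_mono)
        have "y \<in> {e \<in> set r. e \<le> j}" "y \<notin> {e \<in> set r. e \<le> y - 1}" using yj Some by auto
        moreover have "{e \<in> set r. e \<le> y - 1} \<subseteq> {e \<in> set r. e \<le> j}" using yj by auto
        ultimately show "{e \<in> set r. e \<le> y - 1} \<subset> {e \<in> set r. e \<le> j}" by blast
      qed simp
      finally show ?thesis using 0 by simp
    qed
  qed
qed simp

lemma col_strict_insert:
  assumes "tab T" "x \<notin> ents T" "col_strict T"
  shows "col_strict (tableau_insert x T)"
  unfolding col_strict_def
proof (intro allI)
  fix k j
  have "row_count T (Suc k) j \<le> row_count T k j" using assms by (simp add: col_strict_def)
  moreover have "row_count T (Suc k) j < row_count T k j" if "x \<le> j" "Suc k = new_row_upto j x T"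
    using row_count_pos[OF assms that] .
  ultimately show "row_count (tableau_insert x T) (Suc k) j \<le> row_count (tableau_insert x T) k j"
    by (auto simp: row_count_insert[OF assms(1,2)])
qed

subsection \<open>Robinson-Schensted for permutations\<close>

fun ins_tab :: "(nat \<Rightarrow> nat) \<Rightarrow> nat \<Rightarrow> nat list list" where
  "ins_tab f 0 = []"
| "ins_tab f (Suc i) = tableau_insert (f (Suc i)) (ins_tab f i)"

text \<open>The row of \<open>i\<close> in the recording tableau. Only \<open>i\<close> from 1 on is
  meaningful, since \<open>i - 1\<close> truncates at 0.\<close>

definition rec_row :: "(nat \<Rightarrow> nat) \<Rightarrow> nat \<Rightarrow> nat" where
  "rec_row f i = new_row (f i) (ins_tab f (i - 1))"

lemma insertion_tableau_ins_tab: "insertion_tableau n w = ins_tab w n"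
  unfolding insertion_tableau_def by (induction n) auto

lemma ins_tab_tab:
  assumes "inj f"
  shows "tab (ins_tab f i) \<and> ents (ins_tab f i) = f ` {1..i} \<and> col_strict (ins_tab f i)"
proof (induction i)
  case 0
  then show ?case by (simp add: col_strict_def)
next
  case (Suc i)
  have "f (Suc i) \<notin> f ` {1..i}" using assms by (simp add: inj_image_mem_iff)
  moreover have "f ` {1..Suc i} = insert (f (Suc i)) (f ` {1..i})" by (simp add: atLeastAtMostSuc_conv)
  ultimately show ?case using Suc tableau_insert_tab col_strict_insert by simp
qed

lemma ins_tab_fresh: "inj f \<Longrightarrow> k \<notin> {1..i} \<Longrightarrow> f k \<notin> ents (ins_tab f i)"
  using ins_tab_tab[of f i] by (simp add: inj_image_mem_iff)

lemma row_count_0: "w permutes {1..n} \<Longrightarrow> row_count (ins_tab w i) k 0 = 0"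
proof -
  assume w: "w permutes {1..n}"
  have "\<forall>e\<in>ents T. 0 < e \<Longrightarrow> row_count T k 0 = 0" for T
    by (induction T k "0 :: nat" rule: row_count.induct) auto
  moreover have "0 < e" if "e \<in> ents (ins_tab w i)" for e
  proof -
    have "e \<in> w ` {1..i}" using that ins_tab_tab[OF permutes_inj[OF w], of i] by simp
    then obtain a where a: "e = w a" "1 \<le> a" by auto
    have "w 0 = 0" using w by (simp add: permutes_def)
    then have "w a \<noteq> 0" using a(2) permutes_inj[OF w] by (metis injD not_one_le_zero)
    then show ?thesis using a by simp
  qed
  ultimately show ?thesis by blast
qed

text \<open>Both sides are the vertex (i, j) of one growth diagram, which passing to the inverse
  transposes. The induction fills a square from its three earlier corners, and the rule for the
  fourth corner is symmetric.\<close>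

lemma row_count_symmetric:
  assumes w: "w permutes {1..n}"
  shows "row_count (ins_tab w i) k j = row_count (ins_tab (inv' w) j) k i"
proof (induction "i + j" arbitrary: i j k rule: less_induct)
  case less
  define u where "u = inv' w"
  have u: "u permutes {1..n}" using w permutes_inv u_def by blast
  have iw: "inj w" "inj u" using permutes_inj w u by auto
  have wu: "w a = b \<longleftrightarrow> u b = a" for a b
    using w by (auto simp: u_def permutes_inverses)
  have img: "b \<in> w ` S \<longleftrightarrow> u b \<in> S" "b \<in> u ` S \<longleftrightarrow> w b \<in> S" for b S
    using wu by (metis image_iff)+
  show ?case
  proof (cases "i = 0 \<or> j = 0")
    case True
    then show ?thesis using row_count_0[OF w] row_count_0[OF u] by (auto simp: u_def)
  next
    case False
    then obtain a b where ab: "i = Suc a" "j = Suc b" by (meson not0_implies_Suc)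
    let ?T = "ins_tab w a" and ?U = "ins_tab u b"
    have T: "tab ?T" "w (Suc a) \<notin> ents ?T" and U: "tab ?U" "u (Suc b) \<notin> ents ?U"
      using ins_tab_tab[OF iw(1)] ins_tab_tab[OF iw(2)] ins_tab_fresh[OF iw(1)] ins_tab_fresh[OF iw(2)] by auto
    have IH1: "row_count ?T k b = row_count ?U k a" for k
      using less[of a b] ab u_def by simp
    have IH2: "row_count ?T k (Suc b) = row_count (ins_tab u (Suc b)) k a" for k
      using less[of a "Suc b"] ab u_def by simp
    have IH3: "row_count (ins_tab w (Suc a)) k b = row_count ?U k (Suc a)" for k
      using less[of "Suc a" b] ab u_def by simp
    note rw = row_count_insert[OF T] and ru = row_count_insert[OF U]
    have Tin: "Suc b \<in> ents ?T \<longleftrightarrow> 1 \<le> u (Suc b) \<and> u (Suc b) \<le> a"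
      using ins_tab_tab[OF iw(1), of a] by (simp add: img)
    have Uin: "Suc a \<in> ents ?U \<longleftrightarrow> 1 \<le> w (Suc a) \<and> w (Suc a) \<le> b"
      using ins_tab_tab[OF iw(2), of b] by (simp add: img)
    have pos: "1 \<le> w (Suc a)" "1 \<le> u (Suc b)"
    proof -
      have "w 0 = 0" "u 0 = 0" using w u by (simp_all add: permutes_def)
      then show "1 \<le> w (Suc a)" "1 \<le> u (Suc b)" using iw by (metis Suc_leI inj_eq nat.distinct(1) neq0_conv One_nat_def)+
    qed
    \<comment> \<open>The points of the permutation relative to the new square: in the square,
      beyond it in one direction, beyond it in the other, or before it in both. Only the last case
      needs \<open>new_row_upto_Suc\<close>.\<close>
    consider "w (Suc a) = Suc b" | "Suc b < w (Suc a)" | "Suc a < u (Suc b)"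
      | "w (Suc a) \<le> b" "u (Suc b) \<le> a"
      using wu[of "Suc a" "Suc b"] by linarith
    then have "row_count (ins_tab w (Suc a)) k (Suc b) = row_count (ins_tab u (Suc b)) k (Suc a)"
    proof cases
      case 1
      then have "u (Suc b) = Suc a" using wu by simp
      moreover have "Suc b \<notin> ents ?T" "Suc a \<notin> ents ?U" using Tin Uin 1 calculation by auto
      ultimately show ?thesis
        using 1 rw[of k "Suc b"] ru[of k "Suc a"] IH1[of k] new_row_upto_self T U
        by (simp add: row_count_Suc_notin)
    next
      case 2
      then have "Suc a \<notin> ents ?U" using Uin by auto
      then have n: "row_count ?U k (Suc a) = row_count ?U k a" for k by (rule row_count_Suc_notin)
      have "Suc a \<notin> ents (ins_tab u (Suc b))"
        using ins_tab_tab[OF iw(2), of "Suc b"] 2 by (simp add: img)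
      then have "row_count (ins_tab u (Suc b)) k (Suc a) = row_count (ins_tab u (Suc b)) k a"
        by (rule row_count_Suc_notin)
      then show ?thesis using rw[of k "Suc b"] 2 IH2 by simp
    next
      case 3
      have "Suc b \<notin> ents (ins_tab w (Suc a))"
        using ins_tab_tab[OF iw(1), of "Suc a"] 3 by (simp add: img)
      then have "row_count (ins_tab w (Suc a)) k (Suc b) = row_count (ins_tab w (Suc a)) k b"
        by (rule row_count_Suc_notin)
      then show ?thesis using ru[of k "Suc a"] 3 IH3 by simp
    next
      case 4
      obtain s where s: "\<And>k. row_count ?T k (Suc b) = row_count ?T k b + (if k = s then 1 else 0)"
        using row_count_Suc_in[OF T(1)] Tin 4 pos by metis
      obtain t where t: "\<And>k. row_count ?U k (Suc a) = row_count ?U k a + (if k = t then 1 else 0)"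
        using row_count_Suc_in[OF U(1)] Uin 4 pos by metis
      \<comment> \<open>The corner (\<open>Suc a\<close>, \<open>b\<close>) is known from both
        diagrams; evaluating at \<open>k = t\<close> identifies the row it gains over
        (\<open>a\<close>, \<open>b\<close>).\<close>
      have "row_count ?T k b + (if k = new_row_upto b (w (Suc a)) ?T then 1 else 0) =
            row_count ?T k b + (if k = t then 1 else 0)" for k
        using IH3[of k] rw[of k b] t[of k] IH1[of k] 4 by simp
      from this[of t] have e1: "new_row_upto b (w (Suc a)) ?T = t" by (simp split: if_splits)
      have "row_count ?U k a + (if k = new_row_upto a (u (Suc b)) ?U then 1 else 0) =
            row_count ?U k a + (if k = s then 1 else 0)" for k
        using IH2[of k] ru[of k a] s[of k] IH1[of k] 4 by simp
      from this[of s] have e2: "new_row_upto a (u (Suc b)) ?U = s" by (simp split: if_splits)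
      have f1: "new_row_upto (Suc b) (w (Suc a)) ?T = (if t = s then Suc t else t)"
        using new_row_upto_Suc[OF T, of b] 4 e1 s by (simp add: Let_def)
      have f2: "new_row_upto (Suc a) (u (Suc b)) ?U = (if t = s then Suc s else s)"
        using new_row_upto_Suc[OF U, of a] 4 e2 t by (simp add: Let_def)
      show ?thesis
        using rw[of k "Suc b"] ru[of k "Suc a"] 4 f1 f2 s[of k] t[of k] IH1[of k] by auto
    qed
    then show ?thesis using ab u_def by simp
  qed
qed

lemma Sym_iff: "w \<in> Sym n \<longleftrightarrow> w permutes {1..n}"
  by (simp add: sym_group_carrier)

subsection \<open>The insertion tableau is encoded by the recording rows of the inverse\<close>

lemma ins_tab_bound:
  assumes "w permutes {1..n}" "i \<le> n" "e \<in> ents (ins_tab w i)"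
  shows "e \<in> {1..n}"
proof -
  have "e \<in> w ` {1..i}" using ins_tab_tab[OF permutes_inj[OF assms(1)], of i] assms(3) by simp
  then show ?thesis using permutes_in_image[OF assms(1)] assms(2) by fastforce
qed

lemma ins_tab_le: "w permutes {1..n} \<Longrightarrow> \<forall>e\<in>ents (ins_tab w n). e \<le> n"
  using ins_tab_bound[of w n n] by fastforce

lemma card_filter_Suc:
  "card {a \<in> {1..Suc m}. f a = k} = card {a \<in> {1..m}. f a = k} + (if f (Suc m) = k then 1 else 0)"
proof -
  have "{a \<in> {1..Suc m}. f a = k} =
      (if f (Suc m) = k then insert (Suc m) {a \<in> {1..m}. f a = k} else {a \<in> {1..m}. f a = k})"
    by (auto simp: le_Suc_eq)
  then show ?thesis by auto
qed

lemma row_count_rec_row: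
  assumes w: "w permutes {1..n}" and "i \<le> n"
  shows "row_count (ins_tab w i) k n = card {a \<in> {1..i}. rec_row w a = k}"
  using assms(2)
proof (induction i)
  case (Suc i)
  have inj: "inj w" using permutes_inj[OF w] .
  have T: "tab (ins_tab w i)" "w (Suc i) \<notin> ents (ins_tab w i)"
    using ins_tab_tab[OF inj] ins_tab_fresh[OF inj] by auto
  have "w (Suc i) \<le> n" using permutes_in_image[OF w, of "Suc i"] Suc.prems by auto
  moreover have "new_row_upto n (w (Suc i)) (ins_tab w i) = rec_row w (Suc i)"
    unfolding rec_row_def
    using new_row_upto_large[OF T, of n] ins_tab_bound[OF w, of i] Suc.prems by auto
  ultimately show ?case
    unfolding card_filter_Suc using row_count_insert[OF T, of k n] Suc by auto
qed simp

text \<open>By symmetry, the entries at most \<open>j\<close> of the insertion tableau of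
  \<open>w\<close> have the shape reached after \<open>j\<close> letters of the inverse, and
  recorded rows count that shape.\<close>

lemma row_count_inverse:
  assumes "w permutes {1..n}" "j \<le> n"
  shows "row_count (ins_tab w n) k j = card {a \<in> {1..j}. rec_row (inv' w) a = k}"
  using row_count_symmetric[OF assms(1)] row_count_rec_row[OF permutes_inv[OF assms(1)] assms(2)]
  by simp

text \<open>A number belongs to a finite set exactly when the counting function jumps there; the
  value before 0 is taken to be 0.\<close>

lemma row_count_eqD:
  assumes "finite R" "finite R'" "\<And>j. card {e \<in> R. e \<le> j} = card {e \<in> R'. e \<le> (j :: nat)}"
  shows "R = R'"
proof -
  have mem: "e \<in> A \<longleftrightarrow> card {x \<in> A. x \<le> e} \<noteq> (if e = 0 then 0 else card {x \<in> A. x \<le> e - 1})"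
    if "finite A" for A and e :: nat
  proof (cases "e \<in> A")
    case True
    have "{x \<in> A. x \<le> e} = insert e {x \<in> A. x < e}" using True by auto
    then have "card {x \<in> A. x \<le> e} = Suc (card {x \<in> A. x < e})" using that by simp
    moreover have "{x \<in> A. x < e} = (if e = 0 then {} else {x \<in> A. x \<le> e - 1})"
      by (cases e) (simp_all add: less_Suc_eq_le)
    ultimately show ?thesis using True by simp
  next
    case False
    have "{x \<in> A. x \<le> e} = (if e = 0 then {} else {x \<in> A. x \<le> e - 1})"
      using False by (auto simp: le_less)
    then show ?thesis using False by auto
  qed
  have "e \<in> R \<longleftrightarrow> e \<in> R'" for e
    unfolding mem[OF assms(1), of e] mem[OF assms(2), of e] assms(3) ..
  then show ?thesis by blast
qed

lemma card_le_not_0: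
  fixes r :: "nat list"
  assumes "r \<noteq> []"
  shows "\<exists>j. card {e \<in> set r. e \<le> j} \<noteq> 0"
  using hd_in_set[OF assms] by (intro exI[of _ "hd r"]) auto

lemma tab_eqI:
  assumes "tab T" "tab T'" "\<And>k j. row_count T k j = row_count T' k j"
  shows "T = T'"
  using assms
proof (induction T arbitrary: T')
  case Nil
  show ?case
  proof (cases T')
    case (Cons r rs)
    have "card {e \<in> set r. e \<le> j} = 0" for j using Nil(3)[of 0 j] Cons by simp
    then show ?thesis using card_le_not_0[of r] Cons Nil by auto
  qed simp
next
  case (Cons r rs)
  show ?case
  proof (cases T')
    case Nil
    have "card {e \<in> set r. e \<le> j} = 0" for j using Cons.prems(3)[of 0 j] Nil by simp
    then show ?thesis using card_le_not_0[of r] Cons.prems by auto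
  next
    case C: (Cons s ss)
    have "set r = set s"
      by (rule row_count_eqD) (use Cons.prems(3)[of 0] C in auto)
    moreover have "rs = ss"
      by (rule Cons.IH) (use Cons.prems(1,2) Cons.prems(3)[of "Suc _"] C in auto)
    ultimately show ?thesis using Cons.prems C sorted_wrt_less_eqI by auto
  qed
qed

lemma row_count_beyond:
  assumes "\<forall>e\<in>ents T. e \<le> n" "n \<le> j"
  shows "row_count T k j = row_count T k n"
  using assms(2)
proof (induction j rule: dec_induct)
  case (step j)
  then have "Suc j \<notin> ents T" using assms(1) by fastforce
  then show ?case using step row_count_Suc_notin by simp
qed simp

text \<open>The entry \<open>i\<close> sits in row \<open>rec_row (inv' w) i\<close> of the
  insertion tableau of \<open>w\<close>. Differences of consecutive counts recover this row, and the
  rows recover all counts, hence the tableau.\<close>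

lemma insertion_tableau_eq_iff:
  assumes w: "w permutes {1..n}" and w': "w' permutes {1..n}"
  shows "insertion_tableau n w = insertion_tableau n w' \<longleftrightarrow>
    (\<forall>i\<in>{1..n}. rec_row (inv' w) i = rec_row (inv' w') i)" (is "?L \<longleftrightarrow> ?R")
proof
  assume L: ?L
  have c: "card {a \<in> {1..j}. rec_row (inv' w) a = k} = card {a \<in> {1..j}. rec_row (inv' w') a = k}"
    if "j \<le> n" for j k
    using L row_count_inverse[OF w that] row_count_inverse[OF w' that]
    by (simp add: insertion_tableau_ins_tab)
  show ?R
  proof
    fix i assume i: "i \<in> {1..n}"
    then obtain j where j: "i = Suc j" by (cases i) auto
    define K where "K = rec_row (inv' w') (Suc j)"
    have "(if rec_row (inv' w) (Suc j) = K then 1 else 0 :: nat) = 1"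
      using c[of "Suc j" K] c[of j K] i j
      unfolding card_filter_Suc K_def by simp
    then show "rec_row (inv' w) i = rec_row (inv' w') i"
      by (simp add: j K_def split: if_splits)
  qed
next
  assume R: ?R
  have c: "row_count (ins_tab w n) k j = row_count (ins_tab w' n) k j" if "j \<le> n" for j k
  proof -
    have "{a \<in> {1..j}. rec_row (inv' w) a = k} = {a \<in> {1..j}. rec_row (inv' w') a = k}"
      using R that by auto
    then show ?thesis using row_count_inverse[OF w that] row_count_inverse[OF w' that] by simp
  qed
  have "ins_tab w n = ins_tab w' n"
  proof (rule tab_eqI)
    fix k j
    show "row_count (ins_tab w n) k j = row_count (ins_tab w' n) k j"
    proof (cases "j \<le> n")
      case False
      then have "n \<le> j" by simp
      from row_count_beyond[OF ins_tab_le[OF w] this] row_count_beyond[OF ins_tab_le[OF w'] this]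
      show ?thesis using c[OF order_refl] by simp
    qed (use c in simp)
  qed (use ins_tab_tab permutes_inj w w' in auto)
  then show ?L by (simp add: insertion_tableau_ins_tab)
qed

lemma row_count_length:
  assumes "\<forall>e\<in>ents T. e \<le> n" "tab T"
  shows "row_count T k n = (if k < length T then length (T ! k) else 0)"
  using assms
proof (induction T k n rule: row_count.induct)
  case (2 r rs j)
  have "{e \<in> set r. e \<le> j} = set r" using 2 by auto
  moreover have "distinct r" using 2 by (auto simp: strict_sorted_iff)
  ultimately show ?case by (simp add: distinct_card)
qed auto

lemma shape_row_count:
  assumes "w permutes {1..n}" "w' permutes {1..n}"
    "shape (insertion_tableau n w) = shape (insertion_tableau n w')"
  shows "row_count (ins_tab w n) k n = row_count (ins_tab w' n) k n"
proof -
  have "row_count (ins_tab v n) k n = (let s = shape (ins_tab v n) in if k < length s then s ! k else 0)"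
    if "v permutes {1..n}" for v
    using row_count_length[OF ins_tab_le[OF that], of k] ins_tab_tab[OF permutes_inj[OF that], of n]
    by (simp add: shape_def Let_def)
  then show ?thesis using assms by (simp add: insertion_tableau_ins_tab)
qed

text \<open>The last recorded row starts a reverse insertion, which yields the last letter and the
  previous tableau.\<close>

lemma ins_tab_inj:
  assumes w: "w permutes {1..n}" and w': "w' permutes {1..n}"
    and "ins_tab w n = ins_tab w' n" "\<forall>i\<in>{1..n}. rec_row w i = rec_row w' i"
  shows "w = w'"
proof -
  have "m \<le> n \<Longrightarrow> ins_tab w m = ins_tab w' m \<Longrightarrow> (\<forall>i\<in>{1..m}. w i = w' i)" for m
  proof (induction m)
    case (Suc m)
    have T: "tab (ins_tab v m)" "v (Suc m) \<notin> ents (ins_tab v m)" if "v permutes {1..n}" for v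
      using ins_tab_tab ins_tab_fresh permutes_inj[OF that] by auto
    have "rec_row w (Suc m) = rec_row w' (Suc m)" using assms(4) Suc.prems by simp
    then have "w (Suc m) = w' (Suc m) \<and> ins_tab w m = ins_tab w' m"
      using tableau_insert_inj[OF T(1)[OF w] T(1)[OF w'] T(2)[OF w] T(2)[OF w']] Suc.prems
      by (simp add: rec_row_def)
    then show ?case using Suc by (auto simp: le_Suc_eq)
  qed simp
  then have "w i = w' i" if "i \<in> {1..n}" for i using that assms(3) by blast
  moreover have "w i = w' i" if "i \<notin> {1..n}" for i using that w w' by (simp add: permutes_def)
  ultimately show ?thesis by blast
qed

text \<open>The insertion tableaux of \<open>w\<close> and of its inverse play the role of the
  Robinson-Schensted pair, and inversion swaps them.\<close>

lemma involution_iff: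
  assumes w: "w permutes {1..n}"
  shows "w \<circ> w = id \<longleftrightarrow> insertion_tableau n (inv' w) = insertion_tableau n w"
proof
  assume "w \<circ> w = id"
  then have "inv' w = w" using w by (metis inv_unique_comp)
  then show "insertion_tableau n (inv' w) = insertion_tableau n w" by simp
next
  assume a: "insertion_tableau n (inv' w) = insertion_tableau n w"
  have i: "inv' w permutes {1..n}" "inv' (inv' w) = w" using w permutes_inv permutes_inv_inv by auto
  have "inv' w = w"
    by (rule ins_tab_inj[OF i(1) w])
      (use a insertion_tableau_eq_iff[OF i(1) w] i(2) in \<open>auto simp: insertion_tableau_ins_tab\<close>)
  then show "w \<circ> w = id" using w permutes_inv_o(1) by metis
qed

lemma insertion_tableau_pair_inj:
  assumes "w permutes {1..n}" "w' permutes {1..n}"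
    "insertion_tableau n w = insertion_tableau n w'"
    "insertion_tableau n (inv' w) = insertion_tableau n (inv' w')"
  shows "w = w'"
proof -
  have "inv' w = inv' w'"
    by (rule ins_tab_inj[OF permutes_inv[OF assms(1)] permutes_inv[OF assms(2)]])
      (use assms insertion_tableau_eq_iff[OF assms(1,2)] in \<open>auto simp: insertion_tableau_ins_tab\<close>)
  then show ?thesis using assms permutes_inv_inv by metis
qed

subsection \<open>Descents and star operations\<close>

definition srefl :: "nat \<Rightarrow> nat \<Rightarrow> nat" where
  "srefl i = transpose i (Suc i)"

definition lmul :: "nat \<Rightarrow> (nat \<Rightarrow> nat) \<Rightarrow> (nat \<Rightarrow> nat)" where
  "lmul i w = srefl i \<circ> w"

definition rmul :: "nat \<Rightarrow> (nat \<Rightarrow> nat) \<Rightarrow> (nat \<Rightarrow> nat)" where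
  "rmul j w = w \<circ> srefl j"

text \<open>The left descent condition: left multiplication by \<open>srefl i\<close> shortens
  \<open>w\<close> exactly when \<open>Suc i\<close> stands to the left of \<open>i\<close> in its
  word.\<close>

definition ldesc :: "nat \<Rightarrow> (nat \<Rightarrow> nat) \<Rightarrow> bool" where
  "ldesc i w \<longleftrightarrow> inv' w (Suc i) < inv' w i"

text \<open>The left star operation of Kazhdan and Lusztig, meant for adjacent \<open>i\<close>,
  \<open>j\<close> with \<open>i\<close> a left descent of \<open>w\<close> and \<open>j\<close>
  none. It selects the one product that has left descent \<open>j\<close> but not
  \<open>i\<close>.\<close>

definition star :: "nat \<Rightarrow> nat \<Rightarrow> (nat \<Rightarrow> nat) \<Rightarrow> (nat \<Rightarrow> nat)" where
  "star i j w = (if ldesc i (lmul j w) then lmul i w else lmul j w)"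

lemma srefl_comp [simp]: "srefl i \<circ> srefl i = id"
  by (simp add: srefl_def)

lemma srefl_Sym: "i \<in> {1..<n} \<Longrightarrow> srefl i \<in> Sym n"
  unfolding Sym_iff srefl_def by (rule permutes_swap_id) auto

lemma comp_Sym: "x \<in> Sym n \<Longrightarrow> y \<in> Sym n \<Longrightarrow> x \<circ> y \<in> Sym n"
  by (simp add: Sym_iff permutes_compose)

lemma inv_Sym: "x \<in> Sym n \<Longrightarrow> inv' x \<in> Sym n"
  by (simp add: Sym_iff permutes_inv)

lemma lmul_Sym: "w \<in> Sym n \<Longrightarrow> i \<in> {1..<n} \<Longrightarrow> lmul i w \<in> Sym n"
  unfolding lmul_def by (intro comp_Sym srefl_Sym)

lemma rmul_Sym: "w \<in> Sym n \<Longrightarrow> i \<in> {1..<n} \<Longrightarrow> rmul i w \<in> Sym n"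
  unfolding rmul_def by (intro comp_Sym srefl_Sym)

lemma lmul_lmul [simp]: "lmul i (lmul i w) = w"
  by (simp add: lmul_def srefl_def comp_assoc[symmetric])

lemma rmul_lmul: "rmul j (lmul i w) = lmul i (rmul j w)"
  unfolding lmul_def rmul_def by (rule comp_assoc)

lemma lmul_id [simp]: "lmul i id = srefl i"
  unfolding lmul_def by (rule comp_id)

lemma lmul_eq_iff: "lmul i w = x \<longleftrightarrow> w = lmul i x"
  by (metis lmul_lmul)

lemma inv_lmul: "w \<in> Sym n \<Longrightarrow> inv' (lmul i w) = rmul i (inv' w)"
  unfolding lmul_def rmul_def Sym_iff by (simp add: permutes_bij o_inv_distrib srefl_def)

lemma ldesc_lmul_srefl:
  "w \<in> Sym n \<Longrightarrow> ldesc i (lmul j w) \<longleftrightarrow> inv' w (srefl j (Suc i)) < inv' w (srefl j i)"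
  by (simp add: ldesc_def inv_lmul rmul_def)

lemma ldesc_lmul:
  assumes "w \<in> Sym n"
  shows "ldesc i (lmul i w) \<longleftrightarrow> \<not> ldesc i w"
proof -
  have "inv' w i \<noteq> inv' w (Suc i)"
    using assms permutes_inj[OF permutes_inv] unfolding Sym_iff by (metis injD n_not_Suc_n)
  then show ?thesis using ldesc_lmul_srefl[OF assms, of i i] by (auto simp: ldesc_def srefl_def)
qed

text \<open>This is row bumping in the word of the inverse. Consequently left descents depend only
  on the right cell.\<close>

lemma ldesc_rec_row:
  assumes "w permutes {1..n}" "1 \<le> i"
  shows "ldesc i w \<longleftrightarrow> rec_row (inv' w) i < rec_row (inv' w) (Suc i)"
proof -
  define u where "u = inv' w"
  have u: "inj u" using assms permutes_inj permutes_inv u_def by blast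
  obtain m where m: "i = Suc m" using assms(2) by (cases i) auto
  have T: "tab (ins_tab u m)" "u (Suc m) \<notin> ents (ins_tab u m)" "u (Suc (Suc m)) \<notin> ents (ins_tab u m)"
    using ins_tab_tab[OF u] ins_tab_fresh[OF u] by auto
  have "u (Suc m) \<noteq> u (Suc (Suc m))" using u by (simp add: inj_eq)
  then show ?thesis
    using new_row_next[OF T] by (simp add: ldesc_def rec_row_def m u_def[symmetric])
qed

lemma ins_tab_cong: "(\<And>a. 1 \<le> a \<Longrightarrow> a \<le> m \<Longrightarrow> f a = g a) \<Longrightarrow> ins_tab f m = ins_tab g m"
  by (induction m) auto

text \<open>The words differ only in three consecutive letters. The tableau before them is common,
  \<open>rel\<close> makes the tableau after them common, and equal insertions follow, so only the
  three middle rows can change.\<close>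

lemma knuth_word:
  assumes u: "inj u" and k: "1 \<le> k" and out: "\<And>a. a \<notin> {k..k + 2} \<Longrightarrow> u' a = u a"
    and rel: "\<And>T. tab T \<Longrightarrow> {u k, u (k + 1), u (k + 2)} \<inter> ents T = {} \<Longrightarrow>
      knuth_rel (insert3 (u k) (u (k + 1)) (u (k + 2)) T) (insert3 (u' k) (u' (k + 1)) (u' (k + 2)) T)"
  shows "k + 2 \<le> m \<Longrightarrow> ins_tab u' m = ins_tab u m"
    and "a \<notin> {k..k + 2} \<Longrightarrow> 1 \<le> a \<Longrightarrow> rec_row u' a = rec_row u a"
    and "row_move (rec_row u k) (rec_row u (k + 1)) (rec_row u (k + 2))
           (rec_row u' k) (rec_row u' (k + 1)) (rec_row u' (k + 2))"
proof -
  obtain m0 where m0: "k = Suc m0" using k by (cases k) auto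
  have pre: "ins_tab u' b = ins_tab u b" if "b \<le> m0" for b
    by (rule ins_tab_cong) (use that out m0 in auto)
  have I: "insert3 (v k) (v (k + 1)) (v (k + 2)) (ins_tab v m0) =
    (ins_tab v (k + 2), rec_row v k, rec_row v (k + 1), rec_row v (k + 2))" for v
    by (simp add: insert3_def m0 rec_row_def Let_def)
  have "knuth_rel (insert3 (u k) (u (k + 1)) (u (k + 2)) (ins_tab u m0))
     (insert3 (u' k) (u' (k + 1)) (u' (k + 2)) (ins_tab u m0))"
    using rel[of "ins_tab u m0"] ins_tab_tab[OF u] ins_tab_fresh[OF u, of _ m0] m0 by auto
  then have R: "ins_tab u' (k + 2) = ins_tab u (k + 2)"
    "row_move (rec_row u k) (rec_row u (k + 1)) (rec_row u (k + 2))
           (rec_row u' k) (rec_row u' (k + 1)) (rec_row u' (k + 2))"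
    using I[of u] I[of u'] pre[of m0] by (auto simp: knuth_rel_def)
  then show "row_move (rec_row u k) (rec_row u (k + 1)) (rec_row u (k + 2))
           (rec_row u' k) (rec_row u' (k + 1)) (rec_row u' (k + 2))" by simp
  show post: "ins_tab u' m = ins_tab u m" if "k + 2 \<le> m" for m
    using that
  proof (induction m rule: dec_induct)
    case (step m)
    then show ?case using out[of "Suc m"] by simp
  qed (use R in simp)
  show "rec_row u' a = rec_row u a" if "a \<notin> {k..k + 2}" "1 \<le> a"
  proof -
    have "ins_tab u' (a - 1) = ins_tab u (a - 1)"
      using that pre[of "a - 1"] post[of "a - 1"] m0 by (cases "a < k") auto
    then show ?thesis using out[OF that(1)] by (simp add: rec_row_def)
  qed
qed

lemma star_Sym:
  assumes "w \<in> Sym n" "i \<in> {1..<n}" "j \<in> {1..<n}"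
  shows "star i j w \<in> Sym n"
  using assms lmul_Sym by (simp add: star_def)

lemma star_rec_row:
  assumes w: "w \<in> Sym n" and k: "1 \<le> k" "k + 2 \<le> n" and ij: "{i, j} = {k, Suc k}"
    and d: "ldesc i w" "\<not> ldesc j w"
  defines "u \<equiv> inv' w" and "u' \<equiv> inv' (star i j w)"
  shows "insertion_tableau n u' = insertion_tableau n u"
    and "a \<notin> {k..k + 2} \<Longrightarrow> 1 \<le> a \<Longrightarrow> rec_row u' a = rec_row u a"
    and "row_move (rec_row u k) (rec_row u (k + 1)) (rec_row u (k + 2))
           (rec_row u' k) (rec_row u' (k + 1)) (rec_row u' (k + 2))"
proof -
  have inj: "inj u" using w permutes_inj permutes_inv unfolding u_def Sym_iff by blast
  have u': "u' = (if ldesc i (lmul j w) then rmul i u else rmul j u)"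
    using inv_lmul[OF w] by (simp add: u'_def u_def star_def)
  have ne: "u k \<noteq> u (k + 1)" "u k \<noteq> u (k + 2)" "u (k + 1) \<noteq> u (k + 2)"
    using inj by (simp_all add: inj_eq)
  have out: "u' a = u a" if "a \<notin> {k..k + 2}" for a
    using that ij by (auto simp: u' rmul_def srefl_def transpose_def doubleton_eq_iff)
  let ?A = "u k" and ?B = "u (k + 1)" and ?C = "u (k + 2)"
  \<comment> \<open>The comparison of the two outer letters decides which product
    \<open>star\<close> takes, and at the same time which kind of Knuth move occurs.\<close>
  have LA: "ldesc i (lmul j w) \<longleftrightarrow> ?C < ?A"
    using ldesc_lmul_srefl[OF w, of i j] ij by (auto simp: u_def srefl_def transpose_def doubleton_eq_iff)
  have rel: "knuth_rel (insert3 ?A ?B ?C T) (insert3 (u' k) (u' (k + 1)) (u' (k + 2)) T)"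
    if T: "tab T" "{?A, ?B, ?C} \<inter> ents T = {}" for T
  proof -
    note K = insert3_knuth[OF T(1)]
    consider "i = k" "j = k + 1" | "i = k + 1" "j = k" using ij by (auto simp: doubleton_eq_iff)
    then show ?thesis
    proof cases
      case 1
      then have AB: "?B < ?A" "?B < ?C" using d ne by (auto simp: ldesc_def u_def)
      show ?thesis
      proof (cases "?C < ?A")
        case True
        then have "u' k = ?B" "u' (k + 1) = ?A" "u' (k + 2) = ?C"
          using 1 LA by (auto simp: u' rmul_def srefl_def)
        then show ?thesis using K[of ?B ?C ?A] True AB T(2) knuth_rel_sym by auto
      next
        case False
        then have "u' k = ?A" "u' (k + 1) = ?C" "u' (k + 2) = ?B"
          using 1 LA by (auto simp: u' rmul_def srefl_def)
        then show ?thesis using K[of ?B ?A ?C] False ne AB T(2) knuth_rel_sym by auto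
      qed
    next
      case 2
      then have AB: "?C < ?B" "?A < ?B" using d ne by (auto simp: ldesc_def u_def)
      show ?thesis
      proof (cases "?C < ?A")
        case True
        then have "u' k = ?A" "u' (k + 1) = ?C" "u' (k + 2) = ?B"
          using 2 LA by (auto simp: u' rmul_def srefl_def)
        then show ?thesis using K[of ?C ?A ?B] True AB T(2) knuth_rel_sym by auto
      next
        case False
        then have "u' k = ?B" "u' (k + 1) = ?A" "u' (k + 2) = ?C"
          using 2 LA by (auto simp: u' rmul_def srefl_def)
        then show ?thesis using K[of ?A ?C ?B] False ne AB T(2) knuth_rel_sym by auto
      qed
    qed
  qed
  show "insertion_tableau n u' = insertion_tableau n u"
    using knuth_word(1)[OF inj k(1) out rel k(2)] by (simp add: insertion_tableau_ins_tab)
  show "rec_row u' a = rec_row u a" if "a \<notin> {k..k + 2}" "1 \<le> a" using knuth_word(2)[OF inj k(1) out rel that] .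
  show "row_move (rec_row u k) (rec_row u (k + 1)) (rec_row u (k + 2))
           (rec_row u' k) (rec_row u' (k + 1)) (rec_row u' (k + 2))" using knuth_word(3)[OF inj k(1) out rel] .
qed

subsection \<open>Lattice words\<close>

text \<open>Words of row indices are read backwards, so that the last letter comes first.\<close>

fun lattice_word :: "nat list \<Rightarrow> bool" where
  "lattice_word [] \<longleftrightarrow> True"
| "lattice_word (r # l) \<longleftrightarrow>
     lattice_word l \<and> (\<forall>k. count (mset (r # l)) (Suc k) \<le> count (mset (r # l)) k)"

definition word_move :: "nat list \<Rightarrow> nat list \<Rightarrow> bool" where
  "word_move l l' \<longleftrightarrow> (\<exists>p q a b c a' b' c'.
     l = p @ [c, b, a] @ q \<and> l' = p @ [c', b', a'] @ q \<and> row_move a b c a' b' c')"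

abbreviation word_moves :: "nat list \<Rightarrow> nat list \<Rightarrow> bool" where
  "word_moves \<equiv> word_move\<^sup>*\<^sup>*"

text \<open>Removing one copy of the largest letter keeps the counts weakly decreasing, as no larger
  letter occurs; so this letter can be put in front of a word for the rest.\<close>

lemma lattice_word_exists:
  assumes "\<And>k. count M (Suc k) \<le> count M k"
  shows "\<exists>l. lattice_word l \<and> mset l = M"
  using assms
proof (induction "size M" arbitrary: M)
  case 0
  then show ?case by (intro exI[of _ "[]"]) auto
next
  case (Suc m)
  define q where "q = Max (set_mset M)"
  have ne: "M \<noteq> {#}" using Suc.hyps(2) by auto
  then have q: "q \<in># M" unfolding q_def by (intro Max_in) auto
  have q1: "count M (Suc q) = 0"
  proof (rule ccontr)
    assume "count M (Suc q) \<noteq> 0"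
    then have "Suc q \<in># M" by (simp add: count_eq_zero_iff)
    then have "Suc q \<le> q" unfolding q_def by (intro Max_ge) auto
    then show False by simp
  qed
  have "count (M - {#q#}) (Suc k) \<le> count (M - {#q#}) k" for k
    using Suc.prems[of k] q1 by auto
  moreover have "m = size (M - {#q#})" using Suc.hyps(2) q by (simp add: size_Diff_singleton)
  ultimately obtain l where l: "lattice_word l" "mset l = M - {#q#}" using Suc.hyps(1) by blast
  have "mset (q # l) = M" using l q by simp
  moreover have "lattice_word (q # l)"
    using l Suc.prems \<open>mset (q # l) = M\<close> by (simp del: mset.simps)
  ultimately show ?case by blast
qed

lemma lattice_word_count: "lattice_word l \<Longrightarrow> count (mset l) (Suc k) \<le> count (mset l) k"
  by (cases l) auto

lemma word_move_Cons: "word_move l l' \<Longrightarrow> word_move (r # l) (r # l')"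
  unfolding word_move_def by (metis append_Cons)

lemma word_moves_Cons: "word_moves l l' \<Longrightarrow> word_moves (r # l) (r # l')"
  by (induction rule: rtranclp_induct) (auto intro: word_move_Cons rtranclp.rtrancl_into_rtrancl)

lemma word_move_sym: "word_move l l' \<Longrightarrow> word_move l' l"
  unfolding word_move_def using row_move_sym by blast

lemma word_moves_sym: "word_moves l l' \<Longrightarrow> word_moves l' l"
  by (induction rule: rtranclp_induct) (auto intro: word_move_sym converse_rtranclp_into_rtranclp)

lemma exists_drop:
  fixes f :: "nat \<Rightarrow> nat"
  assumes "f (a + d) < f a"
  shows "\<exists>q. a \<le> q \<and> q < a + d \<and> f (Suc q) < f q"
  using assms
proof (induction d)
  case (Suc d)
  show ?case
  proof (cases "f (a + d) < f a")
    case True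
    then show ?thesis using Suc.IH by fastforce
  next
    case False
    then show ?thesis using Suc.prems by (intro exI[of _ "a + d"]) auto
  qed
qed simp

text \<open>Connectedness of the standard tableaux of one shape under dual Knuth moves, stated for
  row words. If the largest entry lies in different rows, each tableau is first moved by induction
  until the two differ by a single move of the three largest entries.\<close>

lemma word_moves_connected:
  assumes "lattice_word l" "lattice_word l'" "mset l = mset l'"
  shows "word_moves l l'"
  using assms
proof (induction "length l" arbitrary: l l')
  case 0
  then show ?case by simp
next
  case (Suc N)
  have swap: "word_moves (r # m) (r' # m')"
    if *: "lattice_word (r # m)" "lattice_word (r' # m')" "mset (r # m) = mset (r' # m')"
      "r < r'" "length m = N" for r r' m m'
  proof -
    define L where "L = mset (r # m)"
    define M where "M = L - {#r#} - {#r'#}"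
    have Lm: "L = add_mset r (mset m)" "L = add_mset r' (mset m')" using * by (auto simp: L_def)
    have L: "count L (Suc k) \<le> count L k" for k
      using lattice_word_count[OF *(1), of k] by (simp add: L_def)
    have cm: "count (mset m) k = (if k = r then count L k - 1 else count L k)"
      "count (mset m') k = (if k = r' then count L k - 1 else count L k)" for k
      using arg_cong[OF Lm(1), of "\<lambda>M. count M k"] arg_cong[OF Lm(2), of "\<lambda>M. count M k"] by auto
    have pos: "0 < count L r" "0 < count L r'" using Lm by (metis count_add_mset zero_less_Suc)+
    \<comment> \<open>Because the remaining words are lattice words, the rows \<open>r\<close> and
      \<open>r'\<close> both end in a removable cell of the common shape.\<close>
    have "count L (Suc r) \<le> count L r - 1" "count L (Suc r') \<le> count L r' - 1"
      using lattice_word_count[of m r] lattice_word_count[of m' r'] *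
        cm(1)[of r] cm(1)[of "Suc r"] cm(2)[of r'] cm(2)[of "Suc r'"] by simp_all
    then have dr: "count L (Suc r) < count L r" "count L (Suc r') < count L r'"
      using pos by linarith+
    have cM: "count M k = (if k = r \<or> k = r' then count L k - 1 else count L k)" for k
      using *(4) by (simp add: M_def)
    have Mp: "count M (Suc k) \<le> count M k" for k
      using L[of k] dr cM[of k] cM[of "Suc k"] by auto
    have mono: "count L (Suc r + d) \<le> count L (Suc r)" for d
      by (induction d) (use L order_trans in auto)
    have "count L r' \<le> count L (Suc r)"
      using mono[of "r' - Suc r"] *(4) by simp
    then have "count M r' < count M r"
      using dr pos cM[of r] cM[of r'] *(4) by auto
    \<comment> \<open>Row \<open>q\<close> ends in a removable cell of what is left and lies between
      the two corners. With the third largest entry there, exchanging the two largest is a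
      \<open>row_move\<close>.\<close>
    then obtain q where q: "r \<le> q" "q < r'" "count M (Suc q) < count M q"
      using exists_drop[of "count M" r "r' - r"] *(4) by auto
    have "count (M - {#q#}) (Suc k) \<le> count (M - {#q#}) k" for k
      using Mp[of k] q(3) by auto
    then obtain t where t: "lattice_word t" "mset t = M - {#q#}"
      using lattice_word_exists by blast
    have qM: "q \<in># M" using q(3) by (metis count_eq_zero_iff not_less_zero)
    then have qt: "mset (q # t) = M" using t by simp
    have lq: "lattice_word (q # t)" using t qt Mp by (simp del: mset.simps)
    have rL: "r \<in># L" "r' \<in># L" using pos by (simp_all add: count_greater_zero_iff)
    have r'L: "r' \<in># L - {#r#}" "r \<in># L - {#r'#}" using rL *(4) by (auto simp: in_diff_count)
    have m1: "mset (r' # q # t) = mset m"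
      using qt r'L Lm by (simp add: M_def)
    have m': "mset m' = L - {#r'#}" unfolding Lm(2) by simp
    have "M = mset m' - {#r#}" unfolding m' M_def by (simp add: add_mset_commute)
    moreover have "r \<in># mset m'" using r'L(2) unfolding m' .
    ultimately have m2: "mset (r # q # t) = mset m'"
      using qt by simp
    have l1: "lattice_word (r' # q # t)"
      using lq m1 lattice_word_count[of m] * by (simp del: mset.simps)
    have l2: "lattice_word (r # q # t)"
      using lq m2 lattice_word_count[of m'] * by (simp del: mset.simps)
    have len: "length (r' # q # t) = N" "length (r # q # t) = N"
      using m1 m2 *(3,5) by (metis mset_eq_length length_Cons Suc_inject)+
    have "word_moves m (r' # q # t)"
      using Suc.hyps(1)[of m "r' # q # t"] *(1,5) l1 m1 by simp
    then have s1: "word_moves (r # m) (r # r' # q # t)" by (rule word_moves_Cons)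
    have "word_moves (r # q # t) m'"
      using Suc.hyps(1)[of "r # q # t" m'] *(2) len l2 m2 by simp
    then have s2: "word_moves (r' # r # q # t) (r' # m')" by (rule word_moves_Cons)
    have "row_move q r' r q r r'" using q *(4) by (simp add: row_move_def)
    then have "word_move (r # r' # q # t) (r' # r # q # t)"
      unfolding word_move_def by (intro exI[of _ "[]"] exI[of _ t]) auto
    then show ?thesis using s1 s2 by (meson rtranclp.rtrancl_into_rtrancl rtranclp_trans)
  qed
  obtain r m where l: "l = r # m" "length m = N" using Suc.hyps(2) by (cases l) auto
  obtain r' m' where l': "l' = r' # m'" "length m' = N"
    using mset_eq_length[OF Suc.prems(3)] Suc.hyps(2) by (cases l') auto
  consider "r = r'" | "r < r'" | "r' < r" by linarith
  then show ?case
  proof cases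
    case 1
    then have "word_moves m m'" using Suc.hyps(1)[of m m'] Suc.prems l l' by simp
    then show ?thesis using 1 l l' word_moves_Cons by simp
  next
    case 2
    then show ?thesis using swap[of r m r' m'] Suc.prems l l' by simp
  next
    case 3
    then show ?thesis using swap[of r' m' r m] Suc.prems l l' word_moves_sym by simp
  qed
qed

subsection \<open>Moving inside two-sided cells\<close>

text \<open>The reversal puts the row of the largest entry first, so passing to the tail removes
  that entry from the insertion tableau of \<open>w\<close>.\<close>

definition row_word :: "nat \<Rightarrow> (nat \<Rightarrow> nat) \<Rightarrow> nat list" where
  "row_word n w = rev (map (rec_row (inv' w)) [1..<Suc n])"

lemma row_word_nth: "i < n \<Longrightarrow> row_word n w ! i = rec_row (inv' w) (n - i)"
  by (simp add: row_word_def rev_nth Suc_diff_Suc del: upt_Suc)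

lemma length_row_word [simp]: "length (row_word n w) = n"
  by (simp add: row_word_def)

lemma row_word_eq_iff:
  assumes "w \<in> Sym n" "w' \<in> Sym n"
  shows "row_word n w = row_word n w' \<longleftrightarrow> insertion_tableau n w = insertion_tableau n w'"
  using assms insertion_tableau_eq_iff[of w n w']
  by (auto simp: row_word_def Sym_iff less_Suc_eq_le Suc_le_eq simp del: upt_Suc)

lemma count_rev_map:
  "count (mset (rev (map f [1..<Suc n]))) k = card {a \<in> {1..n}. f a = k}"
proof (induction n)
  case (Suc n)
  then show ?case unfolding card_filter_Suc by simp
qed simp

lemma count_row_word:
  assumes "w \<in> Sym n"
  shows "count (mset (row_word n w)) k = row_count (ins_tab w n) k n"
  using row_count_inverse[of w n n k] count_rev_map[of "rec_row (inv' w)" n k] assms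
  by (simp add: row_word_def Sym_iff del: upt_Suc)

text \<open>Suffixes of the word count the restricted shapes of the insertion tableau, so the
  lattice condition is its column strictness.\<close>

lemma lattice_row_word:
  assumes "w \<in> Sym n"
  shows "lattice_word (row_word n w)"
proof -
  have w: "w permutes {1..n}" using assms by (simp add: Sym_iff)
  have "lattice_word (rev (map (rec_row (inv' w)) [1..<Suc m]))" if "m \<le> n" for m
    using that
  proof (induction m)
    case (Suc m)
    have e: "rev (map f [1..<Suc (Suc m)]) = f (Suc m) # rev (map f [1..<Suc m])" for f :: "nat \<Rightarrow> nat"
      by simp
    have "count (mset (rev (map (rec_row (inv' w)) [1..<Suc (Suc m)]))) k =
      row_count (ins_tab w n) k (Suc m)" for k
      using count_rev_map[of "rec_row (inv' w)" "Suc m" k] row_count_inverse[OF w Suc.prems, of k] by simp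
    moreover have "row_count (ins_tab w n) (Suc k) (Suc m) \<le> row_count (ins_tab w n) k (Suc m)" for k
      using ins_tab_tab[OF permutes_inj[OF w], of n] by (simp add: col_strict_def)
    ultimately show ?case using Suc unfolding e by simp
  qed simp
  then show ?thesis by (simp add: row_word_def del: upt_Suc)
qed

lemma same_shape_connected:
  assumes "w \<in> Sym n" "w' \<in> Sym n"
    "shape (insertion_tableau n w) = shape (insertion_tableau n w')"
  shows "word_moves (row_word n w) (row_word n w')"
proof (rule word_moves_connected)
  show "mset (row_word n w) = mset (row_word n w')"
  proof (rule multiset_eqI)
    fix k
    show "count (mset (row_word n w)) k = count (mset (row_word n w')) k"
      unfolding count_row_word[OF assms(1)] count_row_word[OF assms(2)]
      using shape_row_count assms unfolding Sym_iff by blast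
  qed
qed (use assms lattice_row_word in auto)

lemma inverse_connected:
  assumes "w \<in> Sym n"
  shows "word_moves (row_word n w) (row_word n (inv' w))"
proof (rule word_moves_connected)
  show "mset (row_word n w) = mset (row_word n (inv' w))"
  proof (rule multiset_eqI)
    fix k
    have "row_count (ins_tab w n) k n = row_count (ins_tab (inv' w) n) k n"
      using assms row_count_symmetric[of w n n k n] by (simp only: Sym_iff)
    then show "count (mset (row_word n w)) k = count (mset (row_word n (inv' w))) k"
      unfolding count_row_word[OF assms] count_row_word[OF inv_Sym[OF assms]] .
  qed
qed (use assms lattice_row_word inv_Sym in auto)

text \<open>The star operation realising a word move depends only on the word, so that two permutations in
  the same right cell can be moved simultaneously.\<close>

lemma star_realises_word_move:
  assumes "word_move (row_word n w0) l"
  obtains i j where "i \<in> {1..<n}" "j \<in> {1..<n}" "i = Suc j \<or> j = Suc i"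
    "\<And>w. w \<in> Sym n \<Longrightarrow> row_word n w = row_word n w0 \<Longrightarrow>
      ldesc i w \<and> \<not> ldesc j w \<and> row_word n (star i j w) = l \<and>
      insertion_tableau n (inv' (star i j w)) = insertion_tableau n (inv' w)"
proof -
  obtain p q a b c a' b' c' where l0: "row_word n w0 = p @ [c, b, a] @ q"
    and l: "l = p @ [c', b', a'] @ q" and rm: "row_move a b c a' b' c'"
    using assms unfolding word_move_def by blast
  have n: "length p + 3 + length q = n" using arg_cong[OF l0, of length] by simp
  \<comment> \<open>The word is reversed: \<open>q\<close> holds the rows of the entries below
    \<open>k\<close>, and \<open>a\<close>, \<open>b\<close>, \<open>c\<close> are the rows of
    \<open>k\<close>, \<open>k + 1\<close>, \<open>k + 2\<close>.\<close>
  define k where "k = Suc (length q)"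
  define i where "i = (if a < b then k else Suc k)"
  define j where "j = (if a < b then Suc k else k)"
  have k: "1 \<le> k" "k + 2 \<le> n" using n by (auto simp: k_def)
  have lp: "n - k = length p + 2" "n - (k + 1) = length p + 1" "n - (k + 2) = length p"
    using n by (simp_all add: k_def)
  have "ldesc i w \<and> \<not> ldesc j w \<and> row_word n (star i j w) = l \<and>
      insertion_tableau n (inv' (star i j w)) = insertion_tableau n (inv' w)"
    if w: "w \<in> Sym n" and e: "row_word n w = row_word n w0" for w
  proof -
    define u where "u = inv' w"
    define u' where "u' = inv' (star i j w)"
    have nth: "rec_row u m = (p @ [c, b, a] @ q) ! (n - m)" if "1 \<le> m" "m \<le> n" for m
      using row_word_nth[of "n - m" n w] e l0 that by (simp add: u_def)
    have r: "rec_row u k = a" "rec_row u (k + 1) = b" "rec_row u (k + 2) = c"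
      using nth[of k] nth[of "k + 1"] nth[of "k + 2"] k unfolding lp by (simp_all add: nth_append)
    have d: "ldesc k w \<longleftrightarrow> a < b" "ldesc (Suc k) w \<longleftrightarrow> b < c"
      using ldesc_rec_row[of w n k] ldesc_rec_row[of w n "Suc k"] w r k(1)
      by (simp_all add: Sym_iff u_def)
    \<comment> \<open>The inequalities of \<open>row_move\<close> force exactly one of
      \<open>k\<close> and \<open>Suc k\<close> to be a left descent; that one was chosen as
      \<open>i\<close>.\<close>
    have bc: "a < b \<longleftrightarrow> \<not> b < c" using rm by (auto simp: row_move_def)
    have ij: "{i, j} = {k, Suc k}" by (auto simp: i_def j_def)
    have dij: "ldesc i w" "\<not> ldesc j w" using d bc by (auto simp: i_def j_def)
    note S = star_rec_row[OF w k ij dij, folded u_def u'_def]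
    have r': "rec_row u' k = a'" "rec_row u' (k + 1) = b'" "rec_row u' (k + 2) = c'"
      using row_move_det[OF rm] S(3) r by auto
    have "row_word n (star i j w) = l"
    proof (rule nth_equalityI)
      show "length (row_word n (star i j w)) = length l" using n l by simp
      fix x assume "x < length (row_word n (star i j w))"
      then have x: "x < n" by simp
      define m where "m = n - x"
      have m: "1 \<le> m" "m \<le> n" "x = n - m" using x by (auto simp: m_def)
      have L: "row_word n (star i j w) ! x = rec_row u' m"
        using row_word_nth[OF x] by (simp add: u'_def m_def)
      show "row_word n (star i j w) ! x = l ! x"
      proof (cases "m \<in> {k..k + 2}")
        case True
        then consider "m = k" | "m = k + 1" | "m = k + 2" by fastforce
        then show ?thesis
          by cases (use L l r' m(3) lp in \<open>simp_all add: nth_append\<close>)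
      next
        case False
        then have "rec_row u' m = (p @ [c, b, a] @ q) ! x" using S(2) nth[of m] m by simp
        moreover have "x < length p \<or> length p + 3 \<le> x"
          using False m lp(3) k by auto
        ultimately show ?thesis using L l by (auto simp: nth_append nth_Cons' )
      qed
    qed
    then show ?thesis using dij S(1) by (simp add: u_def u'_def)
  qed
  moreover have "i \<in> {1..<n}" "j \<in> {1..<n}" "i = Suc j \<or> j = Suc i"
    using k by (auto simp: i_def j_def)
  ultimately show thesis using that by blast
qed

text \<open>Keeping \<open>Q\<close> abstract separates the combinatorics from the algebra. Each
  word move provides one pair \<open>i\<close>, \<open>j\<close> that serves both permutations,
  because they share a row word.\<close>

lemma star_transport:
  assumes x: "x \<in> Sym n" and y: "y \<in> Sym n" and e: "row_word n x = row_word n y"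
    and conn: "word_moves (row_word n x) l" and Q: "Q x y"
    and step: "\<And>x y i j. \<lbrakk>x \<in> Sym n; y \<in> Sym n; i \<in> {1..<n}; j \<in> {1..<n}; i = Suc j \<or> j = Suc i;
       ldesc i x; \<not> ldesc j x; ldesc i y; \<not> ldesc j y; Q x y\<rbrakk> \<Longrightarrow> Q (star i j x) (star i j y)"
  obtains x' y' where "x' \<in> Sym n" "y' \<in> Sym n" "row_word n x' = l" "row_word n y' = l"
    "insertion_tableau n (inv' x') = insertion_tableau n (inv' x)"
    "insertion_tableau n (inv' y') = insertion_tableau n (inv' y)" "Q x' y'"
proof -
  from conn have "\<exists>x' y'. x' \<in> Sym n \<and> y' \<in> Sym n \<and> row_word n x' = l \<and> row_word n y' = l \<and>
    insertion_tableau n (inv' x') = insertion_tableau n (inv' x) \<and>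
    insertion_tableau n (inv' y') = insertion_tableau n (inv' y) \<and> Q x' y'"
  proof (induction rule: rtranclp_induct)
    case base
    then show ?case using x y e Q by auto
  next
    case (step l1 l2)
    then obtain x' y' where xy: "x' \<in> Sym n" "y' \<in> Sym n" "row_word n x' = l1" "row_word n y' = l1"
      "insertion_tableau n (inv' x') = insertion_tableau n (inv' x)"
      "insertion_tableau n (inv' y') = insertion_tableau n (inv' y)" "Q x' y'" by blast
    have wm: "word_move (row_word n x') l2" using step.hyps(2) xy(3) by simp
    obtain i j where ij: "i \<in> {1..<n}" "j \<in> {1..<n}" "i = Suc j \<or> j = Suc i"
      and w: "\<And>w. w \<in> Sym n \<Longrightarrow> row_word n w = row_word n x' \<Longrightarrow>
        ldesc i w \<and> \<not> ldesc j w \<and> row_word n (star i j w) = l2 \<and>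
        insertion_tableau n (inv' (star i j w)) = insertion_tableau n (inv' w)"
      by (rule star_realises_word_move[OF wm]) (rule that; assumption)
    have wx: "ldesc i x' \<and> \<not> ldesc j x' \<and> row_word n (star i j x') = l2 \<and>
        insertion_tableau n (inv' (star i j x')) = insertion_tableau n (inv' x')"
      by (rule w[OF xy(1) refl])
    have wy: "ldesc i y' \<and> \<not> ldesc j y' \<and> row_word n (star i j y') = l2 \<and>
        insertion_tableau n (inv' (star i j y')) = insertion_tableau n (inv' y')"
      by (rule w[OF xy(2)]) (simp add: xy)
    have "Q (star i j x') (star i j y')"
      by (rule assms(6)[OF xy(1,2) ij]) (use wx wy xy(7) in simp_all)
    then show ?case
      using wx wy xy(5,6) star_Sym[OF xy(1) ij(1,2)] star_Sym[OF xy(2) ij(1,2)] by metis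
  qed
  then show thesis using that by blast
qed

section \<open>Laurent polynomials\<close>

abbreviation (input) lookup :: "('a \<Rightarrow>\<^sub>0 'b :: zero) \<Rightarrow> 'a \<Rightarrow> 'b" where
  "lookup \<equiv> Poly_Mapping.lookup"

lemma lookup_vpow_mult [simp]: "lookup (vpow k * p) m = lookup p (m - k)"
proof -
  have "lookup (vpow k) l * x = (x when l = k)" for l and x :: int
    by (auto simp: vpow_def lookup_single when_def)
  then have "lookup (vpow k * p) m =
      Sum_any (\<lambda>q. lookup p q when m = k + q)"
    by (simp add: lookup_mult)
  also have "(\<lambda>q. lookup p q when m = k + q) =
      (\<lambda>q. lookup p q when q = m - k)"
    by (rule ext) (auto simp: when_def)
  finally show ?thesis by simp
qed

lemma lookup_vpow: "lookup (vpow k) m = (if m = k then 1 else 0)"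
  by (auto simp: vpow_def lookup_single when_def)

lemma vpow_0 [simp]: "vpow 0 = 1"
  by (simp add: vpow_def)

lemma vpow_mult: "vpow a * vpow b = vpow (a + b)"
  by (simp add: vpow_def mult_single)

lemma lookup_laurent_bar [simp]:
  "lookup (laurent_bar p) k = lookup p (- k)"
  by (simp add: laurent_bar_def map_key.rep_eq)

lemma laurent_bar_add [simp]: "laurent_bar (p + q) = laurent_bar p + laurent_bar q"
  and laurent_bar_diff [simp]: "laurent_bar (p - q) = laurent_bar p - laurent_bar q"
  and laurent_bar_0 [simp]: "laurent_bar 0 = 0"
  by (rule poly_mapping_eqI; simp add: lookup_add lookup_minus)+

lemma laurent_bar_sum: "laurent_bar (sum f A) = (\<Sum>a\<in>A. laurent_bar (f a))"
  by (induction A rule: infinite_finite_induct) auto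

lemma laurent_bar_single [simp]:
  "laurent_bar (Poly_Mapping.single k c) = Poly_Mapping.single (- k) c"
  by (rule poly_mapping_eqI) (auto simp: lookup_single when_def)

lemma laurent_bar_vpow [simp]: "laurent_bar (vpow k) = vpow (- k)"
  by (simp add: vpow_def)

lemma laurent_bar_1 [simp]: "laurent_bar 1 = 1"
  using laurent_bar_vpow[of 0] by simp

lemma poly_mapping_sum_single:
  "p = (\<Sum>k\<in>Poly_Mapping.keys p. Poly_Mapping.single k (lookup p k))"
  by (rule poly_mapping_eqI)
    (auto simp: lookup_sum lookup_single when_def sum.delta in_keys_iff)

lemma laurent_bar_mult [simp]: "laurent_bar (p * q) = laurent_bar p * laurent_bar q"
proof -
  have "laurent_bar (p * q) = (\<Sum>k\<in>Poly_Mapping.keys p. \<Sum>l\<in>Poly_Mapping.keys q.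
     Poly_Mapping.single (- k) (lookup p k) * Poly_Mapping.single (- l) (lookup q l))"
    by (subst poly_mapping_sum_single[of p], subst poly_mapping_sum_single[of q])
      (simp add: sum_product laurent_bar_sum mult_single)
  also have "\<dots> = laurent_bar p * laurent_bar q"
    by (subst poly_mapping_sum_single[of p], subst poly_mapping_sum_single[of q])
      (simp add: sum_product laurent_bar_sum)
  finally show ?thesis .
qed

lemma vZv_iff: "p \<in> vZv \<longleftrightarrow> (\<forall>k\<le>0. lookup p k = 0)"
  by (auto simp: vZv_def in_keys_iff subset_iff) (meson not_le)

lemma vZv_bar_0: "p \<in> vZv \<Longrightarrow> laurent_bar p = p \<Longrightarrow> p = 0"
proof (rule poly_mapping_eqI)
  fix k assume p: "p \<in> vZv" "laurent_bar p = p"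
  have "lookup p k = lookup p (- k)"
    using arg_cong[OF p(2), of "\<lambda>p. lookup p k"] by simp
  then show "lookup p k = lookup 0 k"
    using p(1) by (cases "k \<le> 0") (auto simp: vZv_iff)
qed

lemma vZv_0 [simp]: "0 \<in> vZv"
  and vZv_add: "p \<in> vZv \<Longrightarrow> q \<in> vZv \<Longrightarrow> p + q \<in> vZv"
  and vZv_diff: "p \<in> vZv \<Longrightarrow> q \<in> vZv \<Longrightarrow> p - q \<in> vZv"
  by (simp_all add: vZv_iff lookup_add lookup_minus)

lemma vZv_sum: "(\<And>a. a \<in> A \<Longrightarrow> f a \<in> vZv) \<Longrightarrow> sum f A \<in> vZv"
  by (simp add: vZv_iff lookup_sum)

lemma vZv_vpow_mult: "p \<in> vZv \<Longrightarrow> vpow 1 * p \<in> vZv"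
  by (simp add: vZv_iff)

lemma vpow_1_vZv [simp]: "vpow 1 \<in> vZv"
  by (simp add: vZv_iff lookup_vpow)

text \<open>On coefficients of the Kazhdan-Lusztig basis this is the mu-coefficient, kept as a
  constant Laurent polynomial so that it acts as a bar-invariant scalar.\<close>

definition coef1 :: "laurent \<Rightarrow> laurent" where
  "coef1 p = Poly_Mapping.single 0 (lookup p 1)"

lemma lookup_coef1_mult [simp]:
  "lookup (coef1 p * q) k = lookup p 1 * lookup q k"
proof -
  have "coef1 p * q = Poly_Mapping.map ((*) (lookup p 1)) q"
    by (simp add: coef1_def mult_map_scale_conv_mult)
  then show ?thesis by (simp add: map.rep_eq when_def)
qed

lemma bar_coef1 [simp]: "laurent_bar (coef1 p) = coef1 p"
  by (simp add: coef1_def)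

lemma vZv_coef1_mult: "q \<in> vZv \<Longrightarrow> coef1 p * q \<in> vZv"
  by (simp add: vZv_iff)

lemma vZv_shift: "p \<in> vZv \<Longrightarrow> vpow (- 1) * p - coef1 p \<in> vZv"
  by (auto simp: vZv_iff lookup_minus coef1_def lookup_single when_def)

abbreviation vv :: laurent where "vv \<equiv> vpow 1 + vpow (- 1)"

lemma vv_nonzero: "vv \<noteq> 0"
proof
  assume "vv = 0"
  then have "lookup vv 1 = 0" by simp
  then show False by (simp add: lookup_add lookup_vpow)
qed

section \<open>The length function\<close>

definition inversions :: "(nat \<Rightarrow> nat) \<Rightarrow> (nat \<times> nat) set" where
  "inversions u = {(a, b). a < b \<and> u b < u a}"

text \<open>Inversions of the inverse are counted because left multiplication of \<open>w\<close>
  acts on positions of the inverse word.\<close>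

definition ell :: "(nat \<Rightarrow> nat) \<Rightarrow> nat" where
  "ell w = card (inversions (inv' w))"

lemma inversions_subset:
  assumes "u permutes {1..n}"
  shows "inversions u \<subseteq> {1..n} \<times> {1..n}"
proof -
  have in_iff: "u x \<in> {1..n} \<longleftrightarrow> x \<in> {1..n}" for x using permutes_in_image[OF assms] .
  have out: "u x = x" if "x \<notin> {1..n}" for x using assms that by (simp add: permutes_def)
  have "a \<in> {1..n} \<and> b \<in> {1..n}" if "a < b" "u b < u a" for a b
    using that in_iff[of a] in_iff[of b] out[of a] out[of b] by (cases "a \<in> {1..n}"; cases "b \<in> {1..n}") auto
  then show ?thesis by (auto simp: inversions_def)
qed

text \<open>Applying \<open>srefl i\<close> to positions preserves the order of every pair except
  (\<open>i\<close>, \<open>Suc i\<close>). The resulting inclusion, used also for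
  \<open>u \<circ> srefl i\<close>, gives equality since \<open>srefl i\<close> is an
  involution.\<close>

lemma inversions_comp:
  fixes u :: "nat \<Rightarrow> nat"
  shows "inversions (u \<circ> srefl i) - {(i, Suc i)} =
    (\<lambda>(a, b). (srefl i a, srefl i b)) ` (inversions u - {(i, Suc i)})"
proof -
  have s: "srefl i (srefl i a) = a" for a by (simp add: srefl_def)
  have lt: "srefl i a < srefl i b" if "a < b" "(a, b) \<noteq> (i, Suc i)" for a b
    using that by (auto simp: srefl_def transpose_def)
  have ne: "(srefl i a, srefl i b) \<noteq> (i, Suc i)" if "a < b" for a b
    using that by (auto simp: srefl_def transpose_def split: if_splits)
  have sub: "(\<lambda>(a, b). (srefl i a, srefl i b)) ` (inversions u - {(i, Suc i)})
      \<subseteq> inversions (u \<circ> srefl i) - {(i, Suc i)}" for u :: "nat \<Rightarrow> nat"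
    using lt ne by (auto simp: inversions_def s)
  have "p \<in> (\<lambda>(a, b). (srefl i a, srefl i b)) ` (inversions u - {(i, Suc i)})"
    if "p \<in> inversions (u \<circ> srefl i) - {(i, Suc i)}" for p
  proof -
    obtain a b where p: "p = (a, b)" by fastforce
    have "(srefl i a, srefl i b) \<in> inversions (u \<circ> srefl i \<circ> srefl i) - {(i, Suc i)}"
      using sub[of "u \<circ> srefl i"] that p by auto
    then have "(srefl i a, srefl i b) \<in> inversions u - {(i, Suc i)}" by (simp add: comp_assoc)
    then show ?thesis using p by (intro image_eqI[of _ _ "(srefl i a, srefl i b)"]) (simp_all add: s)
  qed
  with sub[of u] show ?thesis by blast
qed

lemma ell_lmul_cases:
  assumes w: "w \<in> Sym n"
  shows "\<not> ldesc i w \<Longrightarrow> ell (lmul i w) = Suc (ell w)"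
    and "ldesc i w \<Longrightarrow> ell w = Suc (ell (lmul i w))"
proof -
  define u where "u = inv' w"
  have u: "u permutes {1..n}" using w by (simp add: u_def Sym_iff permutes_inv)
  have fin: "finite (inversions u)" using inversions_subset[OF u] finite_subset by blast
  have inj: "inj_on (\<lambda>(a, b). (srefl i a, srefl i b)) A" for A
    unfolding srefl_def by (auto simp: inj_on_def transpose_eq_iff)
  have c: "card (inversions (u \<circ> srefl i) - {(i, Suc i)}) = card (inversions u - {(i, Suc i)})"
    using inversions_comp[of u i] card_image[OF inj] by simp
  have fin': "finite (inversions (u \<circ> srefl i))"
    using inversions_comp[of u i] fin by (metis finite_Diff finite_Diff2 finite.emptyI finite_imageI finite_insert)
  have mem: "(i, Suc i) \<in> inversions u \<longleftrightarrow> ldesc i w"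
    by (simp add: inversions_def ldesc_def u_def)
  have "u i \<noteq> u (Suc i)" using permutes_inj[OF u] by (simp add: inj_eq)
  then have mem': "(i, Suc i) \<in> inversions (u \<circ> srefl i) \<longleftrightarrow> \<not> ldesc i w"
    by (auto simp: inversions_def ldesc_def u_def srefl_def)
  have e: "ell w = card (inversions u)" "ell (lmul i w) = card (inversions (u \<circ> srefl i))"
    using inv_lmul[OF w] by (simp_all add: ell_def u_def rmul_def)
  show "ell (lmul i w) = Suc (ell w)" if "\<not> ldesc i w"
    using card.remove[OF fin', of "(i, Suc i)"] that mem mem' c e by simp
  show "ell w = Suc (ell (lmul i w))" if "ldesc i w"
    using card.remove[OF fin, of "(i, Suc i)"] that mem mem' c e by simp
qed

lemmas ell_lmul = ell_lmul_cases(1) and ell_lmul_desc = ell_lmul_cases(2)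

lemma ell_lmul_le: "w \<in> Sym n \<Longrightarrow> ell (lmul i w) \<le> Suc (ell w)"
  and ell_le_lmul: "w \<in> Sym n \<Longrightarrow> ell w \<le> Suc (ell (lmul i w))"
  using ell_lmul_cases[of w n i] by linarith+

text \<open>Without descents the inverse word increases, so the inverse lies above the identity
  pointwise and must equal it.\<close>

lemma exists_ldesc:
  assumes w: "w \<in> Sym n" and "w \<noteq> id"
  shows "\<exists>i\<in>{1..<n}. ldesc i w"
proof (rule ccontr)
  assume *: "\<not> (\<exists>i\<in>{1..<n}. ldesc i w)"
  define u where "u = inv' w"
  have u: "u permutes {1..n}" using w by (simp add: u_def Sym_iff permutes_inv)
  have inc: "u i < u (Suc i)" if "i \<in> {1..<n}" for i
  proof -
    have "u i \<noteq> u (Suc i)" using permutes_inj[OF u] by (simp add: inj_eq)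
    moreover have "\<not> ldesc i w" using * that by blast
    ultimately show ?thesis by (simp add: ldesc_def u_def)
  qed
  have "i \<le> u i" if "i \<in> {1..n}" for i
    using that
  proof (induction i)
    case (Suc i)
    show ?case
    proof (cases "i = 0")
      case True
      then show ?thesis using permutes_in_image[OF u, of "Suc i"] Suc.prems by auto
    next
      case False
      then show ?thesis using Suc inc[of i] by auto
    qed
  qed simp
  then have "u = id" using permutes_natset_ge[OF u] by auto
  then have "w = id" using w unfolding u_def Sym_iff by (metis permutes_inv_inv inv_id)
  then show False using assms(2) by simp
qed

lemma id_Sym [simp]: "id \<in> Sym n"
  by (simp add: Sym_iff permutes_id)

lemma ldesc_id [simp]: "\<not> ldesc i id"
  by (simp add: ldesc_def)

lemma ell_id [simp]: "ell id = 0"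
proof -
  have "inversions id = {}" by (auto simp: inversions_def)
  then show ?thesis by (simp add: ell_def del: id_apply)
qed

lemma Sym_induct [consumes 1, case_names id lmul]:
  assumes "w \<in> Sym n" "P id"
    and "\<And>i w. i \<in> {1..<n} \<Longrightarrow> w \<in> Sym n \<Longrightarrow> \<not> ldesc i w \<Longrightarrow> P w \<Longrightarrow> P (lmul i w)"
  shows "P w"
  using assms(1)
proof (induction "ell w" arbitrary: w rule: less_induct)
  case less
  show ?case
  proof (cases "w = id")
    case False
    then obtain i where i: "i \<in> {1..<n}" "ldesc i w" using exists_ldesc less.prems by blast
    have u: "lmul i w \<in> Sym n" using lmul_Sym[OF less.prems i(1)] .
    have "P (lmul i w)" by (rule less.hyps) (use u ell_lmul_desc[OF less.prems i(2)] in auto)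
    then have "P (lmul i (lmul i w))" using assms(3)[OF i(1) u] ldesc_lmul[OF less.prems] i(2) by blast
    then show ?thesis by simp
  qed (use assms in simp)
qed

section \<open>Words in simple transpositions: the length is the number of inversions\<close>

lemma simple_transpositions_srefl: "simple_transpositions n = srefl ` {1..<n}"
  unfolding simple_transpositions_def srefl_def by auto

lemma foldr_comp_simps:
  "foldr (\<circ>) [] id = id"
  "foldr (\<circ>) (s # ss) id = s \<circ> foldr (\<circ>) ss id"
  by (simp_all add: fun_eq_iff)

lemma foldr_Sym: "set ss \<subseteq> simple_transpositions n \<Longrightarrow> foldr (\<circ>) ss id \<in> Sym n"
proof (induction ss)
  case (Cons s ss)
  have "s \<in> Sym n" using srefl_Sym Cons.prems by (auto simp: simple_transpositions_srefl)
  moreover have "foldr (\<circ>) ss id \<in> Sym n" by (rule Cons.IH) (use Cons.prems in simp)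
  ultimately show ?case unfolding foldr_comp_simps by (rule comp_Sym)
qed (simp only: foldr_comp_simps id_Sym)

lemma ell_foldr: "set ss \<subseteq> simple_transpositions n \<Longrightarrow> ell (foldr (\<circ>) ss id) \<le> length ss"
proof (induction ss)
  case (Cons s ss)
  then obtain i where i: "s = srefl i" by (auto simp: simple_transpositions_srefl)
  have F: "foldr (\<circ>) ss id \<in> Sym n" by (rule foldr_Sym) (use Cons.prems in simp)
  have "ell (foldr (\<circ>) ss id) \<le> length ss" by (rule Cons.IH) (use Cons.prems in simp)
  then show ?case unfolding foldr_comp_simps i list.size lmul_def[symmetric]
    using ell_lmul_le[OF F, of i] by linarith
qed (simp only: foldr_comp_simps ell_id)

lemma reduced_word:
  assumes "w \<in> Sym n"
  shows "\<exists>ss. length ss = ell w \<and> set ss \<subseteq> simple_transpositions n \<and> w = foldr (\<circ>) ss id"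
  using assms
proof (induction rule: Sym_induct)
  case id
  show ?case by (intro exI[of _ "[]"]) (simp only: foldr_comp_simps ell_id, simp)
next
  case (lmul i w)
  then obtain ss where ss: "length ss = ell w" "set ss \<subseteq> simple_transpositions n" "w = foldr (\<circ>) ss id"
    by blast
  have "srefl i \<in> simple_transpositions n" using lmul(1) by (simp add: simple_transpositions_srefl)
  moreover have "ell (lmul i w) = Suc (length ss)" using ell_lmul[OF lmul(2,3)] ss(1) by simp
  moreover have "lmul i w = foldr (\<circ>) (srefl i # ss) id"
    unfolding foldr_comp_simps ss(3)[symmetric] lmul_def ..
  ultimately show ?case using ss(2) by (metis insert_subset length_Cons list.set(2))
qed

lemma len_ell:
  assumes "w \<in> Sym n"
  shows "len n w = ell w"
  unfolding len_def
proof (rule Least_equality)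
  show "\<exists>ss. length ss = ell w \<and> set ss \<subseteq> simple_transpositions n \<and> w = foldr (\<circ>) ss id"
    by (rule reduced_word[OF assms])
next
  fix k assume "\<exists>ss. length ss = k \<and> set ss \<subseteq> simple_transpositions n \<and> w = foldr (\<circ>) ss id"
  then show "ell w \<le> k" using ell_foldr by blast
qed

lemma ell_comp_le:
  assumes "x \<in> Sym n" "y \<in> Sym n"
  shows "ell (x \<circ> y) \<le> ell x + ell y"
  using assms(1)
proof (induction rule: Sym_induct)
  case (lmul i w)
  have "w \<circ> y \<in> Sym n" using comp_Sym lmul assms by blast
  then have "ell (lmul i (w \<circ> y)) \<le> Suc (ell (w \<circ> y))" by (rule ell_lmul_le)
  then show ?case using lmul(4) ell_lmul[OF lmul(2,3)] unfolding lmul_def comp_assoc by linarith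
qed (simp only: ell_id id_comp)

lemma inversions_inverse:
  assumes "w permutes S"
  shows "bij_betw (\<lambda>(a, b). (inv' w b, inv' w a)) (inversions (inv' w)) (inversions w)"
  using permutes_inverses[OF assms]
  by (intro bij_betw_byWitness[where f' = "\<lambda>(a, b). (w b, w a)"]) (auto simp: inversions_def)

lemma ell_inv:
  assumes "w \<in> Sym n"
  shows "ell (inv' w) = ell w"
  using bij_betw_same_card[OF inversions_inverse, of w "{1..n}"] assms
  by (simp add: ell_def Sym_iff permutes_inv_inv)

lemma inv_inv_Sym: "w \<in> Sym n \<Longrightarrow> inv' (inv' w) = w"
  by (simp add: Sym_iff permutes_inv_inv)

lemma finite_Sym [simp]: "finite (Sym n)"
proof -
  have "Sym n = {p. p permutes {1..n}}" by (auto simp: Sym_iff)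
  then show ?thesis by (simp add: finite_permutations)
qed

lemma exists_longest:
  assumes "S \<noteq> {}" "finite S"
  shows "\<exists>x\<in>S. \<forall>y\<in>S. ell y \<le> ell x"
  using finite_has_maximal[of "ell ` S"] assms
  by (metis (no_types, lifting) finite_imageI image_iff image_is_empty nle_le)

section \<open>The free module\<close>

lemma lookup_hscale [simp]:
  "lookup (hscale c h) w = c * lookup h w"
  by (simp add: hscale_def map.rep_eq when_def)

lemma lookup_H: "lookup (H w) x = (if x = w then 1 else 0)"
  by (auto simp: H_def lookup_single when_def)

interpretation hs: module hscale
  by unfold_locales (rule poly_mapping_eqI; simp add: lookup_add algebra_simps)+

lemma hecke_carrier_iff: "h \<in> hecke_carrier n \<longleftrightarrow> (\<forall>w. w \<notin> Sym n \<longrightarrow> lookup h w = 0)"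
  by (auto simp: hecke_carrier_def in_keys_iff)

lemma hecke_carrier_0 [simp]: "0 \<in> hecke_carrier n"
  and hecke_carrier_add [simp]:
    "a \<in> hecke_carrier n \<Longrightarrow> b \<in> hecke_carrier n \<Longrightarrow> a + b \<in> hecke_carrier n"
  and hecke_carrier_uminus [simp]: "a \<in> hecke_carrier n \<Longrightarrow> - a \<in> hecke_carrier n"
  and hecke_carrier_diff [simp]:
    "a \<in> hecke_carrier n \<Longrightarrow> b \<in> hecke_carrier n \<Longrightarrow> a - b \<in> hecke_carrier n"
  and hecke_carrier_hscale [simp]: "a \<in> hecke_carrier n \<Longrightarrow> hscale c a \<in> hecke_carrier n"
  by (simp_all add: hecke_carrier_iff lookup_add lookup_minus)

lemma hecke_carrier_sum: "(\<And>a. a \<in> A \<Longrightarrow> f a \<in> hecke_carrier n) \<Longrightarrow> sum f A \<in> hecke_carrier n"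
  by (simp add: hecke_carrier_iff lookup_sum)

lemma hecke_carrier_H [simp]: "w \<in> Sym n \<Longrightarrow> H w \<in> hecke_carrier n"
  by (auto simp: hecke_carrier_iff lookup_H)

lemma hecke_expand:
  assumes "h \<in> hecke_carrier n"
  shows "h = (\<Sum>w\<in>Sym n. hscale (lookup h w) (H w))"
proof (rule poly_mapping_eqI)
  fix x
  show "lookup h x = lookup (\<Sum>w\<in>Sym n. hscale (lookup h w) (H w)) x"
    using assms by (auto simp: lookup_sum lookup_H hecke_carrier_iff if_distrib sum.delta cong: if_cong)
qed

definition hlinear :: "nat \<Rightarrow> (hecke \<Rightarrow> hecke) \<Rightarrow> bool" where
  "hlinear n F \<longleftrightarrow>
     (\<forall>a\<in>hecke_carrier n. \<forall>b\<in>hecke_carrier n. F (a + b) = F a + F b) \<and>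
     (\<forall>c. \<forall>a\<in>hecke_carrier n. F (hscale c a) = hscale c (F a))"

lemma hlinear_0: "hlinear n F \<Longrightarrow> F 0 = 0"
  unfolding hlinear_def by (metis hecke_carrier_0 hs.scale_zero_left)

lemma hlinear_sum:
  assumes "hlinear n F" "\<And>a. a \<in> A \<Longrightarrow> f a \<in> hecke_carrier n"
  shows "F (sum f A) = (\<Sum>a\<in>A. F (f a))"
  using assms(2)
proof (induction A rule: infinite_finite_induct)
  case (insert a A)
  then have "sum f A \<in> hecke_carrier n" by (intro hecke_carrier_sum) auto
  then show ?case using insert assms(1) by (simp add: hlinear_def)
qed (simp_all add: hlinear_0[OF assms(1)])

lemma hlinear_diff:
  assumes "hlinear n F" "a \<in> hecke_carrier n" "b \<in> hecke_carrier n"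
  shows "F (a - b) = F a - F b"
proof -
  have "F (a - b) + F b = F (a - b + b)" using assms unfolding hlinear_def by (metis hecke_carrier_diff)
  then show ?thesis by (simp add: eq_diff_eq)
qed

lemma hlinear_expand:
  assumes "hlinear n F" "h \<in> hecke_carrier n"
  shows "F h = (\<Sum>w\<in>Sym n. hscale (lookup h w) (F (H w)))"
proof -
  have "F h = F (\<Sum>w\<in>Sym n. hscale (lookup h w) (H w))"
    using hecke_expand[OF assms(2)] by simp
  also have "\<dots> = (\<Sum>w\<in>Sym n. F (hscale (lookup h w) (H w)))"
    by (rule hlinear_sum[OF assms(1)]) simp
  also have "\<dots> = (\<Sum>w\<in>Sym n. hscale (lookup h w) (F (H w)))"
    using assms(1) by (simp add: hlinear_def)
  finally show ?thesis .
qed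

lemma hlinear_eqI:
  assumes "hlinear n F" "hlinear n G" "\<And>w. w \<in> Sym n \<Longrightarrow> F (H w) = G (H w)" "h \<in> hecke_carrier n"
  shows "F h = G h"
  using hlinear_expand[OF assms(1,4)] hlinear_expand[OF assms(2,4)] assms(3) by simp

definition lin_ext :: "nat \<Rightarrow> ((nat \<Rightarrow> nat) \<Rightarrow> hecke) \<Rightarrow> hecke \<Rightarrow> hecke" where
  "lin_ext n f h = (\<Sum>w\<in>Sym n. hscale (lookup h w) (f w))"

lemma lin_ext_add: "lin_ext n f (a + b) = lin_ext n f a + lin_ext n f b"
  by (simp add: lin_ext_def lookup_add hs.scale_left_distrib sum.distrib)

lemma lin_ext_hscale: "lin_ext n f (hscale c a) = hscale c (lin_ext n f a)"
  by (simp add: lin_ext_def hs.scale_sum_right)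

lemma hlinear_lin_ext: "hlinear n (lin_ext n f)"
  by (simp add: hlinear_def lin_ext_add lin_ext_hscale)

lemma lin_ext_H [simp]: "w \<in> Sym n \<Longrightarrow> lin_ext n f (H w) = f w"
  by (simp add: lin_ext_def lookup_H if_distrib[of "\<lambda>c. hscale c _"] cong: if_cong)

lemma lin_ext_carrier:
  "(\<And>w. w \<in> Sym n \<Longrightarrow> f w \<in> hecke_carrier n) \<Longrightarrow> lin_ext n f h \<in> hecke_carrier n"
  unfolding lin_ext_def by (intro hecke_carrier_sum) simp

section \<open>Existence of the Hecke multiplication\<close>

abbreviation qq :: laurent where "qq \<equiv> vpow (- 1) - vpow 1"

definition rdesc :: "nat \<Rightarrow> (nat \<Rightarrow> nat) \<Rightarrow> bool" where
  "rdesc j w \<longleftrightarrow> w (Suc j) < w j"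

text \<open>The forced action of \<open>H (srefl i)\<close>: an ascent is the length relation; at a
  descent \<open>H w\<close> has the left factor \<open>H (srefl i)\<close>, and the quadratic
  relation adds the second term.\<close>

definition left_op :: "nat \<Rightarrow> nat \<Rightarrow> hecke \<Rightarrow> hecke" where
  "left_op n i = lin_ext n (\<lambda>w. H (lmul i w) + (if ldesc i w then hscale qq (H w) else 0))"

definition right_op :: "nat \<Rightarrow> nat \<Rightarrow> hecke \<Rightarrow> hecke" where
  "right_op n j = lin_ext n (\<lambda>w. H (rmul j w) + (if rdesc j w then hscale qq (H w) else 0))"

text \<open>Right multiplication by \<open>srefl j\<close> can reverse the comparison of the
  positions of \<open>i\<close> and \<open>Suc i\<close> only if these positions are
  \<open>j\<close> and \<open>Suc j\<close>; then both products coincide. This dichotomy makes left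
  and right operators commute.\<close>

lemma left_right_descents:
  assumes "w \<in> Sym n"
  shows "(ldesc i (rmul j w) \<longleftrightarrow> ldesc i w) \<and> (rdesc j (lmul i w) \<longleftrightarrow> rdesc j w) \<or>
    lmul i w = rmul j w \<and> (ldesc i w \<longleftrightarrow> rdesc j w)"
proof -
  define u where "u = inv' w"
  have wu: "w a = b \<longleftrightarrow> u b = a" for a b
    using assms by (auto simp: u_def Sym_iff permutes_inverses)
  have uw [simp]: "u (w a) = a" "w (u a) = a" for a using wu by auto
  have iu: "u a = u b \<longleftrightarrow> a = b" for a b by (metis uw(2))
  have iw: "w a = w b \<longleftrightarrow> a = b" for a b by (metis uw(1))
  have "inv' (rmul j w) = srefl j \<circ> u"
    using assms unfolding rmul_def u_def
    by (simp add: Sym_iff permutes_bij o_inv_distrib srefl_def)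
  then have l: "ldesc i (rmul j w) \<longleftrightarrow> srefl j (u (Suc i)) < srefl j (u i)"
    by (simp add: ldesc_def)
  have r: "rdesc j (lmul i w) \<longleftrightarrow> srefl i (w (Suc j)) < srefl i (w j)"
    by (simp add: rdesc_def lmul_def)
  have lt: "srefl k a < srefl k b \<longleftrightarrow> a < b" if "{a, b} \<noteq> {k, Suc k}" "a \<noteq> b" for a b k
    using that by (auto simp: srefl_def transpose_def)
  show ?thesis
  proof (cases "{u (Suc i), u i} = {j, Suc j}")
    case True
    then have c: "u i = j \<and> u (Suc i) = Suc j \<and> w j = i \<and> w (Suc j) = Suc i \<or>
        u i = Suc j \<and> u (Suc i) = j \<and> w j = Suc i \<and> w (Suc j) = i"
      using wu by (auto simp: doubleton_eq_iff)
    then have w: "w j = i \<and> w (Suc j) = Suc i \<or> w j = Suc i \<and> w (Suc j) = i"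
      by blast
    from c have d: "ldesc i w \<longleftrightarrow> rdesc j w"
      unfolding ldesc_def rdesc_def u_def[symmetric] by (elim disjE conjE) simp_all
    have "lmul i w a = rmul j w a" for a
    proof (cases "a = j \<or> a = Suc j")
      case True
      then show ?thesis using w by (auto simp: lmul_def rmul_def srefl_def)
    next
      case False
      then have "w a \<noteq> i" "w a \<noteq> Suc i" using w iw by metis+
      then show ?thesis using False by (simp add: lmul_def rmul_def srefl_def transpose_def)
    qed
    then show ?thesis using d by blast
  next
    case False
    then have F: "{w (Suc j), w j} \<noteq> {i, Suc i}"
      using wu by (auto simp: doubleton_eq_iff)
    have "u (Suc i) \<noteq> u i" "w (Suc j) \<noteq> w j" using iu iw by auto
    then show ?thesis
      using lt[OF False] lt[OF F] l r by (simp add: ldesc_def rdesc_def u_def)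
  qed
qed

lemma left_op_carrier: "i \<in> {1..<n} \<Longrightarrow> left_op n i h \<in> hecke_carrier n"
  unfolding left_op_def by (intro lin_ext_carrier) (simp add: lmul_Sym del: atLeastLessThan_iff)

lemma right_op_carrier: "j \<in> {1..<n} \<Longrightarrow> right_op n j h \<in> hecke_carrier n"
  unfolding right_op_def by (intro lin_ext_carrier) (simp add: rmul_Sym del: atLeastLessThan_iff)

lemma left_op_H:
  "w \<in> Sym n \<Longrightarrow> left_op n i (H w) = H (lmul i w) + (if ldesc i w then hscale qq (H w) else 0)"
  by (simp add: left_op_def)

lemma right_op_H:
  "w \<in> Sym n \<Longrightarrow> right_op n j (H w) = H (rmul j w) + (if rdesc j w then hscale qq (H w) else 0)"
  by (simp add: right_op_def)

lemma hlinear_left_op: "hlinear n (left_op n i)"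
  by (simp add: left_op_def hlinear_lin_ext)

lemma hlinear_right_op: "hlinear n (right_op n i)"
  by (simp add: right_op_def hlinear_lin_ext)

lemma hlinear_comp:
  "hlinear n F \<Longrightarrow> hlinear n G \<Longrightarrow> (\<And>h. h \<in> hecke_carrier n \<Longrightarrow> G h \<in> hecke_carrier n) \<Longrightarrow>
   hlinear n (\<lambda>h. F (G h))"
  by (simp add: hlinear_def)

lemma left_op_add: "left_op n i (a + b) = left_op n i a + left_op n i b"
  and left_op_hscale: "left_op n i (hscale c a) = hscale c (left_op n i a)"
  by (simp_all add: left_op_def lin_ext_add lin_ext_hscale)

lemma right_op_add: "right_op n i (a + b) = right_op n i a + right_op n i b"
  and right_op_hscale: "right_op n i (hscale c a) = hscale c (right_op n i a)"
  by (simp_all add: right_op_def lin_ext_add lin_ext_hscale)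

lemma left_right_op:
  assumes i: "i \<in> {1..<n}" and j: "j \<in> {1..<n}" and h: "h \<in> hecke_carrier n"
  shows "left_op n i (right_op n j h) = right_op n j (left_op n i h)"
proof (rule hlinear_eqI[OF _ _ _ h])
  show "hlinear n (\<lambda>h. left_op n i (right_op n j h))"
    using hlinear_comp[OF hlinear_left_op hlinear_right_op] right_op_carrier[OF j] by blast
  show "hlinear n (\<lambda>h. right_op n j (left_op n i h))"
    using hlinear_comp[OF hlinear_right_op hlinear_left_op] left_op_carrier[OF i] by blast
next
  fix w assume w: "w \<in> Sym n"
  have z: "left_op n i 0 = 0" "right_op n j 0 = 0" using hlinear_0 hlinear_left_op hlinear_right_op by blast+
  have L: "left_op n i (right_op n j (H w)) =
      H (lmul i (rmul j w)) + (if ldesc i (rmul j w) then hscale qq (H (rmul j w)) else 0) +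
      (if rdesc j w then hscale qq (H (lmul i w) + (if ldesc i w then hscale qq (H w) else 0)) else 0)"
    using w rmul_Sym[OF w j]
    by (simp add: right_op_H left_op_H left_op_add left_op_hscale z if_distrib[of "left_op n i"] cong: if_cong)
  have R: "right_op n j (left_op n i (H w)) =
      H (lmul i (rmul j w)) + (if rdesc j (lmul i w) then hscale qq (H (lmul i w)) else 0) +
      (if ldesc i w then hscale qq (H (rmul j w) + (if rdesc j w then hscale qq (H w) else 0)) else 0)"
    using w lmul_Sym[OF w i]
    by (simp add: right_op_H left_op_H right_op_add right_op_hscale z rmul_lmul if_distrib[of "right_op n j"] cong: if_cong)
  from left_right_descents[OF w, of i j] show "left_op n i (right_op n j (H w)) = right_op n j (left_op n i (H w))"
  proof
    assume "(ldesc i (rmul j w) \<longleftrightarrow> ldesc i w) \<and> (rdesc j (lmul i w) \<longleftrightarrow> rdesc j w)"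
    then show ?thesis unfolding L R by (auto simp: algebra_simps hs.scale_right_distrib)
  next
    assume a: "lmul i w = rmul j w \<and> (ldesc i w \<longleftrightarrow> rdesc j w)"
    have "ldesc i (rmul j w) \<longleftrightarrow> \<not> ldesc i w" using a ldesc_lmul[OF w, of i] by simp
    moreover have "rdesc j (lmul i w) \<longleftrightarrow> \<not> rdesc j w"
    proof -
      have "w (Suc j) \<noteq> w j" using w permutes_inj unfolding Sym_iff by (metis injD n_not_Suc_n)
      then show ?thesis using a by (auto simp: rdesc_def rmul_def srefl_def)
    qed
    ultimately show ?thesis unfolding L R using a by auto
  qed
qed

text \<open>Left multiplications are the linear operators commuting with all \<^term>\<open>right_op n j\<close>; such an
  operator is determined by its value at \<^term>\<open>H id\<close>.\<close>

definition left_mult :: "nat \<Rightarrow> (hecke \<Rightarrow> hecke) \<Rightarrow> bool" where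
  "left_mult n F \<longleftrightarrow> hlinear n F \<and> (\<forall>h\<in>hecke_carrier n. F h \<in> hecke_carrier n) \<and>
     (\<forall>j\<in>{1..<n}. \<forall>h\<in>hecke_carrier n. F (right_op n j h) = right_op n j (F h))"

lemma left_mult_id: "left_mult n (\<lambda>h. h)"
  by (simp add: left_mult_def hlinear_def)

lemma left_mult_left_op: "i \<in> {1..<n} \<Longrightarrow> left_mult n (left_op n i)"
  unfolding left_mult_def using hlinear_left_op left_op_carrier left_right_op by blast

lemma left_mult_comp: "left_mult n F \<Longrightarrow> left_mult n G \<Longrightarrow> left_mult n (\<lambda>h. F (G h))"
  unfolding left_mult_def by (simp add: hlinear_comp right_op_carrier del: atLeastLessThan_iff)

text \<open>Right operators along a reduced word produce every basis element from
  \<open>H id\<close>, and commutation carries the agreement along.\<close>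

lemma left_mult_eqI:
  assumes "left_mult n F" "left_mult n G" "F (H id) = G (H id)" "h \<in> hecke_carrier n"
  shows "F h = G h"
proof -
  have "F (H (inv' w)) = G (H (inv' w))" if "w \<in> Sym n" for w
    using that
  proof (induction rule: Sym_induct)
    case id
    then show ?case using assms(3) by (simp only: inv_id)
  next
    case (lmul i w)
    have d: "\<not> rdesc i (inv' w)" using lmul(3) by (simp add: rdesc_def ldesc_def)
    have e: "H (inv' (lmul i w)) = right_op n i (H (inv' w))"
      unfolding inv_lmul[OF lmul(2)] right_op_H[OF inv_Sym[OF lmul(2)]] using d by simp
    show ?case
      unfolding e using assms(1,2) lmul(1,4) inv_Sym[OF lmul(2)] unfolding left_mult_def by simp
  qed
  then have "F (H w) = G (H w)" if "w \<in> Sym n" for w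
    using inv_Sym[OF that] inv_inv_Sym[OF that] by metis
  then show ?thesis using hlinear_eqI[of n F G h] assms unfolding left_mult_def by blast
qed

lemma left_mult_exists:
  assumes "w \<in> Sym n"
  shows "\<exists>F. left_mult n F \<and> F (H id) = H w"
  using assms
proof (induction rule: Sym_induct)
  case id
  then show ?case using left_mult_id by blast
next
  case (lmul i w)
  then obtain F where F: "left_mult n F" "F (H id) = H w" by blast
  have "left_op n i (F (H id)) = H (lmul i w)"
    unfolding F(2) left_op_H[OF lmul(2)] using lmul(3) by simp
  then show ?case using left_mult_comp[OF left_mult_left_op[OF lmul(1)] F(1)] by blast
qed

lemma left_mult_sum:
  assumes "\<And>w. w \<in> Sym n \<Longrightarrow> left_mult n (F w)"
  shows "left_mult n (\<lambda>h. \<Sum>w\<in>Sym n. hscale (c w) (F w h))"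
proof -
  have C: "(\<Sum>w\<in>Sym n. hscale (c w) (F w h)) \<in> hecke_carrier n" if "h \<in> hecke_carrier n" for h
    using assms that by (intro hecke_carrier_sum) (simp add: left_mult_def)
  have "(\<Sum>w\<in>Sym n. hscale (c w) (F w (right_op n j h))) = right_op n j (\<Sum>w\<in>Sym n. hscale (c w) (F w h))"
    if "j \<in> {1..<n}" "h \<in> hecke_carrier n" for j h
  proof -
    have "right_op n j (\<Sum>w\<in>Sym n. hscale (c w) (F w h)) = (\<Sum>w\<in>Sym n. right_op n j (hscale (c w) (F w h)))"
      by (rule hlinear_sum[OF hlinear_right_op]) (use assms that in \<open>simp add: left_mult_def\<close>)
    also have "\<dots> = (\<Sum>w\<in>Sym n. hscale (c w) (F w (right_op n j h)))"
      using assms that by (intro sum.cong) (simp_all add: left_mult_def right_op_hscale)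
    finally show ?thesis by simp
  qed
  moreover have "hlinear n (\<lambda>h. \<Sum>w\<in>Sym n. hscale (c w) (F w h))"
    using assms unfolding left_mult_def hlinear_def
    by (simp add: hs.scale_right_distrib sum.distrib hs.scale_sum_right mult.commute)
  ultimately show ?thesis using C unfolding left_mult_def by blast
qed

text \<open>\<open>M a\<close> is the left multiplication whose value at \<open>H id\<close> is
  \<open>a\<close>. Since such operators are determined there, associativity and the left unit law
  need only be compared at \<open>H id\<close>.\<close>

lemma hecke_mult_exists: "\<exists>M. is_hecke_mult n M"
proof -
  obtain F where F: "\<And>w. w \<in> Sym n \<Longrightarrow> left_mult n (F w)" "\<And>w. w \<in> Sym n \<Longrightarrow> F w (H id) = H w"
    using left_mult_exists[of _ n] by metis
  define M where "M a b = (\<Sum>w\<in>Sym n. hscale (lookup a w) (F w b))" for a b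
  have lm: "left_mult n (M a)" for a
    unfolding M_def using left_mult_sum F(1) by blast
  have M_id: "M a (H id) = a" if "a \<in> hecke_carrier n" for a
    unfolding M_def using hecke_expand[OF that] F(2) by simp
  have cl: "M a b \<in> hecke_carrier n" if "b \<in> hecke_carrier n" for a b
    using lm that by (simp add: left_mult_def)
  have char: "M (G (H id)) b = G b" if "left_mult n G" "b \<in> hecke_carrier n" for G b
    by (rule left_mult_eqI[OF lm that(1) M_id that(2)]) (use that in \<open>simp add: left_mult_def\<close>)
  have assoc: "M (M a b) c = M a (M b c)"
    if "a \<in> hecke_carrier n" "b \<in> hecke_carrier n" "c \<in> hecke_carrier n" for a b c
    using char[OF left_mult_comp[OF lm[of a] lm[of b]] that(3)] M_id[OF that(2)] by simp
  have one: "M (H id) b = b" if "b \<in> hecke_carrier n" for b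
    using char[OF left_mult_id that] .
  have ladd: "M (a + b) c = M a c + M b c" for a b c
    by (simp add: M_def lookup_add hs.scale_left_distrib sum.distrib)
  have lscale: "M (hscale k a) b = hscale k (M a b)" for k a b
    by (simp add: M_def hs.scale_sum_right)
  have radd: "M c (a + b) = M c a + M c b" if "a \<in> hecke_carrier n" "b \<in> hecke_carrier n" for a b c
    using lm[of c] that by (simp add: left_mult_def hlinear_def)
  have rscale: "M b (hscale k a) = hscale k (M b a)" if "a \<in> hecke_carrier n" for k a b
    using lm[of b] that by (simp add: left_mult_def hlinear_def)
  have Ms: "M (H (srefl i)) b = left_op n i b" if "i \<in> {1..<n}" "b \<in> hecke_carrier n" for i b
  proof -
    have "left_op n i (H id) = H (srefl i)" unfolding left_op_H[OF id_Sym] by simp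
    then show ?thesis using char[OF left_mult_left_op[OF that(1)] that(2)] by simp
  qed
  have ring: "ring (hecke_ring_with n M)"
    unfolding hecke_ring_with_def
  proof (rule ringI)
    show "abelian_group \<lparr>carrier = hecke_carrier n, monoid.mult = M, one = H id, zero = 0, add = (+)\<rparr>"
      by (rule abelian_groupI)
        (auto simp: algebra_simps intro: bexI[of _ "- x" for x])
    show "monoid \<lparr>carrier = hecke_carrier n, monoid.mult = M, one = H id, zero = 0, add = (+)\<rparr>"
      by (rule monoidI) (auto simp: cl assoc one M_id simp del: id_apply)
  qed (auto simp: ladd radd)
  have sq: "M (H s) (H s) = H id + hscale qq (H s)" if s: "s \<in> simple_transpositions n" for s
  proof -
    obtain i where i: "i \<in> {1..<n}" "s = srefl i" using s by (auto simp: simple_transpositions_srefl)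
    have "ldesc i (lmul i id)" using ldesc_lmul[OF id_Sym, of i] by simp
    moreover have "lmul i (srefl i) = id" unfolding lmul_def by simp
    ultimately show ?thesis
      unfolding i Ms[OF i(1) hecke_carrier_H[OF srefl_Sym[OF i(1)]]] left_op_H[OF srefl_Sym[OF i(1)]]
      by simp
  qed
  have len: "M (H x) (H y) = H (x \<circ> y)" if x: "x \<in> Sym n" and y: "y \<in> Sym n" and l: "ell x + ell y = ell (x \<circ> y)" for x y
    using x l
  proof (induction rule: Sym_induct)
    case id
    then show ?case using one y by (simp only: hecke_carrier_H id_comp)
  next
    case (lmul i x)
    have xy: "x \<circ> y \<in> Sym n" using lmul y comp_Sym by blast
    have c: "lmul i x \<circ> y = lmul i (x \<circ> y)" unfolding lmul_def by (rule comp_assoc)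
    have le: "ell (x \<circ> y) \<le> ell x + ell y" by (rule ell_comp_le[OF lmul(2) y])
    have e: "Suc (ell x) + ell y = ell (lmul i (x \<circ> y))"
      using lmul.prems ell_lmul[OF lmul(2,3)] unfolding c by linarith
    have d: "\<not> ldesc i (x \<circ> y)" using ell_lmul_desc[OF xy, of i] e le by linarith
    have "ell x + ell y = ell (x \<circ> y)" using ell_lmul[OF xy d] e by linarith
    then have IH: "M (H x) (H y) = H (x \<circ> y)" by (rule lmul.IH)
    have "H (lmul i x) = M (H (srefl i)) (H x)"
      unfolding Ms[OF lmul(1) hecke_carrier_H[OF lmul(2)]] left_op_H[OF lmul(2)] using lmul(3) by simp
    then have "M (H (lmul i x)) (H y) = M (H (srefl i)) (H (x \<circ> y))"
      using assoc hecke_carrier_H srefl_Sym[OF lmul(1)] lmul(2) y IH by metis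
    also have "\<dots> = H (lmul i (x \<circ> y))"
      unfolding Ms[OF lmul(1) hecke_carrier_H[OF xy]] left_op_H[OF xy] using d by simp
    finally show ?case unfolding c .
  qed
  have "is_hecke_mult n M"
    unfolding is_hecke_mult_def
  proof (intro conjI)
    show "\<forall>x\<in>Sym n. \<forall>y\<in>Sym n. len n x + len n y = len n (x \<circ> y) \<longrightarrow> M (H x) (H y) = H (x \<circ> y)"
    proof (intro ballI impI)
      fix x y assume "x \<in> Sym n" "y \<in> Sym n" "len n x + len n y = len n (x \<circ> y)"
      then show "M (H x) (H y) = H (x \<circ> y)" using len comp_Sym len_ell by metis
    qed
  qed (use ring lscale rscale sq in blast)+
  then show ?thesis by blast
qed

section \<open>The Hecke algebra\<close>

abbreviation (input) hmult :: "nat \<Rightarrow> hecke \<Rightarrow> hecke \<Rightarrow> hecke" where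
  "hmult n a b \<equiv> a \<otimes>\<^bsub>hecke n\<^esub> b"

lemma is_hecke_mult_hecke: "is_hecke_mult n (monoid.mult (hecke n))"
proof -
  have "monoid.mult (hecke n) = (SOME M. is_hecke_mult n M)"
    by (simp add: hecke_def hecke_ring_with_def)
  then show ?thesis using someI_ex[OF hecke_mult_exists[of n]] by simp
qed

lemma hecke_simps [simp]:
  "carrier (hecke n) = hecke_carrier n" "\<one>\<^bsub>hecke n\<^esub> = H id" "\<zero>\<^bsub>hecke n\<^esub> = 0"
  "a \<oplus>\<^bsub>hecke n\<^esub> b = a + b"
  by (simp_all add: hecke_def hecke_ring_with_def)

lemma hecke_ring: "ring (hecke n)"
proof -
  have "hecke n = hecke_ring_with n (monoid.mult (hecke n))" by (simp add: hecke_def hecke_ring_with_def)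
  then show ?thesis using is_hecke_mult_hecke unfolding is_hecke_mult_def by metis
qed

lemma hmult_carrier [simp]:
  "a \<in> hecke_carrier n \<Longrightarrow> b \<in> hecke_carrier n \<Longrightarrow> hmult n a b \<in> hecke_carrier n"
  using monoid.m_closed[OF ring.is_monoid[OF hecke_ring]] by simp

lemma hmult_assoc:
  "a \<in> hecke_carrier n \<Longrightarrow> b \<in> hecke_carrier n \<Longrightarrow> c \<in> hecke_carrier n \<Longrightarrow>
   hmult n (hmult n a b) c = hmult n a (hmult n b c)"
  using monoid.m_assoc[OF ring.is_monoid[OF hecke_ring]] by simp

lemma hmult_id:
  "a \<in> hecke_carrier n \<Longrightarrow> hmult n (H id) a = a" "a \<in> hecke_carrier n \<Longrightarrow> hmult n a (H id) = a"
  using monoid.l_one[OF ring.is_monoid[OF hecke_ring], of a n]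
    monoid.r_one[OF ring.is_monoid[OF hecke_ring], of a n] by (simp_all del: id_apply)

lemma hmult_add_left:
  "a \<in> hecke_carrier n \<Longrightarrow> b \<in> hecke_carrier n \<Longrightarrow> c \<in> hecke_carrier n \<Longrightarrow>
   hmult n (a + b) c = hmult n a c + hmult n b c"
  using ring.ring_simprules(13)[OF hecke_ring, of a n b c] by simp

lemma hmult_add_right:
  "a \<in> hecke_carrier n \<Longrightarrow> b \<in> hecke_carrier n \<Longrightarrow> c \<in> hecke_carrier n \<Longrightarrow>
   hmult n c (a + b) = hmult n c a + hmult n c b"
  using ring.ring_simprules(23)[OF hecke_ring, of a n b c] by simp

lemma hmult_hscale:
  assumes "a \<in> hecke_carrier n" "b \<in> hecke_carrier n"
  shows "hmult n (hscale c a) b = hscale c (hmult n a b)" "hmult n a (hscale c b) = hscale c (hmult n a b)"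
  using is_hecke_mult_hecke assms unfolding is_hecke_mult_def by blast+

lemma hlinear_hmult_right: "a \<in> hecke_carrier n \<Longrightarrow> hlinear n (hmult n a)"
  by (simp add: hlinear_def hmult_add_right hmult_hscale)

lemma hlinear_hmult_left: "b \<in> hecke_carrier n \<Longrightarrow> hlinear n (\<lambda>a. hmult n a b)"
  by (simp add: hlinear_def hmult_add_left hmult_hscale)

lemmas hmult_diff_right = hlinear_diff[OF hlinear_hmult_right]
  and hmult_diff_left = hlinear_diff[OF hlinear_hmult_left]

lemma hmult_H:
  assumes "x \<in> Sym n" "y \<in> Sym n" "ell x + ell y = ell (x \<circ> y)"
  shows "hmult n (H x) (H y) = H (x \<circ> y)"
proof -
  have "len n x + len n y = len n (x \<circ> y)"
    using assms len_ell comp_Sym by metis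
  then show ?thesis using is_hecke_mult_hecke assms unfolding is_hecke_mult_def by blast
qed

lemma ell_srefl_1: "ell (srefl i) = 1"
  using ell_lmul[OF id_Sym ldesc_id, of i] by (simp only: lmul_id ell_id One_nat_def)

lemma hmult_srefl_asc:
  assumes "i \<in> {1..<n}" "w \<in> Sym n" "\<not> ldesc i w"
  shows "hmult n (H (srefl i)) (H w) = H (lmul i w)"
  using hmult_H[OF srefl_Sym[OF assms(1)] assms(2)] ell_lmul[OF assms(2,3)] ell_srefl_1
  unfolding lmul_def by simp

lemma hmult_srefl_right:
  assumes "i \<in> {1..<n}" "w \<in> Sym n" "\<not> ldesc i w"
  shows "hmult n (H (inv' w)) (H (srefl i)) = H (inv' (lmul i w))"
proof -
  have e: "inv' (lmul i w) = inv' w \<circ> srefl i"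
    using inv_lmul[OF assms(2), of i] unfolding rmul_def .
  have "ell (inv' (lmul i w)) = Suc (ell w)"
    using ell_inv[OF lmul_Sym[OF assms(2,1)]] ell_lmul[OF assms(2,3)] by simp
  then have "ell (inv' w) + ell (srefl i) = ell (inv' w \<circ> srefl i)"
    unfolding e ell_inv[OF assms(2)] ell_srefl_1 by linarith
  from hmult_H[OF inv_Sym[OF assms(2)] srefl_Sym[OF assms(1)] this] show ?thesis
    unfolding e .
qed

lemma hmult_srefl:
  assumes i: "i \<in> {1..<n}" and h: "h \<in> hecke_carrier n"
  shows "hmult n (H (srefl i)) h = left_op n i h"
proof (rule hlinear_eqI[OF _ hlinear_left_op _ h])
  have s: "H (srefl i) \<in> hecke_carrier n" using srefl_Sym[OF i] by simp
  then show "hlinear n (hmult n (H (srefl i)))" by (rule hlinear_hmult_right)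
  fix w assume w: "w \<in> Sym n"
  show "hmult n (H (srefl i)) (H w) = left_op n i (H w)"
  proof (cases "ldesc i w")
    case False
    then show ?thesis using hmult_srefl_asc[OF i w] left_op_H[OF w] by simp
  next
    case True
    define u where "u = lmul i w"
    have u: "u \<in> Sym n" "\<not> ldesc i u" "w = lmul i u"
      using lmul_Sym[OF w i] ldesc_lmul[OF w] True by (simp_all add: u_def)
    have sq: "hmult n (H (srefl i)) (H (srefl i)) = H id + hscale qq (H (srefl i))"
      using is_hecke_mult_hecke i unfolding is_hecke_mult_def simple_transpositions_srefl by blast
    have Hw: "H w = hmult n (H (srefl i)) (H u)" using hmult_srefl_asc[OF i u(1,2)] u(3) by simp
    have "hmult n (H (srefl i)) (H w) = hmult n (H id + hscale qq (H (srefl i))) (H u)"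
      unfolding Hw using hmult_assoc[of "H (srefl i)" n "H (srefl i)" "H u"] s u(1) sq by simp
    also have "\<dots> = H u + hscale qq (H w)"
      using s u(1) Hw hmult_id(1)[of "H u" n] hmult_add_left[of "H id" n "hscale qq (H (srefl i))" "H u"]
        hecke_carrier_H[OF id_Sym]
      by (simp add: hmult_hscale del: id_apply)
    finally show ?thesis unfolding left_op_H[OF w] using True by (simp add: u_def)
  qed
qed

section \<open>Left multiplication by the Kazhdan-Lusztig element of a simple transposition\<close>

definition kl_op :: "nat \<Rightarrow> nat \<Rightarrow> hecke \<Rightarrow> hecke" where
  "kl_op n i h = hmult n (H (srefl i) + hscale (vpow 1) (H id)) h"

lemma kls_carrier: "i \<in> {1..<n} \<Longrightarrow> H (srefl i) + hscale (vpow 1) (H id) \<in> hecke_carrier n"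
  using srefl_Sym[of i n] hecke_carrier_H[OF id_Sym] by (simp del: id_apply)

lemma kl_op_left_op:
  assumes "i \<in> {1..<n}" "h \<in> hecke_carrier n"
  shows "kl_op n i h = left_op n i h + hscale (vpow 1) h"
proof -
  have "H (srefl i) \<in> hecke_carrier n" "H id \<in> hecke_carrier n"
    using srefl_Sym[OF assms(1)] hecke_carrier_H[OF id_Sym] by auto
  then show ?thesis using assms unfolding kl_op_def
    by (simp add: hmult_add_left hmult_hscale hmult_srefl hmult_id del: id_apply)
qed

lemma kl_op_carrier: "i \<in> {1..<n} \<Longrightarrow> h \<in> hecke_carrier n \<Longrightarrow> kl_op n i h \<in> hecke_carrier n"
  unfolding kl_op_def by (intro hmult_carrier kls_carrier)

lemma hlinear_kl_op: "i \<in> {1..<n} \<Longrightarrow> hlinear n (kl_op n i)"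
  unfolding kl_op_def[abs_def] by (rule hlinear_hmult_right[OF kls_carrier])

lemmas kl_op_diff = hlinear_diff[OF hlinear_kl_op]

lemma kl_op_hscale: "i \<in> {1..<n} \<Longrightarrow> a \<in> hecke_carrier n \<Longrightarrow> kl_op n i (hscale c a) = hscale c (kl_op n i a)"
  using hlinear_kl_op unfolding hlinear_def by blast

lemma kl_op_hmult:
  "i \<in> {1..<n} \<Longrightarrow> a \<in> hecke_carrier n \<Longrightarrow> b \<in> hecke_carrier n \<Longrightarrow>
   kl_op n i (hmult n a b) = hmult n (kl_op n i a) b"
  unfolding kl_op_def by (subst hmult_assoc) (use kls_carrier in auto)

lemma lookup_left_op:
  assumes "i \<in> {1..<n}" "x \<in> Sym n"
  shows "lookup (left_op n i h) x =
    lookup h (lmul i x) + (if ldesc i x then qq * lookup h x else 0)"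
proof -
  have eq: "x = lmul i w \<longleftrightarrow> w = lmul i x" for w by (metis lmul_lmul)
  have ne: "lmul i x \<noteq> x" using ldesc_lmul[OF assms(2), of i] by metis
  have "lookup (left_op n i h) x =
    (\<Sum>w\<in>Sym n. (if w = lmul i x then lookup h w else 0) +
       (if w = x then (if ldesc i x then qq * lookup h x else 0) else 0))"
    unfolding left_op_def lin_ext_def lookup_sum
  proof (rule sum.cong)
    fix w
    have z: "lookup (if P then a else 0) x = (if P then lookup a x else 0)"
      for P and a :: hecke by simp
    consider "w = lmul i x" | "w = x" | "w \<noteq> lmul i x" "w \<noteq> x" by blast
    then show "lookup (hscale (lookup h w)
        (H (lmul i w) + (if ldesc i w then hscale qq (H w) else 0))) x =
      (if w = lmul i x then lookup h w else 0) +
      (if w = x then (if ldesc i x then qq * lookup h x else 0) else 0)"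
    proof cases
      case 1
      then show ?thesis using ne by (auto simp: lookup_add lookup_H z)
    next
      case 2
      then show ?thesis using ne by (auto simp: lookup_add lookup_H z mult.commute)
    next
      case 3
      then have "x \<noteq> lmul i w" using eq by blast
      then show ?thesis using 3 by (auto simp: lookup_add lookup_H z)
    qed
  qed simp
  then show ?thesis using assms(2) lmul_Sym[OF assms(2,1)] by (simp add: sum.distrib)
qed

definition vdesc :: "nat \<Rightarrow> (nat \<Rightarrow> nat) \<Rightarrow> laurent" where
  "vdesc i x = (if ldesc i x then vpow (- 1) else vpow 1)"

lemma lookup_kl_op:
  assumes "i \<in> {1..<n}" "x \<in> Sym n" "h \<in> hecke_carrier n"
  shows "lookup (kl_op n i h) x =
    lookup h (lmul i x) + vdesc i x * lookup h x"
  using lookup_left_op[OF assms(1,2), of h] kl_op_left_op[OF assms(1,3)]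
  by (simp add: lookup_add vdesc_def algebra_simps)

lemma hecke_eqI:
  assumes "a \<in> hecke_carrier n" "b \<in> hecke_carrier n"
    "\<And>x. x \<in> Sym n \<Longrightarrow> lookup a x = lookup b x"
  shows "a = b"
  using assms by (intro poly_mapping_eqI) (metis hecke_carrier_iff)

lemma kl_op_kl_op:
  assumes i: "i \<in> {1..<n}" and h: "h \<in> hecke_carrier n"
  shows "kl_op n i (kl_op n i h) = hscale vv (kl_op n i h)"
proof (rule hecke_eqI)
  fix x assume x: "x \<in> Sym n"
  \<comment> \<open>Exactly one of \<open>x\<close> and \<open>lmul i x\<close> has descent
    \<open>i\<close>, so the two factors are v and its inverse.\<close>
  have v: "vdesc i (lmul i x) * vdesc i x = 1" "vdesc i (lmul i x) + vdesc i x = vv"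
    using ldesc_lmul[OF x, of i] by (auto simp: vdesc_def vpow_mult)
  let ?a = "lookup h x" and ?b = "lookup h (lmul i x)"
  have "lookup (kl_op n i (kl_op n i h)) x =
      ?a + vdesc i (lmul i x) * ?b + vdesc i x * (?b + vdesc i x * ?a)"
    by (simp add: lookup_kl_op[OF i] x h kl_op_carrier[OF i] lmul_Sym[OF x i])
  also have "\<dots> = (vdesc i (lmul i x) * vdesc i x) * ?a + vdesc i (lmul i x) * ?b + vdesc i x * (?b + vdesc i x * ?a)"
    unfolding v(1) by simp
  also have "\<dots> = (vdesc i (lmul i x) + vdesc i x) * (?b + vdesc i x * ?a)"
    by (simp add: algebra_simps)
  also have "\<dots> = lookup (hscale vv (kl_op n i h)) x"
    unfolding v(2) by (simp add: lookup_kl_op[OF i x h])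
  finally show "lookup (kl_op n i (kl_op n i h)) x = lookup (hscale vv (kl_op n i h)) x" .
qed (use i h kl_op_carrier in auto)

section \<open>The bar involution\<close>

definition bar_H :: "nat \<Rightarrow> (nat \<Rightarrow> nat) \<Rightarrow> hecke" where
  "bar_H n y = inv\<^bsub>hecke n\<^esub> (H (inv' y))"

lemma inv_H_srefl:
  assumes i: "i \<in> {1..<n}"
  shows "H (srefl i) \<in> Units (hecke n)"
    "inv\<^bsub>hecke n\<^esub> (H (srefl i)) = H (srefl i) - hscale qq (H id)"
proof -
  let ?s = "H (srefl i)" and ?t = "H (srefl i) - hscale qq (H id)"
  have c: "?s \<in> hecke_carrier n" "H id \<in> hecke_carrier n" "?t \<in> hecke_carrier n"
    using srefl_Sym[OF i] hecke_carrier_H[OF id_Sym] by auto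
  have sq: "hmult n ?s ?s = H id + hscale qq ?s"
    using is_hecke_mult_hecke i unfolding is_hecke_mult_def simple_transpositions_srefl by blast
  have r: "hmult n ?s ?t = H id"
    using c by (simp add: hmult_diff_right hmult_hscale hmult_id sq del: id_apply)
  have l: "hmult n ?t ?s = H id"
    using c by (simp add: hmult_diff_left hmult_hscale hmult_id sq del: id_apply)
  show "?s \<in> Units (hecke n)"
    unfolding Units_def using c l r by (auto intro!: bexI[of _ ?t] simp del: id_apply)
  show "inv\<^bsub>hecke n\<^esub> ?s = ?t"
    using monoid.inv_char[OF ring.is_monoid[OF hecke_ring], of ?s n ?t] c l r by (simp del: id_apply)
qed

lemma H_Units: "w \<in> Sym n \<Longrightarrow> H w \<in> Units (hecke n)"
proof (induction rule: Sym_induct)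
  case id
  show ?case using monoid.Units_one_closed[OF ring.is_monoid[OF hecke_ring], of n]
    by (simp del: id_apply)
next
  case (lmul i w)
  then show ?case
    using hmult_srefl_asc[OF lmul(1-3)] inv_H_srefl(1)[OF lmul(1)]
      monoid.Units_m_closed[OF ring.is_monoid[OF hecke_ring], of "H (srefl i)" n "H w"] by simp
qed

lemma bar_H_carrier [simp]: "w \<in> Sym n \<Longrightarrow> bar_H n w \<in> hecke_carrier n"
  unfolding bar_H_def
  using monoid.Units_inv_closed[OF ring.is_monoid[OF hecke_ring] H_Units[OF inv_Sym]] by simp

lemma bar_H_id: "bar_H n id = H id"
  unfolding bar_H_def inv_id
  using monoid.inv_one[OF ring.is_monoid[OF hecke_ring], of n] by (simp del: id_apply)

lemma monoid_inv_mult: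
  assumes "monoid G" "a \<in> Units G" "b \<in> Units G"
  shows "inv\<^bsub>G\<^esub> (a \<otimes>\<^bsub>G\<^esub> b) = inv\<^bsub>G\<^esub> b \<otimes>\<^bsub>G\<^esub> inv\<^bsub>G\<^esub> a"
  using group.inv_mult_group[OF monoid.units_group[OF assms(1)], of a b] assms
  by (simp add: units_of_carrier units_of_mult monoid.units_of_inv monoid.Units_m_closed)

text \<open>The inverse of \<open>H (srefl i)\<close> is the Kazhdan-Lusztig element of
  \<open>srefl i\<close> minus the inverse of v.\<close>

lemma bar_H_lmul:
  assumes "i \<in> {1..<n}" "w \<in> Sym n" "\<not> ldesc i w"
  shows "bar_H n (lmul i w) = kl_op n i (bar_H n w) - hscale (vpow (- 1)) (bar_H n w)"
proof -
  have "bar_H n (lmul i w) = hmult n (inv\<^bsub>hecke n\<^esub> (H (srefl i))) (bar_H n w)"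
    unfolding bar_H_def hmult_srefl_right[OF assms, symmetric]
    by (rule monoid_inv_mult[OF ring.is_monoid[OF hecke_ring] H_Units[OF inv_Sym[OF assms(2)]]
          inv_H_srefl(1)[OF assms(1)]])
  also have "\<dots> = left_op n i (bar_H n w) - hscale qq (bar_H n w)"
    unfolding inv_H_srefl(2)[OF assms(1)]
    using srefl_Sym[OF assms(1)] hecke_carrier_H[OF id_Sym] assms(1,2)
    by (simp add: hmult_diff_left hmult_hscale hmult_srefl hmult_id del: id_apply)
  finally show ?thesis
    unfolding kl_op_left_op[OF assms(1) bar_H_carrier[OF assms(2)]]
    by (simp add: hs.scale_left_diff_distrib)
qed

lemma hecke_bar_bar_H: "hecke_bar n h = (\<Sum>y\<in>Sym n. hscale (laurent_bar (lookup h y)) (bar_H n y))"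
  by (simp add: hecke_bar_def bar_H_def)

lemma hecke_bar_add: "hecke_bar n (a + b) = hecke_bar n a + hecke_bar n b"
  and hecke_bar_diff: "hecke_bar n (a - b) = hecke_bar n a - hecke_bar n b"
  and hecke_bar_hscale: "hecke_bar n (hscale c a) = hscale (laurent_bar c) (hecke_bar n a)"
  and hecke_bar_0 [simp]: "hecke_bar n 0 = 0"
  by (simp_all add: hecke_bar_bar_H lookup_add lookup_minus hs.scale_left_distrib
      hs.scale_left_diff_distrib sum.distrib sum_subtractf hs.scale_sum_right)

lemma hecke_bar_sum: "hecke_bar n (sum f A) = (\<Sum>a\<in>A. hecke_bar n (f a))"
  by (induction A rule: infinite_finite_induct) (auto simp: hecke_bar_add)

lemma hecke_bar_H: "w \<in> Sym n \<Longrightarrow> hecke_bar n (H w) = bar_H n w"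
  by (simp add: hecke_bar_bar_H lookup_H if_distrib[of laurent_bar] if_distrib[of "\<lambda>c. hscale c _"] cong: if_cong)

text \<open>Multiplicativity of the bar map for a bar-invariant left factor. On basis elements an
  ascent is \<open>bar_H_lmul\<close>, and a descent reduces to it through
  \<open>kl_op_kl_op\<close>.\<close>

lemma hecke_bar_kl_op:
  assumes i: "i \<in> {1..<n}" and h: "h \<in> hecke_carrier n"
  shows "hecke_bar n (kl_op n i h) = kl_op n i (hecke_bar n h)"
proof -
  have bs: "hecke_bar n (kl_op n i (H w)) = kl_op n i (bar_H n w)" if w: "w \<in> Sym n" for w
  proof (cases "ldesc i w")
    case False
    have "kl_op n i (H w) = H (lmul i w) + hscale (vpow 1) (H w)"
      unfolding kl_op_left_op[OF i hecke_carrier_H[OF w]] left_op_H[OF w] using False by simp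
    then show ?thesis
      using hecke_bar_H[OF w] hecke_bar_H[OF lmul_Sym[OF w i]] bar_H_lmul[OF i w False]
      by (simp add: hecke_bar_add hecke_bar_hscale)
  next
    case True
    define u where "u = lmul i w"
    have u: "u \<in> Sym n" "\<not> ldesc i u" "w = lmul i u"
      using lmul_Sym[OF w i] ldesc_lmul[OF w] True by (simp_all add: u_def)
    have Bw: "bar_H n w = kl_op n i (bar_H n u) - hscale (vpow (- 1)) (bar_H n u)"
      unfolding u(3) by (rule bar_H_lmul[OF i u(1,2)])
    have "kl_op n i (H w) = H u + hscale qq (H w) + hscale (vpow 1) (H w)"
      unfolding kl_op_left_op[OF i hecke_carrier_H[OF w]] left_op_H[OF w] using True by (simp add: u_def)
    also have "\<dots> = H u + hscale (vpow (- 1)) (H w)"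
      by (simp add: hs.scale_left_diff_distrib)
    finally have "hecke_bar n (kl_op n i (H w)) = bar_H n u + hscale (vpow 1) (bar_H n w)"
      using hecke_bar_H[OF w] hecke_bar_H[OF u(1)] by (simp add: hecke_bar_add hecke_bar_hscale)
    also have "\<dots> = hscale (vpow 1) (kl_op n i (bar_H n u))"
      unfolding Bw by (simp add: hs.scale_right_diff_distrib vpow_mult)
    also have "\<dots> = kl_op n i (bar_H n w)"
      unfolding Bw using i u(1) kl_op_carrier[OF i bar_H_carrier[OF u(1)]]
      by (simp add: kl_op_diff kl_op_hscale kl_op_kl_op hs.scale_left_distrib)
    finally show ?thesis .
  qed
  have "hecke_bar n (kl_op n i h) =
      hecke_bar n (\<Sum>w\<in>Sym n. hscale (lookup h w) (kl_op n i (H w)))"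
    using hlinear_expand[OF hlinear_kl_op[OF i] h] by simp
  also have "\<dots> = (\<Sum>w\<in>Sym n. hscale (laurent_bar (lookup h w)) (kl_op n i (bar_H n w)))"
    by (simp add: hecke_bar_sum hecke_bar_hscale bs)
  also have "\<dots> = (\<Sum>w\<in>Sym n. kl_op n i (hscale (laurent_bar (lookup h w)) (bar_H n w)))"
    using i by (intro sum.cong) (simp_all add: kl_op_hscale)
  also have "\<dots> = kl_op n i (hecke_bar n h)"
    unfolding hecke_bar_bar_H by (rule hlinear_sum[OF hlinear_kl_op[OF i], symmetric]) simp
  finally show ?thesis .
qed

text \<open>A left multiplication raises length by at most one, so besides \<open>H w\<close> itself
  no term of length at least \<open>ell w\<close> can arise.\<close>

lemma lookup_bar_H:
  assumes "w \<in> Sym n" "x \<in> Sym n" "ell w \<le> ell x"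
  shows "lookup (bar_H n w) x = (if x = w then 1 else 0)"
  using assms
proof (induction arbitrary: x rule: Sym_induct)
  case id
  then show ?case by (simp add: bar_H_id lookup_H del: id_apply)
next
  case (lmul i w)
  have lx: "ell w < ell x" using lmul.prems(2) ell_lmul[OF lmul(2,3)] by simp
  have s: "lmul i x \<in> Sym n" using lmul_Sym[OF lmul.prems(1) lmul(1)] .
  have l: "ell w \<le> ell (lmul i x)" using lx ell_le_lmul[OF lmul.prems(1), of i] by simp
  have "lookup (bar_H n w) x = 0" using lmul.IH[OF lmul.prems(1)] lx by auto
  then have "lookup (bar_H n (lmul i w)) x = lookup (bar_H n w) (lmul i x)"
    unfolding bar_H_lmul[OF lmul(1-3)]
    using lookup_kl_op[OF lmul(1) lmul.prems(1) bar_H_carrier[OF lmul(2)]] by (simp add: lookup_minus)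
  then show ?case using lmul.IH[OF s l] by (simp add: lmul_eq_iff)
qed

section \<open>The Kazhdan-Lusztig basis\<close>

definition is_kl :: "nat \<Rightarrow> (nat \<Rightarrow> nat) \<Rightarrow> hecke \<Rightarrow> bool" where
  "is_kl n w C \<longleftrightarrow> C \<in> hecke_carrier n \<and> hecke_bar n C = C \<and> lookup C w = 1 \<and>
     (\<forall>y\<in>Sym n - {w}. lookup C y \<in> vZv)"

text \<open>At an element of maximal length in the support, unitriangularity makes the coefficient
  bar-invariant, and 0 is the only such element of \<open>vZv\<close>.\<close>

lemma bar_invariant_0:
  assumes D: "D \<in> hecke_carrier n" "hecke_bar n D = D" "\<And>y. y \<in> Sym n \<Longrightarrow> lookup D y \<in> vZv"
  shows "D = 0"
proof (rule ccontr)
  assume "D \<noteq> 0"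
  define S where "S = {y \<in> Sym n. lookup D y \<noteq> 0}"
  have "S \<noteq> {}" using \<open>D \<noteq> 0\<close> hecke_eqI[OF D(1) hecke_carrier_0] by (auto simp: S_def)
  moreover have "finite S" by (simp add: S_def)
  ultimately obtain x where x: "x \<in> S" "\<And>y. y \<in> S \<Longrightarrow> ell y \<le> ell x"
    using exists_longest by metis
  have xs: "x \<in> Sym n" using x by (simp add: S_def)
  have "lookup D x = lookup (hecke_bar n D) x" using D(2) by simp
  also have "\<dots> = (\<Sum>y\<in>Sym n. laurent_bar (lookup D y) * lookup (bar_H n y) x)"
    by (simp add: hecke_bar_bar_H lookup_sum)
  also have "\<dots> = (\<Sum>y\<in>Sym n. if y = x then laurent_bar (lookup D y) else 0)"
  proof (rule sum.cong)
    fix y assume y: "y \<in> Sym n"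
    show "laurent_bar (lookup D y) * lookup (bar_H n y) x =
      (if y = x then laurent_bar (lookup D y) else 0)"
      using lookup_bar_H[OF y xs] x(2)[of y] y by (cases "y \<in> S") (auto simp: S_def)
  qed simp
  also have "\<dots> = laurent_bar (lookup D x)" using xs by simp
  finally have "lookup D x = 0" using vZv_bar_0 D(3)[OF xs] by metis
  then show False using x by (simp add: S_def)
qed

lemma is_kl_unique:
  assumes "is_kl n w C" "is_kl n w C'"
  shows "C = C'"
proof -
  have "C - C' = 0"
  proof (rule bar_invariant_0[of _ n])
    fix y assume "y \<in> Sym n"
    then show "lookup (C - C') y \<in> vZv"
      using assms by (cases "y = w") (auto simp: is_kl_def lookup_minus intro!: vZv_diff)
  qed (use assms in \<open>auto simp: is_kl_def hecke_bar_diff\<close>)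
  then show ?thesis by simp
qed

text \<open>The recursion of Kazhdan and Lusztig. The product with the element of
  \<open>srefl i\<close> is bar-invariant with the right leading term, but may have constant terms
  at elements with descent \<open>i\<close>; subtracting bar-invariant multiples of shorter basis
  elements removes them.\<close>

lemma is_kl_step:
  assumes i: "i \<in> {1..<n}" and u: "u \<in> Sym n" "\<not> ldesc i u"
    and K: "\<And>y. y \<in> Sym n \<Longrightarrow> ell y \<le> ell u \<Longrightarrow> is_kl n y (K y) \<and>
      (\<forall>x\<in>Sym n. x \<noteq> y \<longrightarrow> ell y \<le> ell x \<longrightarrow> lookup (K y) x = 0)"
  defines "S \<equiv> {y \<in> Sym n. ldesc i y \<and> ell y < ell u}"
  defines "C \<equiv> kl_op n i (K u) - (\<Sum>y\<in>S. hscale (coef1 (lookup (K u) y)) (K y))"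
  shows "is_kl n (lmul i u) C \<and>
    (\<forall>x\<in>Sym n. x \<noteq> lmul i u \<longrightarrow> ell (lmul i u) \<le> ell x \<longrightarrow> lookup C x = 0)"
proof -
  let ?L = lookup
  have Ku: "is_kl n u (K u)" and tri_u: "\<And>x. x \<in> Sym n \<Longrightarrow> x \<noteq> u \<Longrightarrow> ell u \<le> ell x \<Longrightarrow> ?L (K u) x = 0"
    using K u(1) by auto
  have KS: "is_kl n y (K y)" "\<And>x. x \<in> Sym n \<Longrightarrow> x \<noteq> y \<Longrightarrow> ell y \<le> ell x \<Longrightarrow> ?L (K y) x = 0"
    if "y \<in> S" for y
    using that K[of y] by (auto simp: S_def)
  have fin: "finite S" by (simp add: S_def)
  have cu: "K u \<in> hecke_carrier n" using Ku by (simp add: is_kl_def)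
  have cy: "K y \<in> hecke_carrier n" if "y \<in> S" for y using KS(1)[OF that] by (simp add: is_kl_def)
  have C: "C \<in> hecke_carrier n"
    unfolding C_def using kl_op_carrier[OF i cu] cy by (intro hecke_carrier_diff hecke_carrier_sum) auto
  have bar: "hecke_bar n C = C"
  proof -
    have "hecke_bar n (K u) = K u" using Ku by (simp add: is_kl_def)
    moreover have "hecke_bar n (K y) = K y" if "y \<in> S" for y using KS(1)[OF that] by (simp add: is_kl_def)
    ultimately show ?thesis
      unfolding C_def by (simp add: hecke_bar_diff hecke_bar_kl_op[OF i cu] hecke_bar_sum hecke_bar_hscale)
  qed
  have LC: "?L C x = ?L (K u) (lmul i x) + vdesc i x * ?L (K u) x -
      (\<Sum>y\<in>S. coef1 (?L (K u) y) * ?L (K y) x)" if "x \<in> Sym n" for x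
    unfolding C_def by (simp add: lookup_minus lookup_sum lookup_kl_op[OF i that cu])
  have eu: "ell (lmul i u) = Suc (ell u)" using ell_lmul u by simp
  have high: "?L (K u) x = 0" "(\<Sum>y\<in>S. coef1 (?L (K u) y) * ?L (K y) x) = 0"
    if "x \<in> Sym n" "ell u < ell x" for x
  proof -
    show "?L (K u) x = 0" using tri_u[OF that(1)] that(2) by auto
    have "?L (K y) x = 0" if y: "y \<in> S" for y
    proof -
      have "ell y < ell x" using y \<open>ell u < ell x\<close> by (simp add: S_def)
      then show ?thesis using KS(2)[OF y \<open>x \<in> Sym n\<close>] by auto
    qed
    then show "(\<Sum>y\<in>S. coef1 (?L (K u) y) * ?L (K y) x) = 0" by simp
  qed
  have one: "?L C (lmul i u) = 1"
    using LC[OF lmul_Sym[OF u(1) i]] high[OF lmul_Sym[OF u(1) i]] eu Ku by (simp add: is_kl_def)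
  have zero: "?L C x = 0" if x: "x \<in> Sym n" "x \<noteq> lmul i u" "ell (lmul i u) \<le> ell x" for x
  proof -
    have "?L (K u) (lmul i x) = 0"
      using tri_u[OF lmul_Sym[OF x(1) i]] x(2,3) eu ell_le_lmul[OF x(1), of i] by (simp add: lmul_eq_iff)
    then show ?thesis using LC[OF x(1)] high[OF x(1)] x(3) eu by simp
  qed
  have v: "?L C x \<in> vZv" if x: "x \<in> Sym n" "x \<noteq> lmul i u" for x
  proof -
    have a: "?L (K u) (lmul i x) \<in> vZv"
      using Ku lmul_Sym[OF x(1) i] x(2) by (simp add: is_kl_def lmul_eq_iff)
    have sum_v: "(\<Sum>y\<in>T. coef1 (?L (K u) y) * ?L (K y) x) \<in> vZv" if "T \<subseteq> S - {x}" for T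
      using that KS(1) x(1) by (intro vZv_sum vZv_coef1_mult) (auto simp: is_kl_def)
    show ?thesis
    proof (cases "ldesc i x")
      case False
      have "?L (K u) x \<in> vZv \<or> x = u" using Ku x(1) by (auto simp: is_kl_def)
      then have "vdesc i x * ?L (K u) x \<in> vZv"
        using False Ku vZv_vpow_mult by (auto simp: vdesc_def is_kl_def)
      moreover have "S \<subseteq> S - {x}" using False by (auto simp: S_def)
      ultimately show ?thesis
        unfolding LC[OF x(1)] using a sum_v by (intro vZv_diff vZv_add)
    next
      case True
      then have xu: "x \<noteq> u" using u by auto
      then have p: "?L (K u) x \<in> vZv" using Ku x(1) by (simp add: is_kl_def)
      \<comment> \<open>The factor \<open>vpow (- 1)\<close> turns the linear term at
        \<open>x\<close> into a constant; the summand \<open>y = x\<close> cancels exactly this, and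
        the other summands lie in \<open>vZv\<close>.\<close>
      have "vpow (- 1) * ?L (K u) x - (\<Sum>y\<in>S. coef1 (?L (K u) y) * ?L (K y) x) \<in> vZv"
      proof (cases "x \<in> S")
        case True
        have "?L (K x) x = 1" using KS(1)[OF True] by (simp add: is_kl_def)
        then have "(\<Sum>y\<in>S. coef1 (?L (K u) y) * ?L (K y) x) =
            coef1 (?L (K u) x) + (\<Sum>y\<in>S - {x}. coef1 (?L (K u) y) * ?L (K y) x)"
          using sum.remove[OF fin True, of "\<lambda>y. coef1 (?L (K u) y) * ?L (K y) x"] by simp
        then show ?thesis using vZv_diff[OF vZv_shift[OF p] sum_v[OF order_refl]] by (simp add: algebra_simps)
      next
        case False
        then have "?L (K u) x = 0" using tri_u[OF x(1) xu] \<open>ldesc i x\<close> x(1) by (auto simp: S_def)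
        then show ?thesis using sum_v[of S] False vZv_diff[OF vZv_0] by simp
      qed
      then show ?thesis
        unfolding LC[OF x(1)] using a True vZv_add by (simp add: vdesc_def add_diff_eq[symmetric])
    qed
  qed
  show ?thesis using C bar one zero v by (auto simp: is_kl_def)
qed

lemma is_kl_exists:
  assumes "w \<in> Sym n"
  shows "\<exists>C. is_kl n w C \<and> (\<forall>x\<in>Sym n. x \<noteq> w \<longrightarrow> ell w \<le> ell x \<longrightarrow> lookup C x = 0)"
  using assms
proof (induction "ell w" arbitrary: w rule: less_induct)
  case less
  show ?case
  proof (cases "w = id")
    case True
    have "is_kl n id (H id)"
      using hecke_bar_H[OF id_Sym] bar_H_id hecke_carrier_H[OF id_Sym]
      by (simp add: is_kl_def lookup_H del: id_apply)
    then show ?thesis unfolding True by (intro exI[of _ "H id"]) (auto simp: lookup_H)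
  next
    case False
    then obtain i where i: "i \<in> {1..<n}" "ldesc i w" using exists_ldesc less.prems by blast
    define u where "u = lmul i w"
    have u: "u \<in> Sym n" "\<not> ldesc i u" "w = lmul i u"
      using lmul_Sym[OF less.prems i(1)] ldesc_lmul[OF less.prems] i(2) by (simp_all add: u_def)
    have "ell w = Suc (ell u)" using ell_lmul[OF u(1,2)] u(3) by simp
    then have "\<exists>C. is_kl n y C \<and> (\<forall>x\<in>Sym n. x \<noteq> y \<longrightarrow> ell y \<le> ell x \<longrightarrow> lookup C x = 0)"
      if "y \<in> Sym n" "ell y \<le> ell u" for y
      using less.hyps[of y] that by simp
    then obtain K where "\<And>y. y \<in> Sym n \<Longrightarrow> ell y \<le> ell u \<Longrightarrow> is_kl n y (K y) \<and>
        (\<forall>x\<in>Sym n. x \<noteq> y \<longrightarrow> ell y \<le> ell x \<longrightarrow> lookup (K y) x = 0)"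
      by metis
    from is_kl_step[OF i(1) u(1,2) this] show ?thesis unfolding u(3)[symmetric] by blast
  qed
qed

lemma is_kl_kl:
  assumes w: "w \<in> Sym n"
  shows "is_kl n w (kl n w)"
proof -
  have eq: "(C \<in> carrier (hecke n) \<and> hecke_bar n C = C \<and>
     (\<exists>p. (\<forall>y\<in>Sym n - {w}. p y \<in> vZv) \<and> C = H w + (\<Sum>y\<in>Sym n - {w}. hscale (p y) (H y)))) \<longleftrightarrow> is_kl n w C"
    (is "?A C \<longleftrightarrow> _") for C
  proof
    assume "?A C"
    then obtain p where p: "C \<in> hecke_carrier n" "hecke_bar n C = C" "\<forall>y\<in>Sym n - {w}. p y \<in> vZv"
      "C = H w + (\<Sum>y\<in>Sym n - {w}. hscale (p y) (H y))" by auto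
    have "lookup (\<Sum>y\<in>Sym n - {w}. hscale (p y) (H y)) x =
        (\<Sum>y\<in>Sym n - {w}. if y = x then p y else 0)" for x
      unfolding lookup_sum by (intro sum.cong) (auto simp: lookup_H)
    then have "lookup C x = (if x = w then 1 else if x \<in> Sym n then p x else 0)" for x
      unfolding p(4) lookup_add lookup_H by (simp add: sum.delta)
    then show "is_kl n w C" using p(1-3) by (auto simp: is_kl_def)
  next
    assume C: "is_kl n w C"
    then have "C = (\<Sum>y\<in>Sym n. hscale (lookup C y) (H y))"
      using hecke_expand by (simp add: is_kl_def)
    also have "\<dots> = H w + (\<Sum>y\<in>Sym n - {w}. hscale (lookup C y) (H y))"
      using sum.remove[OF finite_Sym w, of "\<lambda>y. hscale (lookup C y) (H y)"] C
      by (simp add: is_kl_def)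
    finally show "?A C" using C by (auto simp: is_kl_def intro!: exI[of _ "lookup C"])
  qed
  obtain C where "is_kl n w C" using is_kl_exists[OF w] by blast
  then show ?thesis
    unfolding kl_def eq using theI[of "is_kl n w" C] is_kl_unique by blast
qed

lemma kl_carrier [simp]: "w \<in> Sym n \<Longrightarrow> kl n w \<in> hecke_carrier n"
  using is_kl_kl by (simp add: is_kl_def)

lemma kl_triangular:
  assumes "w \<in> Sym n" "x \<in> Sym n" "ell w \<le> ell x"
  shows "lookup (kl n w) x = (if x = w then 1 else 0)"
proof -
  obtain C where C: "is_kl n w C" "\<forall>x\<in>Sym n. x \<noteq> w \<longrightarrow> ell w \<le> ell x \<longrightarrow> lookup C x = 0"
    using is_kl_exists[OF assms(1)] by blast
  have "kl n w = C" using is_kl_unique is_kl_kl[OF assms(1)] C(1) by blast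
  then show ?thesis using C assms by (auto simp: is_kl_def)
qed

text \<open>By uniqueness the element built in \<open>is_kl_step\<close> is the basis element, so
  the construction doubles as the multiplication formula.\<close>

lemma kl_op_kl_asc:
  assumes i: "i \<in> {1..<n}" and u: "u \<in> Sym n" "\<not> ldesc i u"
  shows "kl_op n i (kl n u) = kl n (lmul i u) +
    (\<Sum>y\<in>{y\<in>Sym n. ldesc i y \<and> ell y < ell u}. hscale (coef1 (lookup (kl n u) y)) (kl n y))"
proof -
  have "is_kl n y (kl n y) \<and> (\<forall>x\<in>Sym n. x \<noteq> y \<longrightarrow> ell y \<le> ell x \<longrightarrow> lookup (kl n y) x = 0)"
    if "y \<in> Sym n" for y
    using is_kl_kl[OF that] kl_triangular[OF that] by simp
  from is_kl_step[OF i u, of "kl n"] this is_kl_unique is_kl_kl[OF lmul_Sym[OF u(1) i]]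
  have "kl n (lmul i u) = kl_op n i (kl n u) -
    (\<Sum>y\<in>{y\<in>Sym n. ldesc i y \<and> ell y < ell u}. hscale (coef1 (lookup (kl n u) y)) (kl n y))"
    by blast
  then show ?thesis by simp
qed

text \<open>\<open>kl n y\<close> is an image under \<open>kl_op n i\<close> minus multiples of
  shorter basis elements with descent \<open>i\<close>. The operator acts by \<open>vv\<close> on
  its image, and on the rest by induction.\<close>

lemma kl_op_kl_desc:
  assumes i: "i \<in> {1..<n}" and y: "y \<in> Sym n" "ldesc i y"
  shows "kl_op n i (kl n y) = hscale vv (kl n y)"
  using y
proof (induction "ell y" arbitrary: y rule: less_induct)
  case less
  define u where "u = lmul i y"
  have u: "u \<in> Sym n" "\<not> ldesc i u" "y = lmul i u"
    using lmul_Sym[OF less.prems(1) i] ldesc_lmul[OF less.prems(1)] less.prems(2) by (simp_all add: u_def)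
  let ?S = "{y\<in>Sym n. ldesc i y \<and> ell y < ell u}"
  let ?c = "\<lambda>z. coef1 (lookup (kl n u) z)"
  have ky: "kl n y = kl_op n i (kl n u) - (\<Sum>z\<in>?S. hscale (?c z) (kl n z))"
    using kl_op_kl_asc[OF i u(1,2)] u(3) by simp
  have sc: "(\<Sum>z\<in>?S. hscale (?c z) (kl n z)) \<in> hecke_carrier n" by (intro hecke_carrier_sum) auto
  have "kl_op n i (\<Sum>z\<in>?S. hscale (?c z) (kl n z)) = (\<Sum>z\<in>?S. kl_op n i (hscale (?c z) (kl n z)))"
    by (rule hlinear_sum[OF hlinear_kl_op[OF i]]) auto
  also have "\<dots> = (\<Sum>z\<in>?S. hscale vv (hscale (?c z) (kl n z)))"
  proof (rule sum.cong)
    fix z assume z: "z \<in> ?S"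
    have "ell y = Suc (ell u)" using ell_lmul[OF u(1,2)] u(3) by simp
    then have "kl_op n i (kl n z) = hscale vv (kl n z)" using less.hyps[of z] z by simp
    then show "kl_op n i (hscale (?c z) (kl n z)) = hscale vv (hscale (?c z) (kl n z))"
      using z i by (simp add: kl_op_hscale mult.commute)
  qed simp
  also have "\<dots> = hscale vv (\<Sum>z\<in>?S. hscale (?c z) (kl n z))"
    by (rule hs.scale_sum_right[symmetric])
  finally show ?case
    unfolding ky using kl_op_diff[OF i _ sc, of "kl_op n i (kl n u)"] kl_op_carrier[OF i kl_carrier[OF u(1)]]
      kl_op_kl_op[OF i kl_carrier[OF u(1)]] by (simp only: hs.scale_right_diff_distrib)
qed

subsection \<open>Coefficients with respect to the Kazhdan-Lusztig basis\<close>

lemma kl_independent: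
  assumes "(\<Sum>y\<in>Sym n. hscale (a y) (kl n y)) = 0" "x \<in> Sym n"
  shows "a x = 0"
proof (rule ccontr)
  assume "a x \<noteq> 0"
  define S where "S = {y \<in> Sym n. a y \<noteq> 0}"
  have "S \<noteq> {}" "finite S" using \<open>a x \<noteq> 0\<close> assms(2) by (auto simp: S_def)
  then obtain z where z: "z \<in> S" "\<And>y. y \<in> S \<Longrightarrow> ell y \<le> ell z"
    using exists_longest by metis
  then have zs: "z \<in> Sym n" by (simp add: S_def)
  have "0 = (\<Sum>y\<in>Sym n. a y * lookup (kl n y) z)"
    using arg_cong[OF assms(1), of "\<lambda>h. lookup h z"] by (simp add: lookup_sum)
  also have "\<dots> = (\<Sum>y\<in>Sym n. if y = z then a y else 0)"
  proof (rule sum.cong)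
    fix y assume y: "y \<in> Sym n"
    show "a y * lookup (kl n y) z = (if y = z then a y else 0)"
      using kl_triangular[OF y zs] z(2)[of y] y by (cases "y \<in> S") (auto simp: S_def)
  qed simp
  also have "\<dots> = a z" using zs by simp
  finally show False using z by (simp add: S_def)
qed

lemma H_in_kl_span: "w \<in> Sym n \<Longrightarrow> \<exists>a. H w = (\<Sum>y\<in>Sym n. hscale (a y) (kl n y))"
proof (induction "ell w" arbitrary: w rule: less_induct)
  case less
  let ?S = "{y \<in> Sym n. ell y < ell w}" and ?L = "lookup (kl n w)"
  have "\<forall>y\<in>?S. \<exists>a. H y = (\<Sum>z\<in>Sym n. hscale (a z) (kl n z))" using less.hyps by blast
  from bchoice[OF this] obtain A where A: "\<forall>y\<in>?S. H y = (\<Sum>z\<in>Sym n. hscale (A y z) (kl n z))" ..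
  have "kl n w = (\<Sum>y\<in>Sym n. hscale (?L y) (H y))" using hecke_expand less.prems by simp
  also have "\<dots> = hscale (?L w) (H w) + (\<Sum>y\<in>Sym n - {w}. hscale (?L y) (H y))"
    using sum.remove[OF finite_Sym less.prems] by blast
  also have "(\<Sum>y\<in>Sym n - {w}. hscale (?L y) (H y)) = (\<Sum>y\<in>?S. hscale (?L y) (H y))"
    by (rule sum.mono_neutral_right) (use kl_triangular[OF less.prems] in \<open>auto simp: not_less\<close>)
  also have "\<dots> = (\<Sum>y\<in>?S. \<Sum>z\<in>Sym n. hscale (?L y * A y z) (kl n z))"
    using A by (intro sum.cong) (simp_all add: hs.scale_sum_right)
  also have "\<dots> = (\<Sum>z\<in>Sym n. hscale (\<Sum>y\<in>?S. ?L y * A y z) (kl n z))"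
    by (subst sum.swap) (simp add: hs.scale_sum_left)
  finally have e: "kl n w = hscale (?L w) (H w) + (\<Sum>z\<in>Sym n. hscale (\<Sum>y\<in>?S. ?L y * A y z) (kl n z))" .
  have "?L w = 1" using kl_triangular[OF less.prems less.prems] by simp
  moreover have "b = k - X" if "k = hscale c b + X" "c = 1" for b k X c using that by simp
  ultimately have "H w = kl n w - (\<Sum>z\<in>Sym n. hscale (\<Sum>y\<in>?S. ?L y * A y z) (kl n z))"
    using e by blast
  also have "kl n w = (\<Sum>z\<in>Sym n. hscale (if z = w then 1 else 0) (kl n z))"
    using less.prems by (simp add: if_distrib[of "\<lambda>c. hscale c _"] cong: if_cong)
  finally show ?case by (auto simp: sum_subtractf[symmetric] hs.scale_left_diff_distrib[symmetric])
qed

text \<open>Unique on \<open>Sym n\<close> by \<open>kl_independent\<close>; values elsewhere are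
  left open by the choice.\<close>

definition kl_coeff :: "nat \<Rightarrow> hecke \<Rightarrow> (nat \<Rightarrow> nat) \<Rightarrow> laurent" where
  "kl_coeff n h = (SOME a. h = (\<Sum>y\<in>Sym n. hscale (a y) (kl n y)))"

lemma kl_expand:
  assumes "h \<in> hecke_carrier n"
  shows "h = (\<Sum>y\<in>Sym n. hscale (kl_coeff n h y) (kl n y))"
proof -
  have "\<forall>w\<in>Sym n. \<exists>a. H w = (\<Sum>y\<in>Sym n. hscale (a y) (kl n y))" using H_in_kl_span by blast
  from bchoice[OF this] obtain A where A: "\<forall>w\<in>Sym n. H w = (\<Sum>y\<in>Sym n. hscale (A w y) (kl n y))" ..
  have "h = (\<Sum>w\<in>Sym n. hscale (lookup h w) (H w))" by (rule hecke_expand[OF assms])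
  also have "\<dots> = (\<Sum>w\<in>Sym n. \<Sum>y\<in>Sym n. hscale (lookup h w * A w y) (kl n y))"
    using A by (intro sum.cong) (simp_all add: hs.scale_sum_right)
  also have "\<dots> = (\<Sum>y\<in>Sym n. hscale (\<Sum>w\<in>Sym n. lookup h w * A w y) (kl n y))"
    by (subst sum.swap) (simp add: hs.scale_sum_left)
  finally have "\<exists>a. h = (\<Sum>y\<in>Sym n. hscale (a y) (kl n y))"
    by (rule exI[where x = "\<lambda>y. \<Sum>w\<in>Sym n. lookup h w * A w y"])
  then show ?thesis unfolding kl_coeff_def by (rule someI_ex)
qed

lemma hlinear_kl_expand:
  assumes "hlinear n F" "h \<in> hecke_carrier n"
  shows "F h = (\<Sum>y\<in>Sym n. hscale (kl_coeff n h y) (F (kl n y)))"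
proof -
  have "F h = F (\<Sum>y\<in>Sym n. hscale (kl_coeff n h y) (kl n y))"
    using kl_expand[OF assms(2)] by simp
  also have "\<dots> = (\<Sum>y\<in>Sym n. F (hscale (kl_coeff n h y) (kl n y)))"
    by (rule hlinear_sum[OF assms(1)]) simp
  also have "\<dots> = (\<Sum>y\<in>Sym n. hscale (kl_coeff n h y) (F (kl n y)))"
    using assms(1) by (simp add: hlinear_def)
  finally show ?thesis .
qed

lemma kl_coeff_unique:
  assumes "h = (\<Sum>y\<in>Sym n. hscale (a y) (kl n y))" "x \<in> Sym n"
  shows "kl_coeff n h x = a x"
proof -
  have "h \<in> hecke_carrier n" unfolding assms(1) by (intro hecke_carrier_sum) simp
  then have "(\<Sum>y\<in>Sym n. hscale (kl_coeff n h y - a y) (kl n y)) = 0"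
    using kl_expand assms(1) by (simp add: hs.scale_left_diff_distrib sum_subtractf)
  then show ?thesis using kl_independent[OF _ assms(2)] by fastforce
qed

lemma kl_coeff_add:
  assumes "a \<in> hecke_carrier n" "b \<in> hecke_carrier n" "x \<in> Sym n"
  shows "kl_coeff n (a + b) x = kl_coeff n a x + kl_coeff n b x"
  by (rule kl_coeff_unique[OF _ assms(3)])
    (use kl_expand[OF assms(1)] kl_expand[OF assms(2)] in \<open>simp add: hs.scale_left_distrib sum.distrib\<close>)

lemma kl_coeff_hscale:
  assumes "a \<in> hecke_carrier n" "x \<in> Sym n"
  shows "kl_coeff n (hscale c a) x = c * kl_coeff n a x"
proof (rule kl_coeff_unique[OF _ assms(2)])
  have "hscale c a = hscale c (\<Sum>y\<in>Sym n. hscale (kl_coeff n a y) (kl n y))"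
    using kl_expand[OF assms(1)] by simp
  then show "hscale c a = (\<Sum>y\<in>Sym n. hscale (c * kl_coeff n a y) (kl n y))"
    by (simp add: hs.scale_sum_right)
qed

lemma kl_coeff_kl:
  assumes "w \<in> Sym n" "x \<in> Sym n"
  shows "kl_coeff n (kl n w) x = (if x = w then 1 else 0)"
  by (rule kl_coeff_unique[OF _ assms(2)])
    (use assms in \<open>simp add: if_distrib[of "\<lambda>c. hscale c _"] cong: if_cong\<close>)

lemma kl_coeff_0: "x \<in> Sym n \<Longrightarrow> kl_coeff n 0 x = 0"
  by (rule kl_coeff_unique[where a = "\<lambda>_. 0"]) simp_all

lemma kl_coeff_diff:
  assumes "a \<in> hecke_carrier n" "b \<in> hecke_carrier n" "x \<in> Sym n"
  shows "kl_coeff n (a - b) x = kl_coeff n a x - kl_coeff n b x"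
  using kl_coeff_add[of "a - b" n b x] assms by simp

lemma kl_coeff_sum:
  assumes "\<And>i. i \<in> A \<Longrightarrow> f i \<in> hecke_carrier n" "x \<in> Sym n"
  shows "kl_coeff n (sum f A) x = (\<Sum>i\<in>A. kl_coeff n (f i) x)"
  using assms(1)
proof (induction A rule: infinite_finite_induct)
  case (insert a A)
  then have "sum f A \<in> hecke_carrier n" by (intro hecke_carrier_sum) auto
  then show ?case using insert assms(2) by (simp add: kl_coeff_add)
qed (simp_all add: kl_coeff_0 assms(2))

section \<open>Right ideals given by left descents\<close>

text \<open>The span of the basis elements with a given left descent is the eigenspace of a left
  multiplication, hence a right ideal.\<close>

definition desc_ideal :: "nat \<Rightarrow> nat \<Rightarrow> hecke set" where
  "desc_ideal n i = {h \<in> hecke_carrier n. \<forall>y\<in>Sym n. \<not> ldesc i y \<longrightarrow> kl_coeff n h y = 0}"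

lemma desc_ideal_carrier: "h \<in> desc_ideal n i \<Longrightarrow> h \<in> hecke_carrier n"
  by (simp add: desc_ideal_def)

lemma kl_desc_ideal: "w \<in> Sym n \<Longrightarrow> ldesc i w \<Longrightarrow> kl n w \<in> desc_ideal n i"
  by (auto simp: desc_ideal_def kl_coeff_kl)

lemma kl_coeff_kl_op_kl:
  assumes i: "i \<in> {1..<n}" and y: "y \<in> Sym n" "\<not> ldesc i y" and z: "z \<in> Sym n"
  shows "kl_coeff n (kl_op n i (kl n y)) z = (if z = lmul i y then 1 else 0) +
    (if ldesc i z \<and> ell z < ell y then coef1 (lookup (kl n y) z) else 0)"
proof -
  let ?S = "{x\<in>Sym n. ldesc i x \<and> ell x < ell y}" and ?c = "\<lambda>x. coef1 (lookup (kl n y) x)"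
  have "kl_coeff n (\<Sum>x\<in>?S. hscale (?c x) (kl n x)) z = (\<Sum>x\<in>?S. ?c x * (if z = x then 1 else 0))"
    by (subst kl_coeff_sum[OF _ z]) (use z in \<open>auto simp: kl_coeff_hscale kl_coeff_kl intro!: sum.cong\<close>)
  also have "\<dots> = (\<Sum>x\<in>?S. if x = z then ?c x else 0)" by (intro sum.cong) auto
  also have "\<dots> = (if z \<in> ?S then ?c z else 0)" by (simp add: sum.delta)
  finally have "kl_coeff n (\<Sum>x\<in>?S. hscale (?c x) (kl n x)) z = (if z \<in> ?S then ?c z else 0)" .
  moreover have "(\<Sum>x\<in>?S. hscale (?c x) (kl n x)) \<in> hecke_carrier n" by (intro hecke_carrier_sum) auto
  ultimately show ?thesis
    unfolding kl_op_kl_asc[OF i y] using lmul_Sym[OF y(1) i] z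
    by (simp add: kl_coeff_add kl_coeff_kl)
qed

lemma kl_coeff_kl_op:
  assumes i: "i \<in> {1..<n}" and h: "h \<in> hecke_carrier n" and z: "z \<in> Sym n"
  shows "kl_coeff n (kl_op n i h) z = (\<Sum>y\<in>Sym n. kl_coeff n h y * kl_coeff n (kl_op n i (kl n y)) z)"
proof -
  note e = hlinear_kl_expand[OF hlinear_kl_op[OF i] h]
  show ?thesis
    unfolding e using kl_op_carrier[OF i] z
    by (subst kl_coeff_sum[OF _ z]) (simp_all add: kl_coeff_hscale)
qed

lemma kl_op_desc_ideal:
  assumes i: "i \<in> {1..<n}" and h: "h \<in> hecke_carrier n"
  shows "kl_op n i h \<in> desc_ideal n i"
proof -
  have "kl_coeff n (kl_op n i (kl n y)) z = 0" if "y \<in> Sym n" "z \<in> Sym n" "\<not> ldesc i z" for y z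
  proof (cases "ldesc i y")
    case True
    then have "z \<noteq> y" using that by auto
    then show ?thesis using kl_op_kl_desc[OF i that(1) True] that by (simp add: kl_coeff_hscale kl_coeff_kl)
  next
    case False
    then have "z \<noteq> lmul i y" using ldesc_lmul[OF that(1), of i] that by auto
    then show ?thesis using kl_coeff_kl_op_kl[OF i that(1) False that(2)] that by simp
  qed
  then show ?thesis
    using kl_coeff_kl_op[OF i h] kl_op_carrier[OF i h] by (simp add: desc_ideal_def)
qed

text \<open>For the converse, \<open>hscale vv h\<close> is an image under \<open>kl_op n i\<close>,
  hence in the ideal, and the nonzero \<open>vv\<close> cancels because Laurent polynomials have no
  zero divisors.\<close>

lemma desc_ideal_iff:
  assumes i: "i \<in> {1..<n}" and h: "h \<in> hecke_carrier n"
  shows "h \<in> desc_ideal n i \<longleftrightarrow> kl_op n i h = hscale vv h"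
proof
  assume h': "h \<in> desc_ideal n i"
  have "kl_op n i h = (\<Sum>y\<in>Sym n. hscale (kl_coeff n h y) (kl_op n i (kl n y)))"
    by (rule hlinear_kl_expand[OF hlinear_kl_op[OF i] h])
  also have "\<dots> = (\<Sum>y\<in>Sym n. hscale vv (hscale (kl_coeff n h y) (kl n y)))"
  proof (rule sum.cong)
    fix y assume y: "y \<in> Sym n"
    show "hscale (kl_coeff n h y) (kl_op n i (kl n y)) = hscale vv (hscale (kl_coeff n h y) (kl n y))"
      using kl_op_kl_desc[OF i y] h' y by (cases "ldesc i y") (simp_all add: desc_ideal_def mult.commute)
  qed simp
  also have "\<dots> = hscale vv h" using kl_expand[OF h] by (metis hs.scale_sum_right)
  finally show "kl_op n i h = hscale vv h" .
next
  assume "kl_op n i h = hscale vv h"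
  then have "hscale vv h \<in> desc_ideal n i" using kl_op_desc_ideal[OF i h] by simp
  then have "vv * kl_coeff n h y = 0" if "y \<in> Sym n" "\<not> ldesc i y" for y
    using that kl_coeff_hscale[OF h that(1), of vv] unfolding desc_ideal_def by auto
  then show "h \<in> desc_ideal n i" using vv_nonzero h by (auto simp: desc_ideal_def)
qed

lemma desc_ideal_hmult:
  assumes i: "i \<in> {1..<n}" and h: "h \<in> desc_ideal n i" and g: "g \<in> hecke_carrier n"
  shows "hmult n h g \<in> desc_ideal n i"
proof -
  have hc: "h \<in> hecke_carrier n" using h by (rule desc_ideal_carrier)
  have "kl_op n i (hmult n h g) = hscale vv (hmult n h g)"
    unfolding kl_op_hmult[OF i hc g] using desc_ideal_iff[OF i hc] h hmult_hscale(1)[OF hc g] by simp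
  then show ?thesis using desc_ideal_iff[OF i] hc g by simp
qed

section \<open>Star operations and structure constants\<close>

lemma ldesc_lmul_swap:
  assumes "w \<in> Sym n" "i = Suc j \<or> j = Suc i"
  shows "ldesc i (lmul j w) \<longleftrightarrow> ldesc j (lmul i w)"
  using assms(2) unfolding ldesc_lmul_srefl[OF assms(1)] by (auto simp: srefl_def transpose_def)

text \<open>For adjacent indices, applying \<open>srefl j\<close> and then \<open>srefl i\<close>
  carries the simple root of \<open>i\<close> to that of \<open>j\<close>.\<close>

lemma ldesc_braid:
  assumes "w \<in> Sym n" "i \<in> {1..<n}" "i = Suc j \<or> j = Suc i"
  shows "ldesc i (lmul j (lmul i w)) \<longleftrightarrow> ldesc j w"
  using assms(3) unfolding ldesc_lmul_srefl[OF lmul_Sym[OF assms(1,2)]] inv_lmul[OF assms(1)]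
  by (auto simp: srefl_def transpose_def rmul_def ldesc_def)

lemma star_desc:
  assumes "w \<in> Sym n" "i = Suc j \<or> j = Suc i" "ldesc i w" "\<not> ldesc j w"
  shows "ldesc j (star i j w)" "\<not> ldesc i (star i j w)"
  using ldesc_lmul_swap[OF assms(1,2)] ldesc_lmul[OF assms(1)] assms(3,4) by (auto simp: star_def)

text \<open>Only the mixed case, with one permutation multiplied by \<open>srefl i\<close> and the
  other by \<open>srefl j\<close>, needs an argument; \<open>ldesc_braid\<close> contradicts the
  descents there.\<close>

lemma star_inj:
  assumes x: "x \<in> Sym n" "ldesc i x" "\<not> ldesc j x" and y: "y \<in> Sym n" "ldesc i y" "\<not> ldesc j y"
    and ij: "i \<in> {1..<n}" "i = Suc j \<or> j = Suc i" and e: "star i j x = star i j y"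
  shows "x = y"
proof -
  have no: False if u: "u \<in> Sym n" "\<not> ldesc j u" and z: "z \<in> Sym n" "ldesc i z" and "lmul i u = lmul j z" for u z
  proof -
    have "z = lmul j (lmul i u)" using that by simp
    then show False using ldesc_braid[OF u(1) ij] u(2) z(2) by simp
  qed
  show ?thesis
    using e no[OF x(1,3) y(1,2)] no[OF y(1,3) x(1,2)] unfolding star_def
    by (auto split: if_splits simp: lmul_eq_iff dest: sym)
qed

text \<open>The coefficients at \<open>z\<close> of both sides of the eigenvalue equation
  \<open>kl_op_kl_desc\<close> are compared.\<close>

lemma lookup_kl_asc:
  assumes i: "i \<in> {1..<n}" and y: "y \<in> Sym n" "ldesc i y" and z: "z \<in> Sym n" "\<not> ldesc i z"
  shows "lookup (kl n y) z = vpow 1 * lookup (kl n y) (lmul i z)"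
proof -
  let ?a = "lookup (kl n y) z" and ?b = "lookup (kl n y) (lmul i z)"
  have "?b + vpow 1 * ?a = vv * ?a"
    using arg_cong[OF kl_op_kl_desc[OF i y], of "\<lambda>h. lookup h z"]
      lookup_kl_op[OF i z(1) kl_carrier[OF y(1)]] z(2) by (simp add: vdesc_def)
  then have "?b = vpow (- 1) * ?a" by (simp add: algebra_simps)
  then have "vpow 1 * ?b = (vpow 1 * vpow (- 1)) * ?a" by (simp only: mult.assoc)
  then show ?thesis by (simp add: vpow_mult)
qed

text \<open>Modulo the right ideal for \<open>i\<close>, left multiplication by \<open>H\<^sub>j + v\<close> realises the star operation.\<close>

lemma kl_op_star:
  assumes i: "i \<in> {1..<n}" and j: "j \<in> {1..<n}" and ij: "i = Suc j \<or> j = Suc i"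
    and y: "y \<in> Sym n" "ldesc i y" "\<not> ldesc j y"
  shows "kl_op n j (kl n y) - kl n (star i j y) \<in> desc_ideal n i"
proof -
  have sy: "star i j y \<in> Sym n" using star_Sym[OF y(1) i j] .
  have "kl_coeff n (kl_op n j (kl n y)) z = (if z = star i j y then 1 else 0)"
    if z: "z \<in> Sym n" "\<not> ldesc i z" for z
  proof (cases "ldesc j z")
    case False
    then have "z \<noteq> star i j y" using star_desc[OF y(1) ij y(2,3)] by auto
    moreover have "kl_coeff n (kl_op n j (kl n y)) z = 0"
      using kl_op_desc_ideal[OF j kl_carrier[OF y(1)]] z(1) False by (simp add: desc_ideal_def)
    ultimately show ?thesis by simp
  next
    case True
    let ?p = "lookup (kl n y)"
    \<comment> \<open>The coefficient at \<open>z\<close> is v times that at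
      \<open>lmul i z\<close>, so its linear term is the constant term there; a coefficient of
      \<open>kl n y\<close> has constant term 0 except at \<open>y\<close>.\<close>
    have "coef1 (?p z) = (if z = lmul i y then 1 else 0)"
    proof -
      have iz: "lmul i z \<in> Sym n" using lmul_Sym[OF z(1) i] .
      have "lookup (?p (lmul i z)) 0 = (if lmul i z = y then 1 else 0)"
        using is_kl_kl[OF y(1)] iz by (auto simp: is_kl_def vZv_iff)
      then show ?thesis
        unfolding lookup_kl_asc[OF i y(1,2) z] by (auto simp: coef1_def lmul_eq_iff)
    qed
    moreover have "ell z < ell y" if "z = lmul i y" using ell_lmul_desc[OF y(1,2)] that by simp
    ultimately have "kl_coeff n (kl_op n j (kl n y)) z =
        (if z = lmul j y then 1 else 0) + (if z = lmul i y then 1 else 0)"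
      unfolding kl_coeff_kl_op_kl[OF j y(1,3) z(1)] using True by auto
    \<comment> \<open>Of the candidates \<open>lmul i y\<close> and \<open>lmul j y\<close> exactly
      one has descent \<open>j\<close> without descent \<open>i\<close>, and it is
      \<open>star i j y\<close>.\<close>
    then show ?thesis
      using True z(2) ldesc_lmul_swap[OF y(1) ij] by (auto simp: star_def)
  qed
  then show ?thesis
    using kl_op_carrier[OF j kl_carrier[OF y(1)]] sy
    by (auto simp: desc_ideal_def kl_coeff_diff kl_coeff_kl)
qed

text \<open>Left multiplication by the element of \<open>srefl j\<close> commutes with right
  multiplication by \<open>g\<close> and acts as the star operation modulo the right ideal for
  \<open>i\<close>. Coefficients at elements without descent \<open>i\<close> do not see this
  ideal.\<close>

lemma star_structure_constants:
  assumes i: "i \<in> {1..<n}" and j: "j \<in> {1..<n}" and ij: "i = Suc j \<or> j = Suc i"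
    and x: "x \<in> Sym n" "ldesc i x" "\<not> ldesc j x" and y: "y \<in> Sym n" "ldesc i y" "\<not> ldesc j y"
    and g: "g \<in> hecke_carrier n"
  shows "kl_coeff n (hmult n (kl n (star i j y)) g) (star i j x) = kl_coeff n (hmult n (kl n y) g) x"
proof -
  let ?y = "star i j y" and ?x = "star i j x"
  have sx: "?x \<in> Sym n" and sy: "?y \<in> Sym n" using star_Sym x y i j by auto
  have nx: "\<not> ldesc i ?x" using star_desc[OF x(1) ij x(2,3)] by simp
  define h where "h = hmult n (kl n y) g"
  define e where "e = kl_op n j (kl n y) - kl n ?y"
  have e: "e \<in> desc_ideal n i" unfolding e_def by (rule kl_op_star[OF i j ij y])
  have ec: "e \<in> hecke_carrier n" using e by (rule desc_ideal_carrier)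
  have h: "h \<in> desc_ideal n i" unfolding h_def by (rule desc_ideal_hmult[OF i kl_desc_ideal[OF y(1,2)] g])
  have hc: "h \<in> hecke_carrier n" using h by (rule desc_ideal_carrier)
  have "kl_op n j h = hmult n (kl n ?y + e) g"
    unfolding h_def e_def using kl_op_hmult[OF j kl_carrier[OF y(1)] g] by simp
  also have "\<dots> = hmult n (kl n ?y) g + hmult n e g"
    using sy ec g by (simp add: hmult_add_left)
  finally have "kl_coeff n (kl_op n j h) ?x = kl_coeff n (hmult n (kl n ?y) g) ?x + kl_coeff n (hmult n e g) ?x"
    using sy sx ec g by (simp add: kl_coeff_add)
  moreover have "kl_coeff n (hmult n e g) ?x = 0"
    using desc_ideal_hmult[OF i e g] sx nx by (simp add: desc_ideal_def)
  \<comment> \<open>Basis elements with both descents stay in the ideal for \<open>i\<close>; those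
    with descent \<open>i\<close> only go to distinct star images modulo it. So the coefficient at
    \<open>?x\<close> comes from \<open>x\<close> alone.\<close>
  moreover have "kl_coeff n (kl_op n j h) ?x = kl_coeff n h x"
  proof -
    have "kl_coeff n h u * kl_coeff n (kl_op n j (kl n u)) ?x = (if u = x then kl_coeff n h x else 0)"
      if u: "u \<in> Sym n" for u
    proof (cases "ldesc i u")
      case False
      then show ?thesis using h u x by (auto simp: desc_ideal_def)
    next
      case iu: True
      show ?thesis
      proof (cases "ldesc j u")
        case True
        have "u \<noteq> ?x" "u \<noteq> x" using nx iu x True by auto
        then show ?thesis using kl_op_kl_desc[OF j u True] u sx by (simp add: kl_coeff_hscale kl_coeff_kl)
      next
        case False
        have su: "star i j u \<in> Sym n" using star_Sym u i j by auto
        have "kl_coeff n (kl_op n j (kl n u) - kl n (star i j u)) ?x = 0"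
          using kl_op_star[OF i j ij u iu False] sx nx by (simp add: desc_ideal_def)
        then have "kl_coeff n (kl_op n j (kl n u)) ?x = (if ?x = star i j u then 1 else 0)"
          using kl_coeff_diff[OF kl_op_carrier[OF j kl_carrier[OF u]] kl_carrier[OF su] sx]
            kl_coeff_kl[OF su sx] by simp
        moreover have "?x = star i j u \<longleftrightarrow> u = x"
          using star_inj[OF x u iu False i ij] by auto
        ultimately show ?thesis by simp
      qed
    qed
    then have "kl_coeff n (kl_op n j h) ?x = (\<Sum>u\<in>Sym n. if u = x then kl_coeff n h x else 0)"
      unfolding kl_coeff_kl_op[OF j hc sx] by (intro sum.cong) auto
    then show ?thesis using x(1) by simp
  qed
  ultimately show ?thesis by (simp add: h_def)
qed

section \<open>The dual basis\<close>

lemma trace_add: "trace_form (a + b) = trace_form a + trace_form b"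
  and trace_hscale: "trace_form (hscale c a) = c * trace_form a"
  by (simp_all add: trace_form_def lookup_add)

lemma trace_H:
  assumes "x \<in> Sym n" "y \<in> Sym n"
  shows "trace_form (hmult n (H (inv' x)) (H y)) = (if y = x then 1 else 0)"
  using assms
proof (induction arbitrary: y rule: Sym_induct)
  case id
  then show ?case using hmult_id(1)[of "H y" n] by (simp add: trace_form_def lookup_H inv_id del: id_apply)
next
  case (lmul i w)
  have c: "H (inv' w) \<in> hecke_carrier n" "H (srefl i) \<in> hecke_carrier n" "H y \<in> hecke_carrier n"
    "H (lmul i y) \<in> hecke_carrier n"
    using inv_Sym[OF lmul(2)] srefl_Sym[OF lmul(1)] lmul.prems lmul_Sym[OF lmul.prems lmul(1)] by auto
  have "hmult n (H (inv' (lmul i w))) (H y) = hmult n (H (inv' w)) (left_op n i (H y))"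
    unfolding hmult_srefl_right[OF lmul(1-3), symmetric] hmult_srefl[OF lmul(1) c(3), symmetric]
    by (rule hmult_assoc[OF c(1-3)])
  also have "\<dots> = hmult n (H (inv' w)) (H (lmul i y)) +
      hscale (if ldesc i y then qq else 0) (hmult n (H (inv' w)) (H y))"
    unfolding left_op_H[OF lmul.prems]
    using c hlinear_0[OF hlinear_hmult_right[OF c(1)]] by (simp add: hmult_add_right hmult_hscale)
  finally have "trace_form (hmult n (H (inv' (lmul i w))) (H y)) =
      (if lmul i y = w then 1 else 0) + (if ldesc i y then qq else 0) * (if y = w then 1 else 0)"
    using lmul.IH lmul.prems lmul_Sym[OF lmul.prems lmul(1)] by (simp only: trace_add trace_hscale)
  \<comment> \<open>The extra term requires \<open>y = w\<close> together with descent
    \<open>i\<close>, which \<open>w\<close> does not have.\<close>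
  then show ?case using lmul(3) by (auto simp: lmul_eq_iff)
qed

lemma trace_sum: "trace_form (sum f A) = (\<Sum>a\<in>A. trace_form (f a))"
  by (simp add: trace_form_def lookup_sum)

lemma sum_mult_delta:
  "finite A \<Longrightarrow> y \<in> A \<Longrightarrow> (\<Sum>w\<in>A. f w * (if w = y then 1 else 0)) = (f y :: 'a :: semiring_1)"
  by (subst sum.cong[OF refl, of _ _ "\<lambda>w. if w = y then f w else 0"]) auto

lemma trace_hmult_H:
  assumes "d \<in> hecke_carrier n" "y \<in> Sym n"
  shows "trace_form (hmult n d (H (inv' y))) = lookup d y"
proof -
  have "hmult n d (H (inv' y)) = (\<Sum>w\<in>Sym n. hscale (lookup d w) (hmult n (H w) (H (inv' y))))"
    using hlinear_expand[OF hlinear_hmult_left assms(1), of "H (inv' y)"] inv_Sym[OF assms(2)] by simp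
  moreover have "trace_form (hmult n (H w) (H (inv' y))) = (if w = y then 1 else 0)" if "w \<in> Sym n" for w
    using trace_H[OF inv_Sym[OF that] inv_Sym[OF assms(2)]] inv_inv_Sym[OF that] inv_inv_Sym[OF assms(2)]
    by metis
  ultimately have "trace_form (hmult n d (H (inv' y))) =
      (\<Sum>w\<in>Sym n. lookup d w * (if w = y then 1 else 0))"
    by (simp add: trace_sum trace_hscale)
  then show ?thesis using sum_mult_delta[OF finite_Sym assms(2)] by simp
qed

lemma trace_nondegenerate:
  assumes "d \<in> hecke_carrier n" "d' \<in> hecke_carrier n"
    "\<And>g. g \<in> hecke_carrier n \<Longrightarrow> trace_form (hmult n d g) = trace_form (hmult n d' g)"
  shows "d = d'"
  by (rule hecke_eqI[OF assms(1,2)])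
    (use trace_hmult_H assms inv_Sym hecke_carrier_H in metis)

lemma trace_kl_expand:
  assumes d: "d \<in> hecke_carrier n" and g: "g \<in> hecke_carrier n"
  shows "trace_form (hmult n d g) = (\<Sum>w\<in>Sym n. kl_coeff n g w * trace_form (hmult n d (kl n w)))"
proof -
  have "hmult n d g = (\<Sum>w\<in>Sym n. hscale (kl_coeff n g w) (hmult n d (kl n w)))"
    by (rule hlinear_kl_expand[OF hlinear_hmult_right[OF d] g])
  then show ?thesis by (simp add: trace_sum trace_hscale)
qed

text \<open>The dual element represents a coefficient functional; the inverse in its index comes
  from the pairing with \<open>kl n (inv' w)\<close>.\<close>

lemma dual_kl_spec:
  assumes x: "x \<in> Sym n"
  shows "dual_kl n x \<in> hecke_carrier n"
    and "g \<in> hecke_carrier n \<Longrightarrow> trace_form (hmult n (dual_kl n x) g) = kl_coeff n g (inv' x)"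
proof -
  define P where "P D \<longleftrightarrow> D \<in> carrier (hecke n) \<and>
     (\<forall>w\<in>Sym n. trace_form (hmult n D (kl n (inv' w))) = (if x = w then 1 else 0))" for D
  have ix: "inv' x \<in> Sym n" using inv_Sym[OF x] .
  have key: "D \<in> hecke_carrier n \<and> (\<forall>g\<in>hecke_carrier n. trace_form (hmult n D g) = kl_coeff n g (inv' x))"
    if "P D" for D
  proof -
    have D: "D \<in> hecke_carrier n" using that by (simp add: P_def)
    have w: "trace_form (hmult n D (kl n w)) = (if w = inv' x then 1 else 0)" if "w \<in> Sym n" for w
    proof -
      have "trace_form (hmult n D (kl n (inv' (inv' w)))) = (if x = inv' w then 1 else 0)"
        using \<open>P D\<close> inv_Sym[OF that] unfolding P_def by blast
      moreover have "x = inv' w \<longleftrightarrow> w = inv' x" using inv_inv_Sym that x by metis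
      ultimately show ?thesis using inv_inv_Sym[OF that] by simp
    qed
    have "trace_form (hmult n D g) = kl_coeff n g (inv' x)" if "g \<in> hecke_carrier n" for g
    proof -
      have "trace_form (hmult n D g) = (\<Sum>v\<in>Sym n. kl_coeff n g v * (if v = inv' x then 1 else 0))"
        unfolding trace_kl_expand[OF D that] by (intro sum.cong) (simp_all only: w)
      then show ?thesis using sum_mult_delta[OF finite_Sym ix] by simp
    qed
    then show ?thesis using D by blast
  qed
  have ex: "\<exists>D. P D"
  proof -
    \<comment> \<open>The trace against \<open>H (inv' y)\<close> reads off the coefficient at
      \<open>y\<close>, so that coefficient has to be the value of the functional on
      \<open>H (inv' y)\<close>.\<close>
    define D where "D = (\<Sum>y\<in>Sym n. hscale (kl_coeff n (H (inv' y)) (inv' x)) (H y))"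
    have D: "D \<in> hecke_carrier n" unfolding D_def by (intro hecke_carrier_sum) simp
    have L: "lookup D y = kl_coeff n (H (inv' y)) (inv' x)" if "y \<in> Sym n" for y
    proof -
      have "lookup D y = (\<Sum>z\<in>Sym n. if z = y then kl_coeff n (H (inv' z)) (inv' x) else 0)"
        unfolding D_def lookup_sum by (intro sum.cong) (auto simp: lookup_H)
      then show ?thesis using that by simp
    qed
    have H: "trace_form (hmult n D (H z)) = kl_coeff n (H z) (inv' x)" if "z \<in> Sym n" for z
      using trace_hmult_H[OF D inv_Sym[OF that]] L[OF inv_Sym[OF that]] inv_inv_Sym[OF that] by simp
    have all: "trace_form (hmult n D g) = kl_coeff n g (inv' x)" if g: "g \<in> hecke_carrier n" for g
    proof -
      have "hmult n D g = (\<Sum>z\<in>Sym n. hscale (lookup g z) (hmult n D (H z)))"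
        by (rule hlinear_expand[OF hlinear_hmult_right[OF D] g])
      then have "trace_form (hmult n D g) = (\<Sum>z\<in>Sym n. lookup g z * kl_coeff n (H z) (inv' x))"
        using H by (simp add: trace_sum trace_hscale)
      also have "\<dots> = kl_coeff n (\<Sum>z\<in>Sym n. hscale (lookup g z) (H z)) (inv' x)"
        by (subst kl_coeff_sum[OF _ ix]) (simp_all add: kl_coeff_hscale ix)
      also have "\<dots> = kl_coeff n g (inv' x)" using hecke_expand[OF g] by simp
      finally show ?thesis .
    qed
    have "trace_form (hmult n D (kl n (inv' w))) = (if x = w then 1 else 0)" if w: "w \<in> Sym n" for w
    proof -
      have "inv' x = inv' w \<longleftrightarrow> x = w" using inv_inv_Sym[OF x] inv_inv_Sym[OF w] by metis
      then show ?thesis using all[OF kl_carrier[OF inv_Sym[OF w]]] kl_coeff_kl[OF inv_Sym[OF w] ix] by simp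
    qed
    then have "P D" using D by (simp add: P_def)
    then show ?thesis by blast
  qed
  have "\<exists>!D. P D"
  proof (rule ex_ex1I[OF ex])
    fix D D' assume "P D" "P D'"
    then show "D = D'" using key[of D] key[of D'] trace_nondegenerate[of D n D'] by simp
  qed
  then have "P (dual_kl n x)" unfolding dual_kl_def P_def[abs_def] by (rule theI')
  then show "dual_kl n x \<in> hecke_carrier n"
    "g \<in> hecke_carrier n \<Longrightarrow> trace_form (hmult n (dual_kl n x) g) = kl_coeff n g (inv' x)"
    using key by blast+
qed

lemma dual_kl_hmult_eqI:
  assumes "x \<in> Sym n" "y \<in> Sym n" "x' \<in> Sym n" "y' \<in> Sym n"
    "\<And>g. g \<in> hecke_carrier n \<Longrightarrow> kl_coeff n (hmult n (kl n y) g) x = kl_coeff n (hmult n (kl n y') g) x'"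
  shows "hmult n (dual_kl n (inv' x)) (kl n y) = hmult n (dual_kl n (inv' x')) (kl n y')"
proof (rule trace_nondegenerate)
  have c: "dual_kl n (inv' x) \<in> hecke_carrier n" "dual_kl n (inv' x') \<in> hecke_carrier n"
    "kl n y \<in> hecke_carrier n" "kl n y' \<in> hecke_carrier n"
    using dual_kl_spec(1) inv_Sym assms(1-4) by auto
  then show "hmult n (dual_kl n (inv' x)) (kl n y) \<in> hecke_carrier n"
    "hmult n (dual_kl n (inv' x')) (kl n y') \<in> hecke_carrier n" by auto
  fix g assume g: "g \<in> hecke_carrier n"
  show "trace_form (hmult n (hmult n (dual_kl n (inv' x)) (kl n y)) g) =
    trace_form (hmult n (hmult n (dual_kl n (inv' x')) (kl n y')) g)"
    unfolding hmult_assoc[OF c(1,3) g] hmult_assoc[OF c(2,4) g]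
      dual_kl_spec(2)[OF inv_Sym[OF assms(1)] hmult_carrier[OF c(3) g]]
      dual_kl_spec(2)[OF inv_Sym[OF assms(3)] hmult_carrier[OF c(4) g]]
      inv_inv_Sym[OF assms(1)] inv_inv_Sym[OF assms(3)]
    by (rule assms(5)[OF g])
qed

section \<open>Transport between right cells\<close>

lemma cell_transport:
  assumes x: "x \<in> Sym n" and y: "y \<in> Sym n" and e: "insertion_tableau n x = insertion_tableau n y"
    and r: "r \<in> Sym n" and conn: "word_moves (row_word n x) (row_word n r)"
  obtains x' y' where "x' \<in> right_cell n r" "y' \<in> right_cell n r"
    "insertion_tableau n (inv' x') = insertion_tableau n (inv' x)"
    "hmult n (dual_kl n (inv' x)) (kl n y) = hmult n (dual_kl n (inv' x')) (kl n y')"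
proof -
  \<comment> \<open>Equality of the functionals that determine the two products through the trace
    form, with the starting pair held fixed.\<close>
  define Q where "Q x' y' \<longleftrightarrow> (\<forall>g\<in>hecke_carrier n.
    kl_coeff n (hmult n (kl n y) g) x = kl_coeff n (hmult n (kl n y') g) x')" for x' y'
  have e': "row_word n x = row_word n y" using row_word_eq_iff[OF x y] e by simp
  have Q0: "Q x y" by (simp add: Q_def)
  have step: "Q (star i j a) (star i j b)"
    if "a \<in> Sym n" "b \<in> Sym n" "i \<in> {1..<n}" "j \<in> {1..<n}" "i = Suc j \<or> j = Suc i"
       "ldesc i a" "\<not> ldesc j a" "ldesc i b" "\<not> ldesc j b" "Q a b" for a b i j
    using star_structure_constants[OF that(3-5) that(1,6,7) that(2,8,9)] that(10) by (simp add: Q_def)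
  obtain x' y' where xy: "x' \<in> Sym n" "y' \<in> Sym n" "row_word n x' = row_word n r" "row_word n y' = row_word n r"
    "insertion_tableau n (inv' x') = insertion_tableau n (inv' x)" "Q x' y'"
    by (rule star_transport[of x n y "row_word n r" Q, OF x y e' conn Q0 step]) blast+
  have "x' \<in> right_cell n r" "y' \<in> right_cell n r"
    using xy row_word_eq_iff[OF xy(1) r] row_word_eq_iff[OF xy(2) r] by (simp_all add: right_cell_def)
  moreover have "hmult n (dual_kl n (inv' x)) (kl n y) = hmult n (dual_kl n (inv' x')) (kl n y')"
    using xy(6) unfolding Q_def by (intro dual_kl_hmult_eqI[OF x y xy(1,2)]) blast
  ultimately show thesis using that xy(5) by blast
qed

lemma cell_involution_eq:
  assumes x: "x \<in> right_cell n w" "x \<circ> x = id"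
  shows "cell_involution n w = x"
  unfolding cell_involution_def
proof (rule the_equality)
  fix y assume y: "y \<in> right_cell n w \<and> y \<circ> y = id"
  have p: "y permutes {1..n}" "x permutes {1..n}"
    using x y by (simp_all add: right_cell_def Sym_iff)
  have "insertion_tableau n y = insertion_tableau n x" using x y by (simp add: right_cell_def)
  moreover have "insertion_tableau n (inv' y) = insertion_tableau n (inv' x)"
    using involution_iff p x y calculation by metis
  ultimately show "y = x" using insertion_tableau_pair_inj[OF p] by blast
qed (use x in simp)

text \<open>Existence comes from the same transport: from the inverse of \<open>w\<close>, star
  operations lead into the right cell of \<open>w\<close> and keep the tableau of the inverse, so
  both tableaux of the result are that of \<open>w\<close>.\<close>

lemma cell_involution:
  assumes w: "w \<in> Sym n"
  shows "cell_involution n w \<in> right_cell n w" "cell_involution n w \<circ> cell_involution n w = id"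
proof -
  have iw: "inv' w \<in> Sym n" using inv_Sym[OF w] .
  have "word_moves (row_word n (inv' w)) (row_word n w)"
    using inverse_connected[OF iw] inv_inv_Sym[OF w] by simp
  then obtain x where x: "x \<in> right_cell n w" "insertion_tableau n (inv' x) = insertion_tableau n (inv' (inv' w))"
    using cell_transport[OF iw iw refl w] by metis
  have "insertion_tableau n (inv' x) = insertion_tableau n x"
    using x inv_inv_Sym[OF w] by (simp add: right_cell_def)
  then have "x \<circ> x = id" using involution_iff[of x n] x(1) by (simp add: right_cell_def Sym_iff)
  then show "cell_involution n w \<in> right_cell n w" "cell_involution n w \<circ> cell_involution n w = id"
    using cell_involution_eq[OF x(1)] x(1) by simp_all
qed

lemma inv_involution: "x \<circ> x = id \<Longrightarrow> inv' x = x"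
  by (rule inv_unique_comp)

theorem theorem2:
  fixes n :: nat and I :: "'i set" and R :: "'i \<Rightarrow> (nat \<Rightarrow> nat) set"
  assumes "0 < n"
    and "R ` I \<subseteq> right_cells n"
    and "\<forall>C\<in>two_sided_cells n. \<exists>!X. X \<in> R ` I \<and> X \<subseteq> C"
  shows "{ev (dual_kl n (cell_involution n w) \<otimes>\<^bsub>hecke n\<^esub> kl n w) | w. w \<in> Sym n} =
         {ev (dual_kl n (inv' x) \<otimes>\<^bsub>hecke n\<^esub> kl n y) | i x y. i \<in> I \<and> (x, y) \<in> R i \<times> R i}"
    (is "?F = ?G")
proof
  show "?F \<subseteq> ?G"
  proof
    fix f assume "f \<in> ?F"
    then obtain w where w: "w \<in> Sym n" and f: "f = ev (hmult n (dual_kl n (cell_involution n w)) (kl n w))"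
      by blast
    define x where "x = cell_involution n w"
    have x: "x \<in> right_cell n w" "inv' x = x"
      using cell_involution[OF w] inv_involution by (simp_all add: x_def)
    then have xs: "x \<in> Sym n" "insertion_tableau n x = insertion_tableau n w"
      by (simp_all add: right_cell_def)
    have "two_sided_cell n w \<in> two_sided_cells n" using w by (simp add: two_sided_cells_def)
    then obtain i where i: "i \<in> I" "R i \<subseteq> two_sided_cell n w" using assms(3) by blast
    then obtain r where r: "r \<in> Sym n" "R i = right_cell n r"
      using assms(2) by (auto simp: right_cells_def)
    have "r \<in> R i" using r by (simp add: right_cell_def)
    then have "shape (insertion_tableau n r) = shape (insertion_tableau n w)"
      using i(2) by (auto simp: two_sided_cell_def)
    then have "word_moves (row_word n x) (row_word n r)"
      using same_shape_connected[OF xs(1) r(1)] xs(2) by simp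
    then obtain x' y' where "x' \<in> R i" "y' \<in> R i"
      "hmult n (dual_kl n (inv' x)) (kl n w) = hmult n (dual_kl n (inv' x')) (kl n y')"
      using cell_transport[OF xs(1) w xs(2) r(1)] r(2) by metis
    then show "f \<in> ?G" using f i(1) x(2) unfolding x_def by fastforce
  qed
  show "?G \<subseteq> ?F"
  proof
    fix f assume "f \<in> ?G"
    then obtain i x y where i: "i \<in> I" and xy: "x \<in> R i" "y \<in> R i"
      and f: "f = ev (hmult n (dual_kl n (inv' x)) (kl n y))" by blast
    obtain r where "r \<in> Sym n" "R i = right_cell n r"
      using assms(2) i by (auto simp: right_cells_def)
    then have s: "x \<in> Sym n" "y \<in> Sym n" "insertion_tableau n x = insertion_tableau n y"
      using xy by (simp_all add: right_cell_def)
    obtain x' y' where x'y': "x' \<in> right_cell n (inv' x)" "y' \<in> right_cell n (inv' x)"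
      "insertion_tableau n (inv' x') = insertion_tableau n (inv' x)"
      "hmult n (dual_kl n (inv' x)) (kl n y) = hmult n (dual_kl n (inv' x')) (kl n y')"
      using cell_transport[OF s inv_Sym[OF s(1)] inverse_connected[OF s(1)]] by metis
    have sym: "x' \<in> Sym n" "y' \<in> Sym n" using x'y'(1,2) by (simp_all add: right_cell_def)
    have inv: "x' \<circ> x' = id"
      using involution_iff[of x' n] x'y'(1,3) sym by (simp add: right_cell_def Sym_iff)
    have "x' \<in> right_cell n y'" using x'y'(1,2) by (simp add: right_cell_def)
    then have "cell_involution n y' = inv' x'"
      using cell_involution_eq[OF _ inv] inv_involution[OF inv] by simp
    then have "f = ev (hmult n (dual_kl n (cell_involution n y')) (kl n y'))"
      using f x'y'(4) by (simp only:)
    then show "f \<in> ?F" using sym(2) by blast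
  qed
qed

end
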